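(* Let $\mathbb{K}$ be a field of characteristic zero and $\alpha\in\mathbb{K}^\times$. The assignment $$\mathcal{O}^q_\alpha: I\longmapsto\big(\mathrm{Sym}(\mathbb{V}_\alpha(I)),\,d_\hbar=d+\hbar\Delta\big),$$ for $I$ a bounded open interval of $\mathbb{R}$ of length greater than $2$, with operations given by multiplication, defines a locally constant $\mathbf{D}_1^1$-algebra in cochain complexes with monoidal structure $\otimes$. That is: each $\mathcal{O}^q_\alpha(I)$ is a cochain complex; for pairwise disjoint $I_1,\dots,I_n\subset J$ the multiplication map $\mathcal{O}^q_\alpha(I_1)\otimes\cdots\otimes\mathcal{O}^q_\alpha(I_n)\to\mathcal{O}^q_\alpha(J)$ is a morphism of cochain complexes, these maps being compatible with operadic compositions, permutations and units; and for every inclusion $I\subset J$ the map $\mathcal{O}^q_\alpha(I)\to\mathcal{O}^q_\alpha(J)$ is a quasi-isomorphism.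
   Context: For a set $S$, $\mathrm{Map}(S,\mathbb{K})$ is the vector space of functions $S\to\mathbb{K}$; for $S\subset T$, functions on $S$ are identified with functions on $T$ supported in $S$ (extension by $0$). $\delta_x$ denotes the function equal to $1$ at $x$ and $0$ elsewhere. Cochain complexes have differential of degree $+1$. Scalars: either $\hbar\in\mathbb{K}^\times$ and $\mathbf{K}=\mathbb{K}$, or $\hbar$ is a formal parameter and $\mathbf{K}=\mathbb{K}[\hbar]$ or $\mathbb{K}[\![\hbar]\!]$. Scalars are extended to $\mathbf{K}$ throughout (symmetric algebras and tensor products are over $\mathbf{K}$). The operator $Q_\alpha$ on $\mathrm{Map}(\mathbb{Z},\mathbb{K})$ is $(Q_\alpha h)(x)=h(x-1)-(\alpha+\alpha^{-1})h(x)+h(x+1)$. For $a<b$ real, $\mathbb{V}_\alpha(a,b)$ is the cone of $Q_\alpha:\mathrm{Map}(\mathbb{Z}\cap(a+1,b-1),\mathbb{K})\to\mathrm{Map}(\mathbb{Z}\cap(a,b),\mathbb{K})$, i.e. the two-term complex with source in degree $-1$, target in degree $0$. An element $g$ of the source, seen in degree $-1$, is written $\overline{g}$, so the differential is $d\overline{g}=Q_\alpha g$. Thus $\mathrm{Sym}(\mathbb{V}_\alpha(a,b))$ is the free graded commutative algebra on degree $0$ generators $\delta_x$ ($x\in\mathbb{Z}\cap(a,b)$) and degree $-1$ generators $\overline{\delta}_x$ ($x\in\mathbb{Z}\cap(a+1,b-1)$); $d$ is extended to it by the Leibniz rule, and $\Delta=\sum_x\frac{\partial^2}{\partial\overline{\delta}_x\partial\delta_x}$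 (sum over integers $x\in(a+1,b-1)$). $\mathbf{D}_1^1$ is the colored operad whose colors are bounded open intervals of $\mathbb{R}$ of length greater than $2$, with exactly one operation $(I_1,\dots,I_n)\to J$ if $I_1,\dots,I_n$ are pairwise disjoint and contained in $J$, and none otherwise. The operation map multiplies in $\mathrm{Sym}(\mathbb{V}_\alpha(J))$ the images (via extension by zero) of the factors. *)

theory Defs
  imports
    Complex_Main
    "HOL-Library.Multiset"
    "HOL-Library.Poly_Mapping"
    "HOL-Combinatorics.Permutations"
    "HOL-Computational_Algebra.Polynomial"
    "HOL-Computational_Algebra.Formal_Power_Series"
    "HOL-Algebra.Module"
    "HOL-Algebra.AbelCoset"
    "HOL-Algebra.Algebraic_Closure_Type"
begin

section \<open>Modules over the scalars\<close>

text \<open>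
  The ground ring is a type of class \<^class>\<open>comm_ring_1\<close>; modules over it are modules in the
  sense of HOL-Algebra, so that submodules and quotients can be formed as carriers.
  The multiplicative fields of the \<^type>\<open>module_ext\<close> record play no role for modules.
\<close>

abbreviation scalars :: "'r::comm_ring_1 ring" where
  "scalars \<equiv> ring_of_type_algebra"

definition mod_hom ::
    "('r::comm_ring_1, 'a) module \<Rightarrow> ('r, 'b) module \<Rightarrow> ('a \<Rightarrow> 'b) set" where
  "mod_hom M N = {f. f \<in> carrier M \<rightarrow> carrier N \<and>
     (\<forall>x\<in>carrier M. \<forall>y\<in>carrier M. f (x \<oplus>\<^bsub>M\<^esub> y) = f x \<oplus>\<^bsub>N\<^esub> f y) \<and>
     (\<forall>c. \<forall>x\<in>carrier M. f (c \<odot>\<^bsub>M\<^esub> x) = c \<odot>\<^bsub>N\<^esub> f x)}"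

definition quot_mod ::
    "('r::comm_ring_1, 'a) module \<Rightarrow> 'a set \<Rightarrow> ('r, 'a set) module" where
  "quot_mod M N =
     \<lparr>carrier = a_rcosets\<^bsub>M\<^esub> N, monoid.mult = undefined, one = undefined,
      zero = N, add = set_add M,
      module.smult = (\<lambda>c U. \<Union>x\<in>U. N +>\<^bsub>M\<^esub> (c \<odot>\<^bsub>M\<^esub> x))\<rparr>"

definition scale :: "'r::comm_ring_1 \<Rightarrow> ('b \<Rightarrow>\<^sub>0 'r) \<Rightarrow> ('b \<Rightarrow>\<^sub>0 'r)" where
  "scale c f = Poly_Mapping.map ((*) c) f"

definition free_mod :: "'b set \<Rightarrow> ('r::comm_ring_1, 'b \<Rightarrow>\<^sub>0 'r) module" where
  "free_mod B =
     \<lparr>carrier = {f. Poly_Mapping.keys f \<subseteq> B}, monoid.mult = undefined, one = undefined,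
      zero = 0, add = (+), module.smult = scale\<rparr>"

text \<open>The linear map with prescribed values on the basis.\<close>

definition lin_ext ::
    "('b \<Rightarrow> ('c \<Rightarrow>\<^sub>0 'r)) \<Rightarrow> ('b \<Rightarrow>\<^sub>0 'r::comm_ring_1) \<Rightarrow> ('c \<Rightarrow>\<^sub>0 'r)" where
  "lin_ext \<phi> f = (\<Sum>b\<in>Poly_Mapping.keys f. scale (Poly_Mapping.lookup f b) (\<phi> b))"

definition ksign :: "int \<Rightarrow> 'r::comm_ring_1" where
  "ksign k = (if even k then 1 else - 1)"


section \<open>Cochain complexes\<close>

record ('r, 'a) cochain =
  Cmod :: "int \<Rightarrow> ('r, 'a) module"
  dif :: "int \<Rightarrow> 'a \<Rightarrow> 'a"

definition cochain_complex :: "('r::comm_ring_1, 'a) cochain \<Rightarrow> bool" where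
  "cochain_complex C \<longleftrightarrow>
     (\<forall>n. module scalars (Cmod C n)) \<and>
     (\<forall>n. dif C n \<in> mod_hom (Cmod C n) (Cmod C (n + 1))) \<and>
     (\<forall>n. \<forall>x\<in>carrier (Cmod C n). dif C (n + 1) (dif C n x) = \<zero>\<^bsub>Cmod C (n + 1 + 1)\<^esub>)"

definition cochain_map ::
    "('r::comm_ring_1, 'a) cochain \<Rightarrow> ('r, 'b) cochain \<Rightarrow> (int \<Rightarrow> 'a \<Rightarrow> 'b) \<Rightarrow> bool" where
  "cochain_map C D f \<longleftrightarrow>
     cochain_complex C \<and> cochain_complex D \<and>
     (\<forall>n. f n \<in> mod_hom (Cmod C n) (Cmod D n)) \<and>
     (\<forall>n. \<forall>x\<in>carrier (Cmod C n). f (n + 1) (dif C n x) = dif D n (f n x))"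

definition cocycles :: "('r::comm_ring_1, 'a) cochain \<Rightarrow> int \<Rightarrow> 'a set" where
  "cocycles C n = {x \<in> carrier (Cmod C n). dif C n x = \<zero>\<^bsub>Cmod C (n + 1)\<^esub>}"

definition coboundaries :: "('r::comm_ring_1, 'a) cochain \<Rightarrow> int \<Rightarrow> 'a set" where
  "coboundaries C n = dif C (n - 1) ` carrier (Cmod C (n - 1))"

definition cohomology ::
    "('r::comm_ring_1, 'a) cochain \<Rightarrow> int \<Rightarrow> ('r, 'a set) module" where
  "cohomology C n = quot_mod ((Cmod C n)\<lparr>carrier := cocycles C n\<rparr>) (coboundaries C n)"

definition cohomology_map ::
    "('r::comm_ring_1, 'b) cochain \<Rightarrow> (int \<Rightarrow> 'a \<Rightarrow> 'b) \<Rightarrow> int \<Rightarrow> 'a set \<Rightarrow> 'b set" where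
  "cohomology_map D f n U = (\<Union>x\<in>U. coboundaries D n +>\<^bsub>Cmod D n\<^esub> f n x)"

definition quasi_isomorphism ::
    "('r::comm_ring_1, 'a) cochain \<Rightarrow> ('r, 'b) cochain \<Rightarrow> (int \<Rightarrow> 'a \<Rightarrow> 'b) \<Rightarrow> bool" where
  "quasi_isomorphism C D f \<longleftrightarrow>
     cochain_map C D f \<and>
     (\<forall>n. bij_betw (cohomology_map D f n) (carrier (cohomology C n)) (carrier (cohomology D n)))"


section \<open>Tensor products of finite families of cochain complexes\<close>

text \<open>
  The degree \<open>k\<close> part of \<open>C\<^sub>0 \<otimes> \<dots> \<otimes> C\<^sub>n\<^sub>-\<^sub>1\<close> is the free module on the tuples of homogeneous
  elements of total degree \<open>k\<close>, modulo multilinearity. A tuple carries the degrees of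
  its entries; tuples with different degrees are different basis elements, which gives the
  direct sum over all \<open>k\<^sub>0 + \<dots> + k\<^sub>n\<^sub>-\<^sub>1 = k\<close>. The empty tensor product is the ground ring in
  degree 0.
\<close>

definition htuples ::
    "('r::comm_ring_1, 'a) cochain list \<Rightarrow> int \<Rightarrow> (int \<times> 'a) list set" where
  "htuples Cs k =
     {xs. length xs = length Cs \<and> sum_list (map fst xs) = k \<and>
          (\<forall>i<length Cs. snd (xs ! i) \<in> carrier (Cmod (Cs ! i) (fst (xs ! i))))}"

definition multilinear_relators ::
    "('r::comm_ring_1, 'a) cochain list \<Rightarrow> int \<Rightarrow> ((int \<times> 'a) list \<Rightarrow>\<^sub>0 'r) set" where
  "multilinear_relators Cs k =
     {Poly_Mapping.single (xs[i := (p, a \<oplus>\<^bsub>Cmod (Cs ! i) p\<^esub> b)]) 1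
        - Poly_Mapping.single (xs[i := (p, a)]) 1 - Poly_Mapping.single (xs[i := (p, b)]) 1
      | xs i p a b. xs \<in> htuples Cs k \<and> i < length Cs \<and> p = fst (xs ! i) \<and>
          a \<in> carrier (Cmod (Cs ! i) p) \<and> b \<in> carrier (Cmod (Cs ! i) p)} \<union>
     {Poly_Mapping.single (xs[i := (p, c \<odot>\<^bsub>Cmod (Cs ! i) p\<^esub> a)]) 1
        - Poly_Mapping.single (xs[i := (p, a)]) c
      | xs i p c a. xs \<in> htuples Cs k \<and> i < length Cs \<and> p = fst (xs ! i) \<and>
          a \<in> carrier (Cmod (Cs ! i) p)}"

definition tensor_rel ::
    "('r::comm_ring_1, 'a) cochain list \<Rightarrow> int \<Rightarrow> ((int \<times> 'a) list \<Rightarrow>\<^sub>0 'r) set" where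
  "tensor_rel Cs k =
     (\<lambda>N. submodule N scalars (free_mod (htuples Cs k))) hull multilinear_relators Cs k"

definition tensor_class ::
    "('r::comm_ring_1, 'a) cochain list \<Rightarrow> int \<Rightarrow> ((int \<times> 'a) list \<Rightarrow>\<^sub>0 'r)
      \<Rightarrow> ((int \<times> 'a) list \<Rightarrow>\<^sub>0 'r) set" where
  "tensor_class Cs k u = tensor_rel Cs k +>\<^bsub>free_mod (htuples Cs k)\<^esub> u"

text \<open>
  \<open>d(x\<^sub>0 \<otimes> \<dots> \<otimes> x\<^sub>n\<^sub>-\<^sub>1) = \<Sum>\<^sub>i \<plusminus> x\<^sub>0 \<otimes> \<dots> \<otimes> d x\<^sub>i \<otimes> \<dots> \<otimes> x\<^sub>n\<^sub>-\<^sub>1\<close>, the sign having exponent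
  \<open>|x\<^sub>0| + \<dots> + |x\<^sub>i\<^sub>-\<^sub>1|\<close>.
\<close>

definition tensor_dif_tuple ::
    "('r::comm_ring_1, 'a) cochain list \<Rightarrow> (int \<times> 'a) list \<Rightarrow> ((int \<times> 'a) list \<Rightarrow>\<^sub>0 'r)" where
  "tensor_dif_tuple Cs xs =
     (\<Sum>i<length xs. Poly_Mapping.single
        (xs[i := (fst (xs ! i) + 1, dif (Cs ! i) (fst (xs ! i)) (snd (xs ! i)))])
        (ksign (sum_list (map fst (take i xs)))))"

definition tensor ::
    "('r::comm_ring_1, 'a) cochain list \<Rightarrow> ('r, ((int \<times> 'a) list \<Rightarrow>\<^sub>0 'r) set) cochain" where
  "tensor Cs =
     \<lparr>Cmod = (\<lambda>k. quot_mod (free_mod (htuples Cs k)) (tensor_rel Cs k)),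
      dif = (\<lambda>k U. \<Union>u\<in>U. tensor_class Cs (k + 1) (lin_ext (tensor_dif_tuple Cs) u))\<rparr>"

abbreviation total_deg :: "(int \<times> 'a) list \<Rightarrow> int" where
  "total_deg xs \<equiv> sum_list (map fst xs)"

definition pure_tensor ::
    "('r::comm_ring_1, 'a) cochain list \<Rightarrow> (int \<times> 'a) list \<Rightarrow> ((int \<times> 'a) list \<Rightarrow>\<^sub>0 'r) set" where
  "pure_tensor Cs xs = tensor_class Cs (total_deg xs) (Poly_Mapping.single xs 1)"

text \<open>
  The Koszul sign \<open>\<epsilon>\<close> of the symmetry isomorphism
  \<open>x\<^sub>0 \<otimes> \<dots> \<otimes> x\<^sub>n\<^sub>-\<^sub>1 \<mapsto> \<epsilon> x\<^sub>\<sigma>\<^sub>(\<^sub>0\<^sub>) \<otimes> \<dots> \<otimes> x\<^sub>\<sigma>\<^sub>(\<^sub>n\<^sub>-\<^sub>1\<^sub>)\<close>.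
\<close>

definition perm_sign :: "(nat \<Rightarrow> nat) \<Rightarrow> (int \<times> 'a) list \<Rightarrow> 'r::comm_ring_1" where
  "perm_sign \<sigma> xs =
     (\<Prod>(i, j)\<in>{(i, j). i < j \<and> j < length xs \<and> \<sigma> j < \<sigma> i}.
        ksign (fst (xs ! \<sigma> i) * fst (xs ! \<sigma> j)))"


section \<open>The operad of intervals and its algebras\<close>

text \<open>A bounded open interval is represented by the pair of its endpoints.\<close>

type_synonym interval = "real \<times> real"

definition ival :: "interval \<Rightarrow> real set" where
  "ival I = {fst I<..<snd I}"

definition D11_colors :: "interval set" where
  "D11_colors = {I. snd I - fst I > 2}"

definition D11_op :: "interval list \<Rightarrow> interval \<Rightarrow> bool" where
  "D11_op Is J \<longleftrightarrow>
     set Is \<subseteq> D11_colors \<and> J \<in> D11_colors \<and>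
     (\<forall>i j. i < j \<and> j < length Is \<longrightarrow> ival (Is ! i) \<inter> ival (Is ! j) = {}) \<and>
     (\<forall>I\<in>set Is. ival I \<subseteq> ival J)"

text \<open>
  An algebra consists of complexes \<open>A I\<close> and, for every operation \<open>Is \<rightarrow> J\<close>, a map
  \<open>\<mu> Is J : \<Otimes> A(Is ! i) \<rightarrow> A J\<close>. Since pure tensors generate, the equations between maps
  out of tensor products (units, symmetric group actions, operadic composition) are written
  on pure tensors of homogeneous elements.
\<close>

definition D11_algebra ::
    "(interval \<Rightarrow> ('r::comm_ring_1, 'a) cochain)
      \<Rightarrow> (interval list \<Rightarrow> interval \<Rightarrow> int \<Rightarrow> ((int \<times> 'a) list \<Rightarrow>\<^sub>0 'r) set \<Rightarrow> 'a) \<Rightarrow> bool" where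
  "D11_algebra A \<mu> \<longleftrightarrow>
     (\<forall>I\<in>D11_colors. cochain_complex (A I)) \<and>
     (\<forall>Is J. D11_op Is J \<longrightarrow> cochain_map (tensor (map A Is)) (A J) (\<mu> Is J)) \<and>
     (\<forall>I\<in>D11_colors. \<forall>n. \<forall>x\<in>carrier (Cmod (A I) n).
        \<mu> [I] I n (pure_tensor [A I] [(n, x)]) = x) \<and>
     (\<forall>Is J \<sigma> k. \<forall>xs\<in>htuples (map A Is) k.
        D11_op Is J \<and> \<sigma> permutes {..<length Is} \<longrightarrow>
        \<mu> (permute_list \<sigma> Is) J k
          (perm_sign \<sigma> xs \<odot>\<^bsub>Cmod (tensor (map A (permute_list \<sigma> Is))) k\<^esub>
             pure_tensor (map A (permute_list \<sigma> Is)) (permute_list \<sigma> xs))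
        = \<mu> Is J k (pure_tensor (map A Is) xs)) \<and>
     (\<forall>Iss Js K xss.
        D11_op Js K \<and> length Iss = length Js \<and> length xss = length Js \<and>
        (\<forall>i<length Js. D11_op (Iss ! i) (Js ! i) \<and>
           xss ! i \<in> htuples (map A (Iss ! i)) (total_deg (xss ! i))) \<longrightarrow>
        \<mu> Js K (total_deg (concat xss))
          (pure_tensor (map A Js)
             (map (\<lambda>i. (total_deg (xss ! i),
                        \<mu> (Iss ! i) (Js ! i) (total_deg (xss ! i))
                          (pure_tensor (map A (Iss ! i)) (xss ! i))))
                  [0..<length Js]))
        = \<mu> (concat Iss) K (total_deg (concat xss))
            (pure_tensor (map A (concat Iss)) (concat xss)))"

definition locally_constant_D11_algebra ::
    "(interval \<Rightarrow> ('r::comm_ring_1, 'a) cochain)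
      \<Rightarrow> (interval list \<Rightarrow> interval \<Rightarrow> int \<Rightarrow> ((int \<times> 'a) list \<Rightarrow>\<^sub>0 'r) set \<Rightarrow> 'a) \<Rightarrow> bool" where
  "locally_constant_D11_algebra A \<mu> \<longleftrightarrow>
     D11_algebra A \<mu> \<and>
     (\<forall>I\<in>D11_colors. \<forall>J\<in>D11_colors. ival I \<subseteq> ival J \<longrightarrow>
        quasi_isomorphism (A I) (A J) (\<lambda>n x. \<mu> [I] J n (pure_tensor [A I] [(n, x)])))"


section \<open>The free graded commutative algebra\<close>

text \<open>
  All intervals share the generators \<open>\<delta>\<^sub>x\<close> (\<open>Ev x\<close>, degree 0) and \<open>\<delta>\<^sub>x\<close> barred (\<open>Od x\<close>,
  degree -1), \<open>x\<close> an integer. The basis element \<open>(A, S)\<close>, \<open>S\<close> finite, is the product of the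
  \<open>\<delta>\<^sub>x\<close> for \<open>x\<close> in the multiset \<open>A\<close>, followed by the product of the barred generators for \<open>x\<close> in
  \<open>S\<close> in increasing order. The algebra of an interval is spanned by the basis elements in its own
  generators, so that extension by zero is the inclusion.
\<close>

datatype gen = Ev int | Od int

type_synonym mon = "int multiset \<times> int set"

fun gen_deg :: "gen \<Rightarrow> int" where
  "gen_deg (Ev x) = 0"
| "gen_deg (Od x) = - 1"

fun mon_mult :: "mon \<Rightarrow> mon \<Rightarrow> (mon \<Rightarrow>\<^sub>0 'r::comm_ring_1)" where
  "mon_mult (A, S) (B, T) =
     (if S \<inter> T = {}
      then Poly_Mapping.single (A + B, S \<union> T) ((- 1) ^ card {(s, t). s \<in> S \<and> t \<in> T \<and> t < s})
      else 0)"

definition sym_mult ::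
    "(mon \<Rightarrow>\<^sub>0 'r::comm_ring_1) \<Rightarrow> (mon \<Rightarrow>\<^sub>0 'r) \<Rightarrow> (mon \<Rightarrow>\<^sub>0 'r)" where
  "sym_mult f g = lin_ext (\<lambda>m. lin_ext (mon_mult m) g) f"

definition sym_one :: "mon \<Rightarrow>\<^sub>0 'r::comm_ring_1" where
  "sym_one = Poly_Mapping.single ({#}, {}) 1"

definition sym_prod :: "(mon \<Rightarrow>\<^sub>0 'r::comm_ring_1) list \<Rightarrow> (mon \<Rightarrow>\<^sub>0 'r)" where
  "sym_prod fs = foldr sym_mult fs sym_one"

fun var :: "gen \<Rightarrow> (mon \<Rightarrow>\<^sub>0 'r::comm_ring_1)" where
  "var (Ev x) = Poly_Mapping.single ({#x#}, {}) 1"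
| "var (Od x) = Poly_Mapping.single ({#}, {x}) 1"

definition mon_word :: "mon \<Rightarrow> gen list" where
  "mon_word m = map Ev (sorted_list_of_multiset (fst m)) @ map Od (sorted_list_of_set (snd m))"

text \<open>
  The derivation of degree \<open>p\<close> with values \<open>D\<close> on generators, given on words in the generators by
  the graded Leibniz rule \<open>D(v w) = D(v) w + (-1)\<^bsup>p|v|\<^esup> v D(w)\<close>.
\<close>

fun word_deriv ::
    "int \<Rightarrow> (gen \<Rightarrow> (mon \<Rightarrow>\<^sub>0 'r::comm_ring_1)) \<Rightarrow> gen list \<Rightarrow> (mon \<Rightarrow>\<^sub>0 'r)" where
  "word_deriv p D [] = 0"
| "word_deriv p D (v # w) =
     sym_mult (D v) (sym_prod (map var w))
     + scale (ksign (p * gen_deg v)) (sym_mult (var v) (word_deriv p D w))"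

definition derivation ::
    "int \<Rightarrow> (gen \<Rightarrow> (mon \<Rightarrow>\<^sub>0 'r::comm_ring_1)) \<Rightarrow> (mon \<Rightarrow>\<^sub>0 'r) \<Rightarrow> (mon \<Rightarrow>\<^sub>0 'r)" where
  "derivation p D = lin_ext (\<lambda>m. word_deriv p D (mon_word m))"

definition partial :: "gen \<Rightarrow> (mon \<Rightarrow>\<^sub>0 'r::comm_ring_1) \<Rightarrow> (mon \<Rightarrow>\<^sub>0 'r)" where
  "partial v = derivation (- gen_deg v) (\<lambda>w. if w = v then sym_one else 0)"


section \<open>The algebra of quantum observables\<close>

definition zpts :: "interval \<Rightarrow> int set" where
  "zpts I = {x. fst I < real_of_int x \<and> real_of_int x < snd I}"

definition shrink :: "interval \<Rightarrow> interval" where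
  "shrink I = (fst I + 1, snd I - 1)"

definition delta :: "int \<Rightarrow> int \<Rightarrow> 'k::field" where
  "delta x y = (if y = x then 1 else 0)"

definition Q_op :: "'k::field \<Rightarrow> (int \<Rightarrow> 'k) \<Rightarrow> int \<Rightarrow> 'k" where
  "Q_op \<alpha> h x = h (x - 1) - (\<alpha> + inverse \<alpha>) * h x + h (x + 1)"

text \<open>
  Throughout, \<open>\<iota>\<close> is the embedding of the field into the extended ring of scalars.
  \<open>lin_elt \<iota> I h\<close> is the linear element \<open>\<Sum> h(x) \<delta>\<^sub>x\<close> attached to a function \<open>h\<close> on the integers
  in \<open>I\<close>, i.e. to a degree 0 element of the cone of \<open>Q\<^sub>\<alpha>\<close>.
\<close>

definition lin_elt :: "('k::field \<Rightarrow> 'r::comm_ring_1) \<Rightarrow> interval \<Rightarrow> (int \<Rightarrow> 'k) \<Rightarrow> (mon \<Rightarrow>\<^sub>0 'r)" where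
  "lin_elt \<iota> I h = (\<Sum>x\<in>zpts I. scale (\<iota> (h x)) (var (Ev x)))"

fun cone_dif ::
    "('k::field \<Rightarrow> 'r::comm_ring_1) \<Rightarrow> 'k \<Rightarrow> interval \<Rightarrow> gen \<Rightarrow> (mon \<Rightarrow>\<^sub>0 'r)" where
  "cone_dif \<iota> \<alpha> I (Ev x) = 0"
| "cone_dif \<iota> \<alpha> I (Od x) = lin_elt \<iota> I (Q_op \<alpha> (delta x))"

definition BV_laplacian :: "interval \<Rightarrow> (mon \<Rightarrow>\<^sub>0 'r::comm_ring_1) \<Rightarrow> (mon \<Rightarrow>\<^sub>0 'r)" where
  "BV_laplacian I f = (\<Sum>x\<in>zpts (shrink I). partial (Od x) (partial (Ev x) f))"

definition sym_basis :: "interval \<Rightarrow> int \<Rightarrow> mon set" where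
  "sym_basis I n =
     {(A, S). set_mset A \<subseteq> zpts I \<and> S \<subseteq> zpts (shrink I) \<and> - int (card S) = n}"

definition Oq ::
    "('k::field \<Rightarrow> 'r::comm_ring_1) \<Rightarrow> 'k \<Rightarrow> 'r \<Rightarrow> interval \<Rightarrow> ('r, mon \<Rightarrow>\<^sub>0 'r) cochain" where
  "Oq \<iota> \<alpha> hbar I =
     \<lparr>Cmod = (\<lambda>n. free_mod (sym_basis I n)),
      dif = (\<lambda>n f. derivation 1 (cone_dif \<iota> \<alpha> I) f + scale hbar (BV_laplacian I f))\<rparr>"

text \<open>
  The map induced on the tensor product by \<open>x\<^sub>0 \<otimes> \<dots> \<otimes> x\<^sub>n\<^sub>-\<^sub>1 \<mapsto> x\<^sub>0 \<cdots> x\<^sub>n\<^sub>-\<^sub>1\<close>; the image of a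
  coset under the linear extension is a singleton because multiplication is multilinear.
\<close>

definition Oq_mult ::
    "interval list \<Rightarrow> interval \<Rightarrow> int \<Rightarrow> ((int \<times> (mon \<Rightarrow>\<^sub>0 'r)) list \<Rightarrow>\<^sub>0 'r::comm_ring_1) set
      \<Rightarrow> (mon \<Rightarrow>\<^sub>0 'r)" where
  "Oq_mult Is J k U = the_elem (lin_ext (\<lambda>xs. sym_prod (map snd xs)) ` U)"

end

theory Submission
  imports Defs
begin

text \<open>
  On the symmetric algebra, \<open>d + \<hbar>\<Delta>\<close> is the Koszul differential \<open>\<Sum>\<^sub>s L\<^sub>s \<partial>\<^sub>s\<close> of the operators
  \<open>L\<^sub>s = Q\<^sub>\<alpha>(\<delta>\<^sub>s) + \<hbar> \<partial>/\<partial>\<delta>\<^sub>s\<close> on polynomials in the \<open>\<delta>\<^sub>x\<close>, with \<open>\<partial>\<^sub>s\<close> the derivative in the barred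
  generator at \<open>s\<close>. These operators commute because \<open>Q\<^sub>\<alpha>\<close> is symmetric, so the differential squares
  to zero. It is a derivation on products of factors with disjoint supports, since the second order
  terms of \<open>\<Delta>\<close> pair the generators of one and the same point.

  For local constancy it suffices to add one site \<open>t\<close> next to an endpoint \<open>p\<close> of the range of integers
  in the interval. This adjoins \<open>\<delta>\<^sub>t\<close> and the barred generator at \<open>p\<close>, so that the new complex is the
  cone of \<open>L\<^sub>p = \<delta>\<^sub>t + E\<close> acting on \<open>K[\<delta>\<^sub>t]\<close>, where \<open>K\<close> is the old complex and \<open>E\<close> preserves \<open>K\<close>
  and commutes with \<open>L\<^sub>p\<close>. By the degree in \<open>\<delta>\<^sub>t\<close>, \<open>L\<^sub>p\<close> is injective and \<open>K\<close> is a complement of its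
  image; hence \<open>K\<close> is quasi-isomorphic to the cone.
\<close>

section \<open>Linear maps between free modules\<close>

text \<open>Both neighbours of \<open>p\<close> have coefficient 1 in
  \<open>Q_op \<alpha> (delta p)\<close>, so \<open>bv_op c h p\<close> is monic of degree one in
  the generator at \<open>t\<close>. Division with remainder by it therefore requires no inverses in
  the ring of scalars, and one argument serves the field, polynomials and power series in \<hbar>.
  The lower term \<open>E\<close> is not a polynomial but an operator containing \<hbar> times the
  derivative at \<open>p\<close>; because \<open>t\<close> differs from \<open>p\<close>, it
  commutes with multiplication by the generator at \<open>t\<close>, and this is what keeps the
  division algorithm valid. The bound 2 on lengths guarantees two integers in every interval: the
  second neighbour of an end point is then an old site, and \<open>E\<close> stays inside the old
  complex.

  The definitions speak of words, derivations and cosets, on which commutation rules are awkward to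
  state. They are traded for four operators, multiplication and differentiation for each kind of
  generator. Likewise, quasi-isomorphism is handled as a statement about elements, which composes
  along a chain of one-site extensions, and is converted into cohomology classes only once.\<close>

lemma lookup_scale [simp]: "Poly_Mapping.lookup (scale c f) b = c * Poly_Mapping.lookup f b"
  unfolding scale_def by (simp add: Poly_Mapping.map.rep_eq when_def)

lemma scale_add_right [simp]: "scale c (f + g) = scale c f + scale c g"
  by (rule poly_mapping_eqI) (simp add: lookup_add algebra_simps)

lemma scale_add_left: "scale (c + d) f = scale c f + scale d f"
  by (rule poly_mapping_eqI) (simp add: lookup_add algebra_simps)

lemma scale_scale [simp]: "scale c (scale d f) = scale (c * d) f"
  by (rule poly_mapping_eqI) (simp add: algebra_simps)

lemma scale_1 [simp]: "scale 1 f = f"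
  by (rule poly_mapping_eqI) simp

lemma scale_0_left [simp]: "scale 0 f = 0"
  by (rule poly_mapping_eqI) simp

lemma scale_0_right [simp]: "scale c 0 = 0"
  by (rule poly_mapping_eqI) simp

lemma scale_minus_right [simp]: "scale c (- f) = - scale c f"
  by (rule poly_mapping_eqI) simp

lemma scale_minus_left [simp]: "scale (- c) f = - scale c f"
  by (rule poly_mapping_eqI) simp

lemma scale_diff_right [simp]: "scale c (f - g) = scale c f - scale c g"
  by (rule poly_mapping_eqI) (simp add: lookup_minus algebra_simps)

lemma scale_sum: "scale c (sum f A) = (\<Sum>a\<in>A. scale c (f a))"
  by (induction A rule: infinite_finite_induct) auto

lemma scale_single [simp]: "scale c (Poly_Mapping.single b d) = Poly_Mapping.single b (c * d)"
  by (rule poly_mapping_eqI) (simp add: lookup_single when_def)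

lemma keys_scale: "Poly_Mapping.keys (scale c f) \<subseteq> Poly_Mapping.keys f"
  by (auto simp: in_keys_iff)

definition span_of :: "'b set \<Rightarrow> ('b \<Rightarrow>\<^sub>0 'r::comm_ring_1) set" where
  "span_of B = {f. Poly_Mapping.keys f \<subseteq> B}"

lemma span_of_0 [simp]: "0 \<in> span_of B"
  by (simp add: span_of_def)

lemma span_of_add: "f \<in> span_of B \<Longrightarrow> g \<in> span_of B \<Longrightarrow> f + g \<in> span_of B"
  using Poly_Mapping.keys_add[of f g] by (auto simp: span_of_def)

lemma span_of_scale: "f \<in> span_of B \<Longrightarrow> scale c f \<in> span_of B"
  using keys_scale[of c f] by (auto simp: span_of_def)

lemma span_of_uminus: "f \<in> span_of B \<Longrightarrow> - f \<in> span_of B"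
  using span_of_scale[of f B "-1"] by simp

lemma span_of_diff: "f \<in> span_of B \<Longrightarrow> g \<in> span_of B \<Longrightarrow> f - g \<in> span_of B"
  using span_of_add[of f B "-g"] span_of_uminus[of g B] by simp

lemma span_of_sum: "(\<And>a. a \<in> A \<Longrightarrow> f a \<in> span_of B) \<Longrightarrow> sum f A \<in> span_of B"
  by (induction A rule: infinite_finite_induct) (auto intro: span_of_add)

lemma span_of_single: "b \<in> B \<Longrightarrow> Poly_Mapping.single b c \<in> span_of B"
  by (simp add: span_of_def)

lemma span_of_mono: "f \<in> span_of B \<Longrightarrow> B \<subseteq> C \<Longrightarrow> f \<in> span_of C"
  by (auto simp: span_of_def)

lemmas span_of_intros = span_of_0 span_of_add span_of_scale span_of_uminus span_of_diff
  span_of_sum span_of_single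

lemma expand_basis:
  "f = (\<Sum>b\<in>Poly_Mapping.keys f. scale (Poly_Mapping.lookup f b) (Poly_Mapping.single b 1))"
proof (rule poly_mapping_eqI)
  fix k
  show "Poly_Mapping.lookup f k = Poly_Mapping.lookup
      (\<Sum>b\<in>Poly_Mapping.keys f. scale (Poly_Mapping.lookup f b) (Poly_Mapping.single b 1)) k"
    by (auto simp: lookup_sum lookup_single when_def in_keys_iff if_distrib cong: if_cong)
qed

definition linear_map :: "(('b \<Rightarrow>\<^sub>0 'r::comm_ring_1) \<Rightarrow> ('c \<Rightarrow>\<^sub>0 'r)) \<Rightarrow> bool" where
  "linear_map T \<longleftrightarrow> (\<forall>f g. T (f + g) = T f + T g) \<and> (\<forall>c f. T (scale c f) = scale c (T f))"

lemma linear_mapI: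
  "(\<And>f g. T (f + g) = T f + T g) \<Longrightarrow> (\<And>c f. T (scale c f) = scale c (T f)) \<Longrightarrow> linear_map T"
  by (simp add: linear_map_def)

lemma
  assumes "linear_map T"
  shows linear_map_add: "T (f + g) = T f + T g"
    and linear_map_scale: "T (scale c f) = scale c (T f)"
    and linear_map_0: "T 0 = 0"
    and linear_map_uminus: "T (- f) = - T f"
    and linear_map_diff: "T (f - g) = T f - T g"
    and linear_map_sum: "T (sum F A) = (\<Sum>a\<in>A. T (F a))"
proof -
  show add: "T (f + g) = T f + T g" for f g
    using assms by (simp add: linear_map_def)
  show sc: "T (scale c f) = scale c (T f)" for c f
    using assms by (simp add: linear_map_def)
  show zero: "T 0 = 0"
    using sc[of 0 0] by simp
  show neg: "T (- f) = - T f" for f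
    using sc[of "-1" f] by simp
  show "T (f - g) = T f - T g"
    using add[of f "-g"] neg[of g] by simp
  show "T (sum F A) = (\<Sum>a\<in>A. T (F a))"
    by (induction A rule: infinite_finite_induct) (auto simp: add zero)
qed

lemmas linear_map_simps = linear_map_add linear_map_scale linear_map_0 linear_map_uminus
  linear_map_diff linear_map_sum

lemma linear_map_id: "linear_map (\<lambda>f. f)"
  by (simp add: linear_map_def)

lemma linear_map_zero: "linear_map (\<lambda>f. 0)"
  by (simp add: linear_map_def)

lemma linear_map_plus: "linear_map S \<Longrightarrow> linear_map T \<Longrightarrow> linear_map (\<lambda>f. S f + T f)"
  by (simp add: linear_map_def)

lemma linear_map_minus: "linear_map S \<Longrightarrow> linear_map T \<Longrightarrow> linear_map (\<lambda>f. S f - T f)"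
  by (simp add: linear_map_def)

lemma linear_map_neg: "linear_map S \<Longrightarrow> linear_map (\<lambda>f. - S f)"
  by (simp add: linear_map_def)

lemma linear_map_scaled: "linear_map S \<Longrightarrow> linear_map (\<lambda>f. scale c (S f))"
  by (simp add: linear_map_def mult.commute)

lemma linear_map_comp: "linear_map S \<Longrightarrow> linear_map T \<Longrightarrow> linear_map (\<lambda>f. S (T f))"
  by (simp add: linear_map_def)

lemma linear_map_sums: "(\<And>a. a \<in> A \<Longrightarrow> linear_map (T a)) \<Longrightarrow> linear_map (\<lambda>f. \<Sum>a\<in>A. T a f)"
  by (simp add: linear_map_def scale_sum sum.distrib)

lemma linear_map_if: "linear_map S \<Longrightarrow> linear_map T \<Longrightarrow> linear_map (\<lambda>f. if P then S f else T f)"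
  by (cases P) simp_all

lemmas linear_map_intros = linear_map_id linear_map_zero linear_map_plus linear_map_minus
  linear_map_neg linear_map_scaled linear_map_sums linear_map_if

text \<open>The index set \<open>keys f\<close> varies with \<open>f\<close>. Over a common finite
  superset, values at different arguments become sums that can be compared termwise, which gives
  additivity.\<close>

lemma lin_ext_superset:
  assumes "finite B" "Poly_Mapping.keys f \<subseteq> B"
  shows "lin_ext \<phi> f = (\<Sum>b\<in>B. scale (Poly_Mapping.lookup f b) (\<phi> b))"
  unfolding lin_ext_def using assms
  by (intro sum.mono_neutral_left) (auto simp: in_keys_iff)

lemma linear_lin_ext: "linear_map (lin_ext \<phi>)"
proof (rule linear_mapI)
  fix f g :: "'a \<Rightarrow>\<^sub>0 'b"
  let ?B = "Poly_Mapping.keys f \<union> Poly_Mapping.keys g"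
  have "Poly_Mapping.keys (f + g) \<subseteq> ?B"
    by (rule Poly_Mapping.keys_add)
  then show "lin_ext \<phi> (f + g) = lin_ext \<phi> f + lin_ext \<phi> g"
    by (simp add: lin_ext_superset[of ?B] lookup_add scale_add_left sum.distrib)
next
  fix c and f :: "'a \<Rightarrow>\<^sub>0 'b"
  show "lin_ext \<phi> (scale c f) = scale c (lin_ext \<phi> f)"
    by (simp add: lin_ext_superset[of "Poly_Mapping.keys f"] keys_scale scale_sum)
qed

lemma lin_ext_single [simp]: "lin_ext \<phi> (Poly_Mapping.single b c) = scale c (\<phi> b)"
  by (subst lin_ext_superset[of "{b}"]) auto

lemmas lin_ext_simps [simp] = linear_map_simps[OF linear_lin_ext]

text \<open>Only basis elements occurring in \<open>f\<close> are tested, so identities that hold on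
  a span but not everywhere can be proved in this way.\<close>

lemma linear_map_eqI:
  assumes "linear_map S" "linear_map T"
    and "\<And>b. b \<in> Poly_Mapping.keys f \<Longrightarrow> S (Poly_Mapping.single b 1) = T (Poly_Mapping.single b 1)"
  shows "S f = T f"
proof -
  have "S f = (\<Sum>b\<in>Poly_Mapping.keys f. scale (Poly_Mapping.lookup f b) (S (Poly_Mapping.single b 1)))"
    by (subst (1) expand_basis)
      (simp add: linear_map_simps[OF assms(1)] del: scale_single)
  also have "\<dots> = (\<Sum>b\<in>Poly_Mapping.keys f. scale (Poly_Mapping.lookup f b) (T (Poly_Mapping.single b 1)))"
    by (intro sum.cong) (auto simp: assms(3))
  also have "\<dots> = T f"
    by (subst (4) expand_basis)
      (simp add: linear_map_simps[OF assms(2)] del: scale_single)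
  finally show ?thesis .
qed

lemma linear_map_span:
  assumes "linear_map T" "f \<in> span_of B"
    and "\<And>b. b \<in> B \<Longrightarrow> T (Poly_Mapping.single b 1) \<in> span_of C"
  shows "T f \<in> span_of C"
proof -
  have "T f = (\<Sum>b\<in>Poly_Mapping.keys f. scale (Poly_Mapping.lookup f b) (T (Poly_Mapping.single b 1)))"
    by (subst (1) expand_basis)
      (simp add: linear_map_simps[OF assms(1)] del: scale_single)
  moreover have "Poly_Mapping.keys f \<subseteq> B"
    using assms(2) by (simp add: span_of_def)
  ultimately show ?thesis
    by (auto intro!: span_of_intros assms(3))
qed

lemma span_induct [consumes 1, case_names zero basis add scale]:
  assumes "f \<in> span_of B"
    and "P 0"
    and "\<And>b. b \<in> B \<Longrightarrow> P (Poly_Mapping.single b 1)"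
    and "\<And>f g. P f \<Longrightarrow> P g \<Longrightarrow> P (f + g)"
    and "\<And>c f. P f \<Longrightarrow> P (scale c f)"
  shows "P f"
proof -
  have "P (\<Sum>b\<in>K. scale (Poly_Mapping.lookup f b) (Poly_Mapping.single b 1))"
    if "finite K" "K \<subseteq> B" for K
    using that by induction (auto intro: assms simp del: scale_single)
  from this[of "Poly_Mapping.keys f"] assms(1) show ?thesis
    by (subst expand_basis) (simp add: span_of_def del: scale_single)
qed

section \<open>Multiplication and differentiation operators\<close>

text \<open>The sign of moving the barred generator at \<open>x\<close> from the front of the
  increasing product over \<open>S\<close> to its sorted position.\<close>

definition osgn :: "int \<Rightarrow> int set \<Rightarrow> 'r::comm_ring_1" where
  "osgn x S = (- 1) ^ card {s \<in> S. s < x}"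

lemma osgn_insert:
  assumes "finite S" "y \<notin> S"
  shows "osgn x (insert y S) = (if y < x then - osgn x S else osgn x S)"
proof -
  have "{s \<in> insert y S. s < x} = (if y < x then insert y {s \<in> S. s < x} else {s \<in> S. s < x})"
    by auto
  with assms show ?thesis by (auto simp: osgn_def)
qed

lemma osgn_remove:
  assumes "finite S" "y \<in> S"
  shows "osgn x (S - {y}) = (if y < x then - osgn x S else osgn x S)"
  using osgn_insert[of "S - {y}" y x, where 'a = 'a] assms by (simp add: insert_absorb split: if_splits)

lemma osgn_empty [simp]: "osgn x {} = 1"
  by (simp add: osgn_def)

lemma osgn_square [simp]: "osgn x S * osgn x S = 1" "osgn x S * (osgn x S * a) = a"
  by (simp_all add: osgn_def flip: power_add mult.assoc mult_2)

text \<open>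
  The guard \<open>finite S\<close> makes the anticommutation rules hold without side conditions: for infinite
  \<open>S\<close> the sign \<open>osgn x S\<close> is a junk value.
\<close>

definition mulE :: "int \<Rightarrow> (mon \<Rightarrow>\<^sub>0 'r::comm_ring_1) \<Rightarrow> (mon \<Rightarrow>\<^sub>0 'r)" where
  "mulE x = lin_ext (\<lambda>(A, S). Poly_Mapping.single (add_mset x A, S) 1)"

definition parE :: "int \<Rightarrow> (mon \<Rightarrow>\<^sub>0 'r::comm_ring_1) \<Rightarrow> (mon \<Rightarrow>\<^sub>0 'r)" where
  "parE x = lin_ext (\<lambda>(A, S). Poly_Mapping.single (A - {#x#}, S) (of_nat (count A x)))"

definition mulO :: "int \<Rightarrow> (mon \<Rightarrow>\<^sub>0 'r::comm_ring_1) \<Rightarrow> (mon \<Rightarrow>\<^sub>0 'r)" where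
  "mulO x = lin_ext (\<lambda>(A, S).
     if finite S \<and> x \<notin> S then Poly_Mapping.single (A, insert x S) (osgn x S) else 0)"

definition parO :: "int \<Rightarrow> (mon \<Rightarrow>\<^sub>0 'r::comm_ring_1) \<Rightarrow> (mon \<Rightarrow>\<^sub>0 'r)" where
  "parO x = lin_ext (\<lambda>(A, S).
     if finite S \<and> x \<in> S then Poly_Mapping.single (A, S - {x}) (osgn x S) else 0)"

lemma linear_mulE: "linear_map (mulE x)"
  and linear_parE: "linear_map (parE x)"
  and linear_mulO: "linear_map (mulO x)"
  and linear_parO: "linear_map (parO x)"
  by (simp_all add: mulE_def parE_def mulO_def parO_def linear_lin_ext)

lemmas mulE_simps [simp] = linear_map_simps[OF linear_mulE]
lemmas parE_simps [simp] = linear_map_simps[OF linear_parE]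
lemmas mulO_simps [simp] = linear_map_simps[OF linear_mulO]
lemmas parO_simps [simp] = linear_map_simps[OF linear_parO]

lemmas linear_ops =
  linear_map_comp[OF linear_mulE] linear_map_comp[OF linear_parE]
  linear_map_comp[OF linear_mulO] linear_map_comp[OF linear_parO]
  linear_mulE linear_parE linear_mulO linear_parO

lemma mulE_single [simp]:
  "mulE x (Poly_Mapping.single (A, S) c) = Poly_Mapping.single (add_mset x A, S) c"
  by (simp add: mulE_def)

lemma parE_single [simp]:
  "parE x (Poly_Mapping.single (A, S) c) = Poly_Mapping.single (A - {#x#}, S) (c * of_nat (count A x))"
  by (simp add: parE_def)

lemma mulO_single [simp]:
  "mulO x (Poly_Mapping.single (A, S) c) =
    (if finite S \<and> x \<notin> S then Poly_Mapping.single (A, insert x S) (c * osgn x S) else 0)"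
  by (simp add: mulO_def)

lemma parO_single [simp]:
  "parO x (Poly_Mapping.single (A, S) c) =
    (if finite S \<and> x \<in> S then Poly_Mapping.single (A, S - {x}) (c * osgn x S) else 0)"
  by (simp add: parO_def)

section \<open>Weyl and Clifford relations between the four operators\<close>

lemma mulE_mulE: "mulE x (mulE y f) = mulE y (mulE x f)"
  by (rule linear_map_eqI[where f = f]) (auto intro!: linear_ops simp: add_mset_commute)

lemma parE_mulE: "parE x (mulE y f) = mulE y (parE x f) + (if x = y then f else 0)"
proof (rule linear_map_eqI[where f = f])
  fix b :: mon
  obtain A S where b: "b = (A, S)" by fastforce
  show "parE x (mulE y (Poly_Mapping.single b 1))
    = mulE y (parE x (Poly_Mapping.single b 1)) + (if x = y then Poly_Mapping.single b 1 else 0)"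
  proof (cases "x = y")
    case True
    \<comment> \<open>For \<open>y\<close> outside \<open>A\<close> the multiset
      \<open>A - {#y#}\<close> is \<open>A\<close> itself, so the monomials on the two sides do not
      match; the coefficient \<open>count A y = 0\<close> removes the offending term.\<close>
    then show ?thesis
      by (cases "y \<in># A") (simp_all add: b add.commute not_in_iff flip: single_add)
  next
    case False
    then show ?thesis
      by (cases "x \<in># A") (simp_all add: b diff_add_mset_swap not_in_iff flip: single_add)
  qed
qed (auto intro!: linear_map_intros linear_ops)

lemma parE_parE: "parE x (parE y f) = parE y (parE x f)"
proof (rule linear_map_eqI[where f = f])
  fix b :: mon
  obtain A S where b: "b = (A, S)" by fastforce
  show "parE x (parE y (Poly_Mapping.single b 1)) = parE y (parE x (Poly_Mapping.single b 1))"
    by (cases "x = y") (simp_all add: b add_mset_commute mult.commute)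
qed (auto intro!: linear_ops)

lemma parO_parO_same [simp]: "parO x (parO x f) = 0"
  by (rule linear_map_eqI[where f = f]) (auto intro!: linear_ops linear_map_intros)

text \<open>Removing the smaller of the two points first changes the sign with which the larger one
  is removed, while the other order changes nothing.\<close>

lemma parO_parO: "parO x (parO y f) = - parO y (parO x f)"
proof (rule linear_map_eqI[where f = f])
  fix b :: mon
  obtain A S where b: "b = (A, S)" by fastforce
  show "parO x (parO y (Poly_Mapping.single b 1)) = - parO y (parO x (Poly_Mapping.single b 1))"
  proof (cases "finite S \<and> x \<in> S \<and> y \<in> S \<and> x \<noteq> y")
    case True
    moreover have "S - {x} - {y} = S - {y} - {x}" by auto
    ultimately show ?thesis
      by (auto simp: b osgn_remove mult.commute simp flip: single_uminus)
  next
    case False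
    then show ?thesis by (cases "x = y") (auto simp: b)
  qed
qed (auto intro!: linear_ops linear_map_intros)

lemma parO_mulO: "x \<noteq> y \<Longrightarrow> parO x (mulO y f) = - mulO y (parO x f)"
proof (rule linear_map_eqI[where f = f])
  fix b :: mon
  obtain A S where b: "b = (A, S)" by fastforce
  assume "x \<noteq> y"
  then show "parO x (mulO y (Poly_Mapping.single b 1)) = - mulO y (parO x (Poly_Mapping.single b 1))"
  proof (cases "finite S \<and> x \<in> S \<and> y \<notin> S")
    case True
    with \<open>x \<noteq> y\<close> have "insert y S - {x} = insert y (S - {x})" by auto
    with True \<open>x \<noteq> y\<close> show ?thesis
      by (auto simp: b osgn_remove osgn_insert mult.commute simp flip: single_uminus)
  qed (auto simp: b)
qed (auto intro!: linear_ops linear_map_intros)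

abbreviation fin_mons :: "mon set" where
  "fin_mons \<equiv> {m. finite (snd m)}"

text \<open>On a monomial with infinite second component the guards make \<open>parO x\<close> and
  \<open>mulO x\<close> both zero, so the relation is confined to the span of finite
  monomials.\<close>

lemma parO_mulO_same:
  assumes "f \<in> span_of fin_mons"
  shows "parO x (mulO x f) = f - mulO x (parO x f)"
proof (rule linear_map_eqI[where f = f])
  fix b :: mon
  assume "b \<in> Poly_Mapping.keys f"
  with assms obtain A S where b: "b = (A, S)" and fin: "finite S"
    by (cases b) (auto simp: span_of_def)
  show "parO x (mulO x (Poly_Mapping.single b 1))
    = Poly_Mapping.single b 1 - mulO x (parO x (Poly_Mapping.single b 1))"
    using fin by (auto simp: b osgn_remove osgn_insert insert_absorb)
qed (auto intro!: linear_ops linear_map_intros)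

lemma parO_mulE: "parO x (mulE y f) = mulE y (parO x f)"
  by (rule linear_map_eqI[where f = f]) (auto intro!: linear_ops)

lemma parO_parE: "parO x (parE y f) = parE y (parO x f)"
  by (rule linear_map_eqI[where f = f]) (auto intro!: linear_ops simp: mult.commute)

lemma mulO_mulE: "mulO x (mulE y f) = mulE y (mulO x f)"
  by (rule linear_map_eqI[where f = f]) (auto intro!: linear_ops)

lemma mulO_parE: "mulO x (parE y f) = parE y (mulO x f)"
  by (rule linear_map_eqI[where f = f]) (auto intro!: linear_ops simp: mult.commute)

lemma
  fixes f :: "mon \<Rightarrow>\<^sub>0 'a::comm_ring_1"
  assumes "f \<in> span_of fin_mons"
  shows fin_mulE: "mulE x f \<in> span_of fin_mons"
    and fin_parE: "parE x f \<in> span_of fin_mons"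
    and fin_mulO: "mulO x f \<in> span_of fin_mons"
    and fin_parO: "parO x f \<in> span_of fin_mons"
proof -
  have *: "T f \<in> span_of fin_mons"
    if "linear_map T" "\<And>A S. finite S \<Longrightarrow> T (Poly_Mapping.single (A, S) 1) \<in> span_of fin_mons"
    for T :: "(mon \<Rightarrow>\<^sub>0 'a) \<Rightarrow> (mon \<Rightarrow>\<^sub>0 'a)"
  proof (rule linear_map_span[OF that(1) assms])
    fix m :: mon
    assume "m \<in> fin_mons"
    then show "T (Poly_Mapping.single m 1) \<in> span_of fin_mons"
      using that(2)[of "snd m" "fst m"] by simp
  qed
  show "mulE x f \<in> span_of fin_mons"
    by (rule *[OF linear_mulE]) (simp add: span_of_single)
  show "parE x f \<in> span_of fin_mons"
    by (rule *[OF linear_parE]) (simp add: span_of_single)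
  show "mulO x f \<in> span_of fin_mons"
    by (rule *[OF linear_mulO]) (simp add: span_of_single)
  show "parO x f \<in> span_of fin_mons"
    by (rule *[OF linear_parO]) (simp add: span_of_single)
qed

lemmas fin_ops = fin_mulE fin_parE fin_mulO fin_parO

section \<open>The symmetric algebra as a graded commutative algebra\<close>

text \<open>The sign of sorting the concatenation of the increasing products over \<open>S\<close>
  and \<open>T\<close>: the exponent counts inversions.\<close>

definition isgn :: "int set \<Rightarrow> int set \<Rightarrow> 'r::comm_ring_1" where
  "isgn S T = (- 1) ^ card {(s, t). s \<in> S \<and> t \<in> T \<and> t < s}"

lemma isgn_empty [simp]: "isgn {} T = 1" "isgn S {} = 1"
  by (simp_all add: isgn_def)

lemma finite_inversions: "finite S \<Longrightarrow> finite T \<Longrightarrow> finite {(s, t). s \<in> S \<and> t \<in> T \<and> t < s}"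
  by (rule finite_subset[of _ "S \<times> T"]) auto

lemma isgn_singleton: "isgn {x} T = osgn x T"
proof -
  have "{(s, t). s \<in> {x} \<and> t \<in> T \<and> t < s} = Pair x ` {t \<in> T. t < x}"
    by auto
  then show ?thesis
    unfolding isgn_def osgn_def by (simp add: card_image inj_on_def)
qed

lemma isgn_Un_left:
  assumes "finite S" "finite S'" "finite T" "S \<inter> S' = {}"
  shows "isgn (S \<union> S') T = isgn S T * isgn S' T"
proof -
  have "{(s, t). s \<in> S \<union> S' \<and> t \<in> T \<and> t < s} =
    {(s, t). s \<in> S \<and> t \<in> T \<and> t < s} \<union> {(s, t). s \<in> S' \<and> t \<in> T \<and> t < s}"
    by auto
  moreover have "{(s, t). s \<in> S \<and> t \<in> T \<and> t < s} \<inter> {(s, t). s \<in> S' \<and> t \<in> T \<and> t < s} = {}"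
    using assms by auto
  ultimately show ?thesis
    using assms by (simp add: isgn_def card_Un_disjoint finite_inversions power_add)
qed

lemma osgn_Un:
  assumes "finite S" "finite T" "S \<inter> T = {}"
  shows "osgn x (S \<union> T) = osgn x S * osgn x T"
proof -
  have "{s \<in> S \<union> T. s < x} = {s \<in> S. s < x} \<union> {s \<in> T. s < x}"
    by auto
  moreover have "{s \<in> S. s < x} \<inter> {s \<in> T. s < x} = {}"
    using assms by auto
  ultimately show ?thesis
    using assms by (simp add: osgn_def card_Un_disjoint power_add)
qed

lemma isgn_insert:
  assumes "finite S" "finite T" "x \<notin> S"
  shows "isgn (insert x S) T = osgn x T * isgn S T"
  using isgn_Un_left[of "{x}" S T] assms by (simp add: isgn_singleton)

text \<open>For disjoint sets every pair in \<open>S \<times> T\<close> is an inversion of exactly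
  one of the two concatenations, so the two exponents add up to
  \<open>card S * card T\<close>.\<close>

lemma isgn_swap:
  assumes "finite S" "finite T" "S \<inter> T = {}"
  shows "isgn S T = (- 1) ^ (card S * card T) * isgn T S"
proof -
  let ?A = "{(s, t). s \<in> S \<and> t \<in> T \<and> t < s}" and ?B = "{(s, t). s \<in> S \<and> t \<in> T \<and> s < t}"
  let ?C = "{(t, s). t \<in> T \<and> s \<in> S \<and> s < t}"
  have "?B = prod.swap ` ?C"
    by auto
  then have B: "card ?B = card ?C"
    by (simp add: card_image)
  have un: "S \<times> T = ?A \<union> ?B"
  proof (intro equalityI subsetI)
    fix p
    assume "p \<in> S \<times> T"
    then obtain s t where p: "p = (s, t)" "s \<in> S" "t \<in> T" by blast
    with assms(3) have "s \<noteq> t" by blast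
    with p show "p \<in> ?A \<union> ?B" by auto
  qed auto
  have "?A \<inter> ?B = {}"
    by auto
  moreover have "finite (S \<times> T)"
    using assms by simp
  then have "finite ?A" "finite ?B"
    unfolding un by simp_all
  ultimately have "card S * card T = card ?A + card ?B"
    using card_Un_disjoint[of ?A ?B] card_cartesian_product[of S T] un by simp
  then have "(- 1 :: 'a) ^ (card S * card T) = (- 1) ^ card ?A * (- 1) ^ card ?C"
    by (simp add: B power_add)
  moreover have "(- 1 :: 'a) ^ card ?C * (- 1) ^ card ?C = 1"
    by (simp flip: power_mult_distrib)
  ultimately show ?thesis
    by (simp add: isgn_def mult.assoc)
qed

lemma mon_mult_isgn:
  "mon_mult (A, S) (B, T) =
    (if S \<inter> T = {} then Poly_Mapping.single (A + B, S \<union> T) (isgn S T) else 0)"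
  by (simp add: isgn_def)

lemma linear_sym_mult_left: "linear_map (\<lambda>f. sym_mult f g)"
  by (simp add: sym_mult_def linear_lin_ext)

lemma linear_sym_mult_right: "linear_map (sym_mult f)"
proof -
  have "linear_map (\<lambda>g. \<Sum>b\<in>Poly_Mapping.keys f.
      scale (Poly_Mapping.lookup f b) (lin_ext (mon_mult b) g))"
    by (intro linear_map_intros linear_lin_ext)
  then show ?thesis
    by (simp add: sym_mult_def[abs_def] lin_ext_def[of _ f])
qed

lemmas sym_mult_simps [simp] =
  linear_map_simps[OF linear_sym_mult_left] linear_map_simps[OF linear_sym_mult_right]

lemmas linear_sym_mult =
  linear_sym_mult_left linear_sym_mult_right
  linear_map_comp[OF linear_sym_mult_left] linear_map_comp[OF linear_sym_mult_right]

lemma sym_mult_single [simp]: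
  "sym_mult (Poly_Mapping.single (A, S) c) (Poly_Mapping.single (B, T) d) =
    (if S \<inter> T = {} then Poly_Mapping.single (A + B, S \<union> T) (c * d * isgn S T) else 0)"
  by (simp add: sym_mult_def mon_mult_isgn mult.assoc del: mon_mult.simps)

lemma bilinear_eqI:
  assumes "\<And>g. linear_map (\<lambda>f. S f g)" "\<And>f. linear_map (S f)"
    and "\<And>g. linear_map (\<lambda>f. T f g)" "\<And>f. linear_map (T f)"
    and "\<And>a b. a \<in> Poly_Mapping.keys f \<Longrightarrow> b \<in> Poly_Mapping.keys g \<Longrightarrow>
      S (Poly_Mapping.single a 1) (Poly_Mapping.single b 1) =
      T (Poly_Mapping.single a 1) (Poly_Mapping.single b 1)"
  shows "S f g = T f g"
proof -
  have "S (Poly_Mapping.single a 1) g = T (Poly_Mapping.single a 1) g"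
    if "a \<in> Poly_Mapping.keys f" for a
    using linear_map_eqI[OF assms(2) assms(4) assms(5)[OF that]] .
  from linear_map_eqI[OF assms(1) assms(3) this] show ?thesis .
qed

lemma sym_mult_one_left [simp]: "sym_mult sym_one f = f"
proof (rule linear_map_eqI[where f = f])
  fix m :: mon
  show "sym_mult sym_one (Poly_Mapping.single m 1) = Poly_Mapping.single m 1"
    by (cases m) (simp add: sym_one_def)
qed (intro linear_sym_mult linear_map_intros)+

lemma sym_mult_one_right [simp]: "sym_mult f sym_one = f"
proof (rule linear_map_eqI[where f = f])
  fix m :: mon
  show "sym_mult (Poly_Mapping.single m 1) sym_one = Poly_Mapping.single m 1"
    by (cases m) (simp add: sym_one_def)
qed (intro linear_sym_mult linear_map_intros)+

lemma sym_mult_mulE_left: "sym_mult (mulE x f) g = mulE x (sym_mult f g)"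
proof (rule bilinear_eqI[where f = f and g = g])
  fix a b :: mon
  show "sym_mult (mulE x (Poly_Mapping.single a 1)) (Poly_Mapping.single b 1)
    = mulE x (sym_mult (Poly_Mapping.single a 1) (Poly_Mapping.single b 1))"
    by (cases a; cases b) simp
qed (intro linear_sym_mult linear_ops linear_map_intros)+

lemma sym_mult_mulE_right: "sym_mult f (mulE x g) = mulE x (sym_mult f g)"
proof (rule bilinear_eqI[where f = f and g = g])
  fix a b :: mon
  show "sym_mult (Poly_Mapping.single a 1) (mulE x (Poly_Mapping.single b 1))
    = mulE x (sym_mult (Poly_Mapping.single a 1) (Poly_Mapping.single b 1))"
    by (cases a; cases b) simp
qed (intro linear_sym_mult linear_ops linear_map_intros)+

lemma parE_sym_mult: "parE x (sym_mult f g) = sym_mult (parE x f) g + sym_mult f (parE x g)"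
proof (rule bilinear_eqI[where f = f and g = g])
  fix a b :: mon
  obtain A S B T where ab: "a = (A, S)" "b = (B, T)" by fastforce
  show "parE x (sym_mult (Poly_Mapping.single a 1) (Poly_Mapping.single b 1))
    = sym_mult (parE x (Poly_Mapping.single a 1)) (Poly_Mapping.single b 1)
      + sym_mult (Poly_Mapping.single a 1) (parE x (Poly_Mapping.single b 1))"
    by (cases "x \<in># A"; cases "x \<in># B")
      (simp_all add: ab not_in_iff algebra_simps flip: single_add)
qed (intro linear_sym_mult linear_ops linear_map_intros)+

lemma sym_mult_fin:
  assumes "f \<in> span_of fin_mons" "g \<in> span_of fin_mons"
  shows "sym_mult f g \<in> span_of fin_mons"
proof (rule linear_map_span[OF linear_sym_mult_left assms(1)])
  fix a :: mon
  assume a: "a \<in> fin_mons"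
  show "sym_mult (Poly_Mapping.single a 1) g \<in> span_of fin_mons"
  proof (rule linear_map_span[OF linear_sym_mult_right assms(2)])
    fix b :: mon
    assume "b \<in> fin_mons"
    with a show "sym_mult (Poly_Mapping.single a 1) (Poly_Mapping.single b 1) \<in> span_of fin_mons"
      by (cases a; cases b) (auto intro!: span_of_intros)
  qed
qed

lemma sym_mult_mulO_left:
  assumes "f \<in> span_of fin_mons" "g \<in> span_of fin_mons"
  shows "sym_mult (mulO x f) g = mulO x (sym_mult f g)"
proof (rule bilinear_eqI[where f = f and g = g])
  fix a b :: mon
  assume "a \<in> Poly_Mapping.keys f" "b \<in> Poly_Mapping.keys g"
  with assms have "finite (snd a)" "finite (snd b)"
    by (auto simp: span_of_def)
  then obtain A S B T where ab: "a = (A, S)" "b = (B, T)" "finite S" "finite T"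
    by (metis prod.collapse)
  then show "sym_mult (mulO x (Poly_Mapping.single a 1)) (Poly_Mapping.single b 1)
    = mulO x (sym_mult (Poly_Mapping.single a 1) (Poly_Mapping.single b 1))"
    by (auto simp: isgn_insert osgn_Un algebra_simps)
qed (intro linear_sym_mult linear_ops linear_map_intros)+

lemma fin_one: "sym_one \<in> span_of fin_mons"
  by (simp add: sym_one_def span_of_single)

text \<open>Finite monomials arise from \<open>sym_one\<close> by the two multiplication operators.
  Identities whose sides transform alike under these operators can thus be proved without counting
  inversions.\<close>

lemma fin_induct [consumes 1, case_names zero one mulE mulO add scale]:
  assumes "f \<in> span_of fin_mons"
    and zero: "P 0" and one: "P sym_one"
    and mulE: "\<And>x f. f \<in> span_of fin_mons \<Longrightarrow> P f \<Longrightarrow> P (mulE x f)"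
    and mulO: "\<And>x f. f \<in> span_of fin_mons \<Longrightarrow> P f \<Longrightarrow> P (mulO x f)"
    and add: "\<And>f g. P f \<Longrightarrow> P g \<Longrightarrow> P (f + g)"
    and scale: "\<And>c f. P f \<Longrightarrow> P (scale c f)"
  shows "P f"
  using assms(1)
proof (induction rule: span_induct)
  case (basis b)
  then obtain A S where b: "b = (A, S)" and fin: "finite S"
    by (cases b) auto
  have "P (Poly_Mapping.single ({#}, S) 1)"
    using fin
  proof induction
    case empty
    then show ?case using one by (simp add: sym_one_def)
  next
    case (insert x S)
    \<comment> \<open>The factor \<open>osgn x S\<close> cancels the sign that \<open>mulO x\<close>
      introduces, since its square is 1.\<close>
    then have "P (scale (osgn x S) (mulO x (Poly_Mapping.single ({#}, S) 1)))"
      by (intro scale mulO span_of_intros) auto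
    with insert show ?case by simp
  qed
  then have "P (Poly_Mapping.single (A, S) 1)"
  proof (induction A)
    case (add x A)
    then have "P (mulE x (Poly_Mapping.single (A, S) 1))"
      using fin by (intro mulE span_of_intros) auto
    then show ?case by simp
  qed
  then show ?case by (simp add: b)
qed (simp_all add: zero add scale)

text \<open>Both sides commute with \<open>mulE x\<close> and \<open>mulO x\<close> acting on the
  first factor, so everything reduces to the case where that factor is
  \<open>sym_one\<close>.\<close>

lemma sym_mult_assoc:
  assumes "f \<in> span_of fin_mons" "g \<in> span_of fin_mons" "h \<in> span_of fin_mons"
  shows "sym_mult (sym_mult f g) h = sym_mult f (sym_mult g h)"
  using assms(1)
  by (induction rule: fin_induct)
    (simp_all add: sym_mult_mulE_left sym_mult_mulO_left sym_mult_fin assms)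

text \<open>The parity automorphism carries the sign of the graded Leibniz rule.\<close>

definition parity :: "(mon \<Rightarrow>\<^sub>0 'r::comm_ring_1) \<Rightarrow> (mon \<Rightarrow>\<^sub>0 'r)" where
  "parity = lin_ext (\<lambda>m. Poly_Mapping.single m ((- 1) ^ card (snd m)))"

lemma linear_parity: "linear_map parity"
  by (simp add: parity_def linear_lin_ext)

lemmas parity_simps [simp] = linear_map_simps[OF linear_parity]

lemma parity_single [simp]:
  "parity (Poly_Mapping.single m c) = Poly_Mapping.single m (c * (- 1) ^ card (snd m))"
  by (simp add: parity_def)

lemmas linear_intros = linear_sym_mult linear_ops linear_map_comp[OF linear_parity] linear_parity
  linear_map_intros

lemma parity_mulE: "parity (mulE x f) = mulE x (parity f)"
proof (rule linear_map_eqI[where f = f])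
  fix m :: mon
  show "parity (mulE x (Poly_Mapping.single m 1)) = mulE x (parity (Poly_Mapping.single m 1))"
    by (cases m) simp
qed (intro linear_intros)+

lemma parity_mulO: "parity (mulO x f) = - mulO x (parity f)"
proof (rule linear_map_eqI[where f = f])
  fix m :: mon
  show "parity (mulO x (Poly_Mapping.single m 1)) = - mulO x (parity (Poly_Mapping.single m 1))"
    by (cases m) (simp add: mult.commute flip: single_uminus)
qed (intro linear_intros)+

lemma parity_fin: "f \<in> span_of fin_mons \<Longrightarrow> parity f \<in> span_of fin_mons"
  by (erule linear_map_span[OF linear_parity]) (simp add: span_of_single)

text \<open>By induction on the first factor, the sign enters when \<open>parO x\<close> passes
  \<open>mulO y\<close>, and \<open>parity_mulO\<close> records it. For \<open>x = y\<close> the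
  extra term of \<open>parO_mulO_same\<close> appears once on each side.\<close>

lemma parO_sym_mult_parity:
  assumes "f \<in> span_of fin_mons" "g \<in> span_of fin_mons"
  shows "parO x (sym_mult f g) = sym_mult (parO x f) g + sym_mult (parity f) (parO x g)"
  using assms(1)
proof (induction rule: fin_induct)
  case one
  have "parO x (sym_one :: mon \<Rightarrow>\<^sub>0 'a) = 0" "parity (sym_one :: mon \<Rightarrow>\<^sub>0 'a) = sym_one"
    by (simp_all add: sym_one_def)
  then show ?case by simp
next
  case (mulE y f)
  then show ?case by (simp add: sym_mult_mulE_left parO_mulE parity_mulE)
next
  case (mulO y f)
  then show ?case
    by (cases "x = y")
      (simp_all add: sym_mult_mulO_left parO_mulO parO_mulO_same parity_mulO sym_mult_fin fin_ops
        assms parity_fin)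
qed (simp_all add: algebra_simps)

text \<open>The barred sites have a bound \<open>V\<close> of their own so that the intermediate
  stage, with the new generator at \<open>t\<close> but not yet the barred one at \<open>p\<close>,
  is again of this form: \<open>mons (insert t U) V n\<close>.\<close>

definition mons :: "int set \<Rightarrow> int set \<Rightarrow> int \<Rightarrow> mon set" where
  "mons U V n = {(A, S). set_mset A \<subseteq> U \<and> S \<subseteq> V \<and> finite S \<and> - int (card S) = n}"

lemma mons_mono: "U \<subseteq> U' \<Longrightarrow> V \<subseteq> V' \<Longrightarrow> mons U V n \<subseteq> mons U' V' n"
  by (auto simp: mons_def)

lemma mons_fin: "mons U V n \<subseteq> fin_mons"
  by (auto simp: mons_def)

lemma span_mons_mono:
  "f \<in> span_of (mons U V n) \<Longrightarrow> U \<subseteq> U' \<Longrightarrow> V \<subseteq> V' \<Longrightarrow> f \<in> span_of (mons U' V' n)"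
  by (erule span_of_mono) (rule mons_mono)

lemma span_mons_fin: "f \<in> span_of (mons U V n) \<Longrightarrow> f \<in> span_of fin_mons"
  by (erule span_of_mono[OF _ mons_fin])

lemma sym_one_mons: "sym_one \<in> span_of (mons U V 0)"
  by (simp add: sym_one_def mons_def span_of_single)

lemma mulE_mons:
  assumes "f \<in> span_of (mons U V n)" "x \<in> U"
  shows "mulE x f \<in> span_of (mons U V n)"
proof (rule linear_map_span[OF linear_mulE assms(1)])
  fix m
  assume m: "m \<in> mons U V n"
  obtain A S where AS: "m = (A, S)" by fastforce
  have "(add_mset x A, S) \<in> mons U V n"
    using m assms(2) by (simp add: mons_def AS)
  then show "mulE x (Poly_Mapping.single m 1) \<in> span_of (mons U V n)"
    by (simp add: AS span_of_single)
qed

lemma parE_mons: "f \<in> span_of (mons U V n) \<Longrightarrow> parE x f \<in> span_of (mons U V n)"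
proof (erule linear_map_span[OF linear_parE])
  fix m
  assume "m \<in> mons U V n"
  then obtain A S where "m = (A, S)" "(A - {#x#}, S) \<in> mons U V n"
    by (cases m) (auto simp: mons_def dest: in_diffD)
  then show "parE x (Poly_Mapping.single m 1) \<in> span_of (mons U V n)"
    by (simp add: span_of_single)
qed

lemma mulO_mons:
  assumes "f \<in> span_of (mons U V (n + 1))" "x \<in> V"
  shows "mulO x f \<in> span_of (mons U V n)"
proof (rule linear_map_span[OF linear_mulO assms(1)])
  fix m
  assume m: "m \<in> mons U V (n + 1)"
  obtain A S where AS: "m = (A, S)" by fastforce
  have "(A, insert x S) \<in> mons U V n" if "x \<notin> S"
    using m assms(2) that by (simp add: mons_def AS)
  then show "mulO x (Poly_Mapping.single m 1) \<in> span_of (mons U V n)"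
    by (simp add: AS span_of_single)
qed

text \<open>The conclusion keeps track of \<open>V - {x}\<close>, since this is how the coefficient
  of the barred generator at a new point is seen to lie over the old barred sites.\<close>

lemma parO_mons:
  assumes "f \<in> span_of (mons U V n)"
  shows "parO x f \<in> span_of (mons U (V - {x}) (n + 1))"
proof (rule linear_map_span[OF linear_parO assms])
  fix m
  assume m: "m \<in> mons U V n"
  obtain A S where AS: "m = (A, S)" by fastforce
  have "(A, S - {x}) \<in> mons U (V - {x}) (n + 1)" if "x \<in> S"
  proof -
    have S: "set_mset A \<subseteq> U" "S \<subseteq> V" "finite S" "n = - int (card S)"
      using m by (auto simp: mons_def AS)
    then have "card S = Suc (card (S - {x}))"
      using that by (intro card.remove)
    with S(4) have "- int (card (S - {x})) = n + 1"
      by linarith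
    moreover have "S - {x} \<subseteq> V - {x}" "finite (S - {x})"
      using S by auto
    ultimately show ?thesis
      using S(1) unfolding mons_def by blast
  qed
  then show "parO x (Poly_Mapping.single m 1) \<in> span_of (mons U (V - {x}) (n + 1))"
    by (simp add: AS span_of_single)
qed

lemma parE_mons_0:
  assumes "f \<in> span_of (mons U V n)" "x \<notin> U"
  shows "parE x f = 0"
proof (rule linear_map_eqI[where f = f])
  fix m
  assume "m \<in> Poly_Mapping.keys f"
  with assms have m: "m \<in> mons U V n"
    by (auto simp: span_of_def)
  obtain A S where AS: "m = (A, S)" by fastforce
  with m assms(2) have "x \<notin># A"
    by (auto simp: mons_def)
  then show "parE x (Poly_Mapping.single m 1) = 0"
    by (simp add: AS not_in_iff)
qed (intro linear_intros)+

lemma parO_mons_0: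
  assumes "f \<in> span_of (mons U V n)" "x \<notin> V"
  shows "parO x f = 0"
proof (rule linear_map_eqI[where f = f])
  fix m
  assume "m \<in> Poly_Mapping.keys f"
  with assms have m: "m \<in> mons U V n"
    by (auto simp: span_of_def)
  obtain A S where AS: "m = (A, S)" by fastforce
  with m assms(2) have "x \<notin> S"
    by (auto simp: mons_def)
  then show "parO x (Poly_Mapping.single m 1) = 0"
    by (simp add: AS)
qed (intro linear_intros)+

lemma parity_mons:
  fixes f :: "mon \<Rightarrow>\<^sub>0 'r::comm_ring_1"
  assumes "f \<in> span_of (mons U V n)"
  shows "parity f = scale (ksign n) f"
proof (rule linear_map_eqI[where f = f])
  fix b :: mon
  assume "b \<in> Poly_Mapping.keys f"
  with assms have "b \<in> mons U V n"
    unfolding span_of_def by blast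
  then have "n = - int (card (snd b))"
    by (cases b) (simp add: mons_def)
  then have "(- 1) ^ card (snd b) = (ksign n :: 'r)"
    by (simp add: ksign_def minus_one_power_iff)
  then show "parity (Poly_Mapping.single b (1::'r)) = scale (ksign n) (Poly_Mapping.single b 1)"
    by simp
qed (intro linear_parity linear_map_intros)+

lemma parO_sym_mult:
  assumes "f \<in> span_of (mons U V n)" "g \<in> span_of fin_mons"
  shows "parO x (sym_mult f g) = sym_mult (parO x f) g + scale (ksign n) (sym_mult f (parO x g))"
  using parO_sym_mult_parity[OF span_mons_fin[OF assms(1)] assms(2), of x]
  by (simp add: parity_mons[OF assms(1)])

lemma sym_mult_mons:
  assumes f: "f \<in> span_of (mons U V p)" and g: "g \<in> span_of (mons U V q)"
  shows "sym_mult f g \<in> span_of (mons U V (p + q))"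
proof (rule linear_map_span[OF linear_sym_mult_left f])
  fix a :: mon
  assume a: "a \<in> mons U V p"
  show "sym_mult (Poly_Mapping.single a 1) g \<in> span_of (mons U V (p + q))"
  proof (rule linear_map_span[OF linear_sym_mult_right g])
    fix b :: mon
    assume b: "b \<in> mons U V q"
    obtain A S B T where AS: "a = (A, S)" "b = (B, T)" by fastforce
    have "(A + B, S \<union> T) \<in> mons U V (p + q)" if "S \<inter> T = {}"
    proof -
      have "card (S \<union> T) = card S + card T"
        using a b that by (intro card_Un_disjoint) (auto simp: mons_def AS)
      with a b show ?thesis
        by (auto simp: mons_def AS)
    qed
    then show "sym_mult (Poly_Mapping.single a 1) (Poly_Mapping.single b 1)
        \<in> span_of (mons U V (p + q))"
      by (simp add: AS span_of_single)
  qed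
qed

lemma sym_mult_commute:
  assumes "f \<in> span_of (mons U V p)" "g \<in> span_of (mons U V q)"
  shows "sym_mult f g = scale (ksign (p * q)) (sym_mult g f)"
proof (rule bilinear_eqI[where f = f and g = g])
  fix a b :: mon
  assume "a \<in> Poly_Mapping.keys f" "b \<in> Poly_Mapping.keys g"
  with assms have ab: "a \<in> mons U V p" "b \<in> mons U V q"
    by (auto simp: span_of_def)
  obtain A S B T where AS: "a = (A, S)" "b = (B, T)" by fastforce
  have "(ksign (p * q) :: 'a) = (- 1) ^ (card S * card T)"
    using ab by (auto simp: AS mons_def ksign_def)
  with ab isgn_swap[of S T, where 'a = 'a]
  show "sym_mult (Poly_Mapping.single a 1) (Poly_Mapping.single b 1)
    = scale (ksign (p * q)) (sym_mult (Poly_Mapping.single b 1) (Poly_Mapping.single a 1) :: mon \<Rightarrow>\<^sub>0 'a)"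
    by (auto simp: AS mons_def add.commute Un_commute)
qed (intro linear_sym_mult linear_map_intros)+

section \<open>Derivations in terms of the operators\<close>

lemma sym_mult_var_Ev: "sym_mult (var (Ev x)) f = mulE x f"
proof (rule linear_map_eqI[where f = f])
  fix m :: mon
  show "sym_mult (var (Ev x)) (Poly_Mapping.single m 1) = mulE x (Poly_Mapping.single m 1)"
    by (cases m) simp
qed (intro linear_intros)+

lemma sym_mult_var_Od:
  assumes "f \<in> span_of fin_mons"
  shows "sym_mult (var (Od x)) f = mulO x f"
proof (rule linear_map_eqI[where f = f])
  fix m :: mon
  assume "m \<in> Poly_Mapping.keys f"
  with assms have "finite (snd m)"
    by (auto simp: span_of_def)
  then show "sym_mult (var (Od x)) (Poly_Mapping.single m 1) = mulO x (Poly_Mapping.single m 1)"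
    by (cases m) (simp add: isgn_singleton)
qed (intro linear_intros)+

lemma sym_prod_Nil [simp]: "sym_prod [] = sym_one"
  and sym_prod_Cons [simp]: "sym_prod (f # fs) = sym_mult f (sym_prod fs)"
  by (simp_all add: sym_prod_def)

lemma sym_prod_fin: "set fs \<subseteq> span_of fin_mons \<Longrightarrow> sym_prod fs \<in> span_of fin_mons"
  by (induction fs) (auto intro: sym_mult_fin fin_one)

lemma var_fin: "var v \<in> span_of fin_mons"
  by (cases v) (auto intro: span_of_intros)

lemma sym_prod_var_fin: "sym_prod (map var w) \<in> span_of fin_mons"
  by (rule sym_prod_fin) (auto intro: var_fin)

lemma sym_prod_var_Cons:
  "sym_prod (map var (Ev x # w)) = mulE x (sym_prod (map var w))"
  "sym_prod (map var (Od x # w)) = mulO x (sym_prod (map var w))"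
  by (simp_all add: sym_mult_var_Ev sym_mult_var_Od sym_prod_var_fin del: var.simps)

text \<open>The barred letters come in increasing order, so each one is multiplied onto larger ones
  and the sign is always 1.\<close>

lemma sym_prod_mon_word:
  assumes "finite S"
  shows "sym_prod (map var (mon_word (A, S))) = Poly_Mapping.single (A, S) (1 :: 'r::comm_ring_1)"
proof -
  have od: "sym_prod (map var (map Od xs)) = Poly_Mapping.single ({#}, set xs) (1 :: 'r)"
    if "sorted_wrt (<) xs" for xs
    using that
  proof (induction xs)
    case Nil
    then show ?case by (simp add: sym_one_def)
  next
    case (Cons x xs)
    then have "\<forall>s\<in>set xs. x < s"
      by simp
    then have "{s \<in> set xs. s < x} = {}"
      by force
    then have "osgn x (set xs) = (1 :: 'r)"
      unfolding osgn_def by (metis card.empty power_0)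
    with Cons show ?case
      by (auto simp: sym_prod_var_Cons simp del: var.simps sym_prod_Cons list.map(2)
        simp: list.map(2)[of Od])
  qed
  have ev: "sym_prod (map var (map Ev ys @ w)) =
      Poly_Mapping.single (mset ys + B, S) (1 :: 'r)"
    if "sym_prod (map var w) = Poly_Mapping.single (B, S) (1 :: 'r)" for ys w B
    using that
    by (induction ys) (simp_all add: sym_mult_var_Ev del: var.simps)
  have "sym_prod (map var (map Od (sorted_list_of_set S))) = Poly_Mapping.single ({#}, S) (1 :: 'r)"
    using od[of "sorted_list_of_set S"] assms by (simp add: strict_sorted_list_of_set)
  from ev[OF this, of "sorted_list_of_multiset A"] show ?thesis
    by (simp add: mon_word_def)
qed

text \<open>Reading a basis element as the product of its word lets a candidate operator be compared
  with the Leibniz recursion letter by letter. The restriction to \<open>B\<close> serves the cone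
  differential, whose formula is right only for words with barred letters at interior
  points.\<close>

lemma derivation_eqI:
  fixes T :: "(mon \<Rightarrow>\<^sub>0 'r::comm_ring_1) \<Rightarrow> (mon \<Rightarrow>\<^sub>0 'r)"
  assumes "linear_map T" "f \<in> span_of B" "B \<subseteq> fin_mons"
    and "\<And>m. m \<in> B \<Longrightarrow> word_deriv p D (mon_word m) = T (sym_prod (map var (mon_word m)))"
  shows "derivation p D f = T f"
proof (rule linear_map_eqI[where f = f])
  fix m
  assume "m \<in> Poly_Mapping.keys f"
  with assms(2) have "m \<in> B"
    by (auto simp: span_of_def)
  with assms(3) have "finite (snd m)" by auto
  with \<open>m \<in> B\<close> assms(4)[of m] sym_prod_mon_word[of "snd m" "fst m", where 'r = 'r]
  show "derivation p D (Poly_Mapping.single m 1) = T (Poly_Mapping.single m 1)"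
    by (simp add: derivation_def)
qed (simp_all add: derivation_def linear_lin_ext assms)

lemma partial_Ev:
  assumes "f \<in> span_of fin_mons"
  shows "partial (Ev x) f = parE x f"
  unfolding partial_def
proof (rule derivation_eqI[OF linear_parE assms order_refl])
  fix m :: mon
  have "word_deriv 0 (\<lambda>w. if w = Ev x then sym_one else 0) w = parE x (sym_prod (map var w))" for w
  proof (induction w)
    case Nil
    show ?case by (simp add: sym_one_def)
  next
    case (Cons v w)
    then show ?case
      by (cases v)
        (auto simp: sym_mult_var_Ev sym_mult_var_Od sym_prod_var_fin parE_mulE mulO_parE fin_ops
          ksign_def simp del: var.simps)
  qed
  then show "word_deriv (- gen_deg (Ev x)) (\<lambda>w. if w = Ev x then sym_one else 0) (mon_word m)
      = parE x (sym_prod (map var (mon_word m)))"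
    by simp
qed

lemma partial_Od:
  assumes "f \<in> span_of fin_mons"
  shows "partial (Od x) f = parO x f"
  unfolding partial_def
proof (rule derivation_eqI[OF linear_parO assms order_refl])
  fix m :: mon
  have "word_deriv 1 (\<lambda>w. if w = Od x then sym_one else 0) w = parO x (sym_prod (map var w))" for w
  proof (induction w)
    case Nil
    show ?case by (simp add: sym_one_def)
  next
    case (Cons v w)
    then show ?case
      by (cases v)
        (auto simp: sym_mult_var_Ev sym_mult_var_Od sym_prod_var_fin parO_mulE parO_mulO
          parO_mulO_same fin_ops ksign_def simp del: var.simps)
  qed
  then show "word_deriv (- gen_deg (Od x)) (\<lambda>w. if w = Od x then sym_one else 0) (mon_word m)
      = parO x (sym_prod (map var (mon_word m)))"
    by simp
qed

section \<open>The differential as a Koszul differential\<close>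

text \<open>
  \<open>bv_op c h s\<close> is the operator \<open>L\<^sub>s\<close>, with \<open>c\<close> standing for the coefficient \<open>- (\<alpha> + \<alpha>\<^sup>-\<^sup>1)\<close> of \<open>Q\<^sub>\<alpha>\<close>.
\<close>

definition bv_op :: "'r::comm_ring_1 \<Rightarrow> 'r \<Rightarrow> int \<Rightarrow> (mon \<Rightarrow>\<^sub>0 'r) \<Rightarrow> (mon \<Rightarrow>\<^sub>0 'r)" where
  "bv_op c h s f = mulE (s - 1) f + mulE (s + 1) f + scale c (mulE s f) + scale h (parE s f)"

definition bv_dif :: "'r::comm_ring_1 \<Rightarrow> 'r \<Rightarrow> int set \<Rightarrow> (mon \<Rightarrow>\<^sub>0 'r) \<Rightarrow> (mon \<Rightarrow>\<^sub>0 'r)" where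
  "bv_dif c h V f = (\<Sum>s\<in>V. bv_op c h s (parO s f))"

lemma linear_bv_op: "linear_map (bv_op c h s)"
  unfolding bv_op_def[abs_def] by (intro linear_map_intros linear_ops)

lemmas bv_op_simps [simp] = linear_map_simps[OF linear_bv_op]

lemma linear_bv_dif: "linear_map (bv_dif c h V)"
  unfolding bv_dif_def[abs_def]
  by (intro linear_map_sums linear_map_comp[OF linear_bv_op] linear_parO)

lemmas bv_dif_simps [simp] = linear_map_simps[OF linear_bv_dif]

lemma bv_op_commute: "bv_op c h s (bv_op c h t f) = bv_op c h t (bv_op c h s f)"
proof -
  \<comment> \<open>The commutator is \<open>h\<close> times the difference of the coefficient of
    the generator at \<open>s\<close> in the linear part of \<open>bv_op c h t\<close> and that with
    \<open>s\<close> and \<open>t\<close> exchanged. Between neighbours both are 1, and at larger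
    distance both are 0.\<close>
  consider "s = t" | "s = t + 1" | "t = s + 1" | "s \<noteq> t" "s \<noteq> t + 1" "t \<noteq> s + 1"
    by blast
  then show ?thesis
  proof cases
    case 4
    then have "s \<noteq> t - 1" "t \<noteq> s - 1"
      by auto
    with 4 show ?thesis
      by (simp add: bv_op_def parE_mulE mulE_mulE parE_parE algebra_simps)
  qed (simp_all add: bv_op_def parE_mulE mulE_mulE parE_parE algebra_simps)
qed

lemma mulE_bv_op: "t \<noteq> s \<Longrightarrow> mulE t (bv_op c h s f) = bv_op c h s (mulE t f)"
  by (simp add: bv_op_def parE_mulE mulE_mulE)

lemma parO_bv_op: "parO x (bv_op c h s f) = bv_op c h s (parO x f)"
  by (simp add: bv_op_def parO_mulE parO_parE)

lemma mulO_bv_op: "mulO x (bv_op c h s f) = bv_op c h s (mulO x f)"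
  by (simp add: bv_op_def mulO_mulE mulO_parE)

lemma parO_bv_dif: "parO x (bv_dif c h V f) = - bv_dif c h V (parO x f)"
  by (simp add: bv_dif_def parO_bv_op parO_parO[of x] flip: sum_negf)

lemma bv_op_bv_dif: "bv_op c h s (bv_dif c h V f) = bv_dif c h V (bv_op c h s f)"
  by (simp add: bv_dif_def parO_bv_op bv_op_commute[of c h s])

lemma bv_dif_mulO:
  assumes "p \<notin> V"
  shows "bv_dif c h V (mulO p f) = - mulO p (bv_dif c h V f)"
proof -
  have "bv_dif c h V (mulO p f) = (\<Sum>s\<in>V. - mulO p (bv_op c h s (parO s f)))"
    unfolding bv_dif_def
  proof (rule sum.cong)
    fix s
    assume "s \<in> V"
    with assms have "s \<noteq> p" by blast
    then show "bv_op c h s (parO s (mulO p f)) = - mulO p (bv_op c h s (parO s f))"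
      by (simp add: parO_mulO mulO_bv_op)
  qed simp
  then show ?thesis
    by (simp add: bv_dif_def sum_negf)
qed

lemma bv_dif_insert:
  "finite V \<Longrightarrow> p \<notin> V \<Longrightarrow> bv_dif c h (insert p V) f = bv_op c h p (parO p f) + bv_dif c h V f"
  by (simp add: bv_dif_def)

text \<open>Adding a point \<open>p\<close> creates one square, which vanishes because
  \<open>parO p\<close> squares to zero, and two cross terms. These cancel, as
  \<open>bv_dif c h V\<close> anticommutes with \<open>parO p\<close> and commutes with
  \<open>bv_op c h p\<close>.\<close>

lemma bv_dif_bv_dif: "bv_dif c h V (bv_dif c h V f) = 0"
proof (induction V rule: infinite_finite_induct)
  case (insert p V)
  then show ?case
    by (simp add: bv_dif_insert parO_bv_dif parO_bv_op bv_op_bv_dif)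
qed (simp_all add: bv_dif_def)

text \<open>An element has no barred generators at the extra points, so their summands vanish. Hence
  extension by zero is compatible with the differentials.\<close>

lemma bv_dif_superset:
  assumes "f \<in> span_of (mons U V n)" "V \<subseteq> V'" "finite V'"
  shows "bv_dif c h V' f = bv_dif c h V f"
  unfolding bv_dif_def
  using assms(2,3) by (intro sum.mono_neutral_right) (auto simp: parO_mons_0[OF assms(1)])

lemma bv_op_mons:
  assumes "f \<in> span_of (mons U V n)" "s - 1 \<in> U" "s \<in> U" "s + 1 \<in> U"
  shows "bv_op c h s f \<in> span_of (mons U V n)"
  unfolding bv_op_def
  by (intro span_of_add span_of_scale mulE_mons parE_mons assms)

lemma bv_dif_mons:
  assumes "f \<in> span_of (mons U V n)" "\<And>s. s \<in> W \<Longrightarrow> s - 1 \<in> U \<and> s \<in> U \<and> s + 1 \<in> U"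
  shows "bv_dif c h W f \<in> span_of (mons U V (n + 1))"
  unfolding bv_dif_def
proof (intro span_of_sum bv_op_mons)
  show "parO s f \<in> span_of (mons U V (n + 1))" for s
    using parO_mons[OF assms(1)] by (rule span_mons_mono) auto
qed (use assms(2) in blast)+

text \<open>Multiplication by a linear element may act on either factor; only the derivation part of
  \<open>bv_op\<close> leaves a correction, in which the other factor is differentiated.\<close>

lemma bv_op_sym_mult:
  "bv_op c h s (sym_mult f g) = sym_mult (bv_op c h s f) g + scale h (sym_mult f (parE s g))"
  "bv_op c h s (sym_mult f g) = sym_mult f (bv_op c h s g) + scale h (sym_mult (parE s f) g)"
  by (simp_all add: bv_op_def sym_mult_mulE_left sym_mult_mulE_right parE_sym_mult)

text \<open>
  The differential is of second order, but the mixed terms involve a derivative of one factor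
  at a point where the other factor has a barred generator.
\<close>

lemma bv_dif_sym_mult:
  assumes f: "f \<in> span_of (mons U V p)" and g: "g \<in> span_of (mons U' V' q)"
    and disj: "V \<inter> U' = {}" "V' \<inter> U = {}"
  shows "bv_dif c h W (sym_mult f g)
    = sym_mult (bv_dif c h W f) g + scale (ksign p) (sym_mult f (bv_dif c h W g))"
proof -
  have "bv_op c h s (parO s (sym_mult f g)) = sym_mult (bv_op c h s (parO s f)) g
      + scale (ksign p) (sym_mult f (bv_op c h s (parO s g)))" for s
  proof -
    have "bv_op c h s (sym_mult (parO s f) g) = sym_mult (bv_op c h s (parO s f)) g"
    proof (cases "s \<in> V")
      case True
      with disj show ?thesis
        by (subst bv_op_sym_mult(1)) (simp add: parE_mons_0[OF g] disjoint_iff)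
    qed (simp add: parO_mons_0[OF f])
    moreover have "bv_op c h s (sym_mult f (parO s g)) = sym_mult f (bv_op c h s (parO s g))"
    proof (cases "s \<in> V'")
      case True
      with disj show ?thesis
        by (subst bv_op_sym_mult(2)) (simp add: parE_mons_0[OF f] disjoint_iff)
    qed (simp add: parO_mons_0[OF g])
    ultimately show ?thesis
      by (simp add: parO_sym_mult[OF f span_mons_fin[OF g]])
  qed
  then show ?thesis
    by (simp add: bv_dif_def sum.distrib scale_sum)
qed

section \<open>Adding one site\<close>

lemma lookup_mulE: "Poly_Mapping.lookup (mulE t f) (add_mset t A, S) = Poly_Mapping.lookup f (A, S)"
proof -
  have "f \<in> span_of UNIV"
    by (simp add: span_of_def)
  then show ?thesis
  proof (induction rule: span_induct)
    case (basis b)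
    then show ?case
      by (cases b) (simp add: lookup_single when_def)
  qed (simp_all add: lookup_add)
qed

text \<open>
  The old complex \<open>K\<close> has generators \<open>\<delta>\<^sub>x\<close> for \<open>x \<in> U\<close> and barred generators for \<open>y \<in> V\<close>; the new
  site \<open>t\<close> and the site \<open>u\<close> are the two neighbours of \<open>p\<close>.
\<close>

locale new_site =
  fixes c h :: "'r::comm_ring_1" and U V :: "int set" and t p u :: int
  assumes t: "t \<notin> U" and p: "p \<in> U" "p \<notin> V" and u: "u \<in> U"
    and nbs: "{p - 1, p + 1} = {t, u}"
    and fin: "finite V"
    and V: "\<And>s. s \<in> V \<Longrightarrow> s - 1 \<in> U \<and> s \<in> U \<and> s + 1 \<in> U"
begin

definition E :: "(mon \<Rightarrow>\<^sub>0 'r) \<Rightarrow> (mon \<Rightarrow>\<^sub>0 'r)" where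
  "E f = mulE u f + scale c (mulE p f) + scale h (parE p f)"

lemma bv_op_E: "bv_op c h p f = mulE t f + E f"
  using nbs unfolding bv_op_def E_def by (auto simp: doubleton_eq_iff)

lemma linear_E: "linear_map E"
  unfolding E_def[abs_def] by (intro linear_map_intros linear_ops)

lemma E_mons: "f \<in> span_of (mons U' V' n) \<Longrightarrow> U \<subseteq> U' \<Longrightarrow> E f \<in> span_of (mons U' V' n)"
  unfolding E_def using p u by (intro span_of_add span_of_scale mulE_mons parE_mons) auto

lemma t_neq_p: "t \<noteq> p"
  using t p by blast

text \<open>\<open>E\<close> is the difference of \<open>bv_op c h p\<close> and
  \<open>mulE t\<close>, and both commute with \<open>bv_op c h p\<close>.\<close>

lemma E_bv_op: "E (bv_op c h p f) = bv_op c h p (E f)"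
proof -
  have E: "E f = bv_op c h p f - mulE t f" for f
    by (simp add: bv_op_E)
  show ?thesis
    unfolding E linear_map_diff[OF linear_bv_op] mulE_bv_op[OF t_neq_p] ..
qed

text \<open>Division with remainder, by induction on the exponent of the generator at
  \<open>t\<close>. Write \<open>mulE t f\<close> as \<open>bv_op c h p f - E f\<close>; since
  \<open>E\<close> commutes with \<open>bv_op c h p\<close> and preserves the possible remainders, a
  decomposition of \<open>f\<close> yields one of \<open>mulE t f\<close>.\<close>

lemma bv_op_complement:
  assumes "f \<in> span_of (mons (insert t U) W n)"
  shows "\<exists>r\<in>span_of (mons U W n). \<exists>g\<in>span_of (mons (insert t U) W n). f = r + bv_op c h p g"
    (is "?P f")
  using assms
proof (induction rule: span_induct)
  case zero
  show ?case
    by (intro bexI[where x = 0]) auto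
next
  case (basis b)
  have step: "?P (mulE t f)" if f: "f \<in> span_of (mons (insert t U) W n)" and "?P f" for f
  proof -
    from \<open>?P f\<close> obtain r g where rg: "r \<in> span_of (mons U W n)"
      "g \<in> span_of (mons (insert t U) W n)" "f = r + bv_op c h p g"
      by blast
    have "mulE t f = bv_op c h p f - E f"
      by (simp add: bv_op_E)
    also have "E f = E r + bv_op c h p (E g)"
      using rg(3) by (simp only: linear_map_add[OF linear_E] E_bv_op)
    finally have "mulE t f = - E r + bv_op c h p (f - E g)"
      by simp
    moreover have "- E r \<in> span_of (mons U W n)"
      using rg by (intro span_of_uminus E_mons) auto
    moreover have "f - E g \<in> span_of (mons (insert t U) W n)"
      using rg f by (intro span_of_diff E_mons) auto
    ultimately show ?thesis
      by blast
  qed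
  obtain A S where b: "b = (A, S)" by fastforce
  have "?P (Poly_Mapping.single (A, S) 1)"
    if "(A, S) \<in> mons (insert t U) W n" for A
    using that
  proof (induction "count A t" arbitrary: A)
    case 0
    then have "t \<notin># A"
      by (simp add: not_in_iff)
    have "x \<in> U" if "x \<in># A" for x
    proof -
      have "x \<in> insert t U" using that 0(2) by (auto simp: mons_def)
      with that \<open>t \<notin># A\<close> show ?thesis by blast
    qed
    then have "set_mset A \<subseteq> U"
      by blast
    with 0(2) have "(A, S) \<in> mons U W n"
      by (simp add: mons_def)
    then have "Poly_Mapping.single (A, S) 1 \<in> span_of (mons U W n)"
      by (rule span_of_single)
    then show ?case
      by (intro bexI[where x = "Poly_Mapping.single (A, S) 1"] bexI[where x = 0]) auto
  next
    case (Suc k)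
    then have "t \<in># A"
      by (metis count_eq_zero_iff nat.distinct(1))
    then obtain B where A: "A = add_mset t B"
      by (meson multi_member_split)
    with Suc have B: "k = count B t" "(B, S) \<in> mons (insert t U) W n"
      by (simp_all add: mons_def)
    from step[OF span_of_single[OF B(2)] Suc(1)[OF B]] show ?case
      by (simp add: A)
  qed
  with basis b show ?case
    by blast
next
  case (add f g)
  then obtain r r' k k' where "r \<in> span_of (mons U W n)" "r' \<in> span_of (mons U W n)"
    "k \<in> span_of (mons (insert t U) W n)" "k' \<in> span_of (mons (insert t U) W n)"
    "f = r + bv_op c h p k" "g = r' + bv_op c h p k'"
    by blast
  then show ?case
    by (intro bexI[where x = "r + r'"] bexI[where x = "k + k'"])
      (auto intro: span_of_add simp: algebra_simps)
next
  case (scale a f)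
  then obtain r k where "r \<in> span_of (mons U W n)" "k \<in> span_of (mons (insert t U) W n)"
    "f = r + bv_op c h p k"
    by blast
  then show ?case
    by (intro bexI[where x = "scale a r"] bexI[where x = "scale a k"])
      (auto intro: span_of_scale)
qed

text \<open>Comparison of top terms. \<open>E\<close> does not raise the exponent of the generator
  at \<open>t\<close>, so a monomial of highest exponent in \<open>g\<close>, multiplied by that
  generator, keeps its coefficient in \<open>bv_op c h p g\<close>; an element over \<open>U\<close>
  has no such monomial. Besides injectivity this shows that the image meets the old complex only in
  0.\<close>

lemma bv_op_inj:
  assumes "bv_op c h p g \<in> span_of (mons U W n)"
  shows "g = 0"
proof (rule ccontr)
  assume "g \<noteq> 0"
  let ?deg = "\<lambda>m::mon. count (fst m) t"
  define N where "N = Max (?deg ` Poly_Mapping.keys g)"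
  have ne: "Poly_Mapping.keys g \<noteq> {}"
    using \<open>g \<noteq> 0\<close> by (metis keys_eq_empty)
  then have "N \<in> ?deg ` Poly_Mapping.keys g"
    unfolding N_def by (intro Max_in) auto
  then obtain A S where AS: "(A, S) \<in> Poly_Mapping.keys g" "count A t = N"
    by force
  have g: "g \<in> span_of {m. ?deg m \<le> N}"
    unfolding span_of_def N_def by (auto intro!: Max_ge)
  have neq: "p \<noteq> t" "u \<noteq> t"
    using t p u by blast+
  have "mulE x g \<in> span_of {m. ?deg m \<le> N}" if "x \<noteq> t" for x
    by (rule linear_map_span[OF linear_mulE g]) (use that in \<open>auto simp: span_of_single\<close>)
  moreover have "parE p g \<in> span_of {m. ?deg m \<le> N}"
    by (rule linear_map_span[OF linear_parE g]) (use neq in \<open>auto simp: span_of_single\<close>)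
  ultimately have "E g \<in> span_of {m. ?deg m \<le> N}"
    unfolding E_def using neq by (intro span_of_add span_of_scale)
  moreover have "(add_mset t A, S) \<notin> {m. ?deg m \<le> N}"
    using AS by simp
  ultimately have "(add_mset t A, S) \<notin> Poly_Mapping.keys (E g)"
    unfolding span_of_def by blast
  then have "Poly_Mapping.lookup (E g) (add_mset t A, S) = 0"
    by (simp add: in_keys_iff)
  then have "Poly_Mapping.lookup (bv_op c h p g) (add_mset t A, S) = Poly_Mapping.lookup g (A, S)"
    by (simp add: bv_op_E lookup_add lookup_mulE)
  also have "\<dots> \<noteq> 0"
    using AS by (simp add: in_keys_iff)
  finally have "(add_mset t A, S) \<in> Poly_Mapping.keys (bv_op c h p g)"
    by (simp add: in_keys_iff)
  with assms have "(add_mset t A, S) \<in> mons U W n"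
    unfolding span_of_def by blast
  with t show False
    by (simp add: mons_def)
qed

section \<open>Descent of cocycles and coboundaries to the old complex\<close>

abbreviation "U' \<equiv> insert t U"
abbreviation "V' \<equiv> insert p V"

text \<open>Three components: the old complex, the image of \<open>bv_op c h p\<close>, and the
  multiples of the barred generator at \<open>p\<close>. Subtracting
  \<open>mulO p (parO p y)\<close> removes precisely the monomials containing that generator, and
  what remains is divided by \<open>bv_op c h p\<close>.\<close>

lemma split_off:
  assumes y: "y \<in> span_of (mons U' V' n)"
  obtains r k g where "r \<in> span_of (mons U V n)" "k \<in> span_of (mons U' V n)"
    "g \<in> span_of (mons U' V (n + 1))" "y = r + bv_op c h p k + mulO p g"
proof -
  have g: "parO p y \<in> span_of (mons U' V (n + 1))"
    using parO_mons[OF y, of p] by (rule span_mons_mono) auto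
  have "y - mulO p (parO p y) \<in> span_of (mons U' V n)"
  proof (rule linear_map_span[OF _ y, where T = "\<lambda>y. y - mulO p (parO p y)"])
    show "linear_map (\<lambda>y :: mon \<Rightarrow>\<^sub>0 'r. y - mulO p (parO p y))"
      by (intro linear_map_intros linear_ops)
    fix m
    assume m: "m \<in> mons U' V' n"
    obtain A S where AS: "m = (A, S)" by fastforce
    show "Poly_Mapping.single m 1 - mulO p (parO p (Poly_Mapping.single m (1 :: 'r)))
        \<in> span_of (mons U' V n)"
    proof (cases "p \<in> S")
      case True
      moreover have "finite S"
        using m by (simp add: mons_def AS)
      ultimately show ?thesis
        by (simp add: AS osgn_remove insert_absorb)
    next
      case False
      then have "(A, S) \<in> mons U' V n"
        using m by (simp add: mons_def AS subset_insert)
      with False show ?thesis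
        by (simp add: AS span_of_single)
    qed
  qed
  from bv_op_complement[OF this] obtain r k where rk: "r \<in> span_of (mons U V n)"
    "k \<in> span_of (mons U' V n)" "y - mulO p (parO p y) = r + bv_op c h p k"
    by blast
  from rk(3) have "y = r + bv_op c h p k + mulO p (parO p y)"
    by (simp add: algebra_simps)
  with rk(1,2) g show thesis
    by (rule that)
qed

lemma parO_p: "f \<in> span_of (mons W V n) \<Longrightarrow> parO p f = 0"
  using p by (blast intro: parO_mons_0)

lemma dif_V':
  assumes "r \<in> span_of (mons U V n)" "k \<in> span_of (mons U' V n)" "g \<in> span_of (mons U' V m)"
  shows "bv_dif c h V' (r + bv_op c h p k + mulO p g)
    = bv_dif c h V r + bv_op c h p (bv_dif c h V k + g) - mulO p (bv_dif c h V g)"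
  using p fin
  by (simp add: bv_dif_insert parO_bv_op parO_p[OF assms(1)] parO_p[OF assms(2)]
      parO_mulO_same[OF span_mons_fin[OF assms(3)]] parO_p[OF assms(3)] bv_dif_mulO bv_op_bv_dif)

text \<open>Comparing the components with and without the barred generator at \<open>p\<close>.\<close>

lemma bv_op_plus_mulO_eq:
  assumes x: "x \<in> span_of (mons U V n)" and e: "e \<in> span_of (mons U' V n)"
    and w: "w \<in> span_of (mons U' V m)"
    and eq: "x = bv_op c h p e - mulO p w"
  shows "x = 0 \<and> e = 0 \<and> w = 0"
proof -
  have "parO p x = bv_op c h p (parO p e) - parO p (mulO p w)"
    by (simp add: eq parO_bv_op)
  then have w0: "w = 0"
    by (simp add: parO_p[OF x] parO_p[OF e] parO_p[OF w] parO_mulO_same[OF span_mons_fin[OF w]])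
  with eq x have "e = 0"
    by (intro bv_op_inj[of e V n]) simp
  with w0 eq show ?thesis
    by simp
qed

text \<open>Injectivity on cohomology. The remainder \<open>r\<close> of \<open>y\<close> serves as
  new primitive: \<open>x - bv_dif c h V r\<close> lies in the old complex and also in the sum of
  the other two components, hence is zero.\<close>

lemma coboundary_descends:
  assumes x: "x \<in> span_of (mons U V n)" and y: "y \<in> span_of (mons U' V' (n - 1))"
    and eq: "bv_dif c h V' y = x"
  shows "\<exists>y'\<in>span_of (mons U V (n - 1)). bv_dif c h V y' = x"
proof -
  from y obtain r k g where r: "r \<in> span_of (mons U V (n - 1))"
    and k: "k \<in> span_of (mons U' V (n - 1))" and g: "g \<in> span_of (mons U' V (n - 1 + 1))"
    and y_eq: "y = r + bv_op c h p k + mulO p g"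
    by (rule split_off)
  have dr: "bv_dif c h V r \<in> span_of (mons U V n)"
    using bv_dif_mons[OF r, of V c h] V by simp
  have dk: "bv_dif c h V k \<in> span_of (mons U' V n)"
    using bv_dif_mons[OF k, of V c h] V by simp
  have dg: "bv_dif c h V g \<in> span_of (mons U' V (n - 1 + 1 + 1))"
    using bv_dif_mons[OF g, of V c h] V by simp
  have "x - bv_dif c h V r = bv_op c h p (bv_dif c h V k + g) - mulO p (bv_dif c h V g)"
    using eq dif_V'[OF r k g] y_eq by (simp add: algebra_simps)
  then have "x - bv_dif c h V r = 0"
    using bv_op_plus_mulO_eq[OF span_of_diff[OF x dr] span_of_add[OF dk] dg, of g] g by simp
  with r show ?thesis
    by auto
qed

text \<open>Surjectivity on cohomology, with the remainder of \<open>z\<close> as representative.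
  The three components of the differential of \<open>z\<close> vanish separately.\<close>

lemma cocycle_descends:
  assumes z: "z \<in> span_of (mons U' V' n)" and dz: "bv_dif c h V' z = 0"
  shows "\<exists>r\<in>span_of (mons U V n). bv_dif c h V r = 0 \<and>
    (\<exists>y\<in>span_of (mons U' V' (n - 1)). z = r + bv_dif c h V' y)"
proof -
  from z obtain r k g where r: "r \<in> span_of (mons U V n)"
    and k: "k \<in> span_of (mons U' V n)" and g: "g \<in> span_of (mons U' V (n + 1))"
    and z_eq: "z = r + bv_op c h p k + mulO p g"
    by (rule split_off)
  have dr: "bv_dif c h V r \<in> span_of (mons U V (n + 1))"
    using bv_dif_mons[OF r, of V c h] V by simp
  have dk: "bv_dif c h V k \<in> span_of (mons U' V (n + 1))"
    using bv_dif_mons[OF k, of V c h] V by simp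
  have dg: "bv_dif c h V g \<in> span_of (mons U' V (n + 1 + 1))"
    using bv_dif_mons[OF g, of V c h] V by simp
  have "- bv_dif c h V r = bv_op c h p (bv_dif c h V k + g) - mulO p (bv_dif c h V g)"
    using dz dif_V'[OF r k g] z_eq by (simp add: algebra_simps)
  then have "bv_dif c h V r = 0" "bv_dif c h V k + g = 0"
    using bv_op_plus_mulO_eq[OF span_of_uminus[OF dr] span_of_add[OF dk g] dg] by simp_all
  \<comment> \<open>The differential of \<open>mulO p k\<close> has \<open>bv_op c h p k\<close> as
    its part without the new barred generator; the cocycle condition
    \<open>bv_dif c h V k = - g\<close> makes its other part \<open>mulO p g\<close>.\<close>
  moreover have "z = r + bv_dif c h V' (mulO p k)"
  proof -
    have "bv_dif c h V' (mulO p k) = bv_op c h p k - mulO p (bv_dif c h V k)"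
      using dif_V'[OF span_of_0 span_of_0 k] by simp
    moreover have "bv_dif c h V k = - g"
      using \<open>bv_dif c h V k + g = 0\<close> by (simp add: eq_neg_iff_add_eq_0)
    ultimately show ?thesis
      using z_eq by simp
  qed
  moreover have "mulO p k \<in> span_of (mons U' V' (n - 1))"
  proof (rule mulO_mons)
    show "k \<in> span_of (mons U' V' (n - 1 + 1))"
      using span_mons_mono[OF k, of U' V'] by auto
  qed simp
  ultimately show ?thesis
    using r by blast
qed

end

section \<open>The complex of an interval\<close>

lemma zpts_eq: "zpts I = {\<lfloor>fst I\<rfloor> + 1..\<lceil>snd I\<rceil> - 1}"
  by (auto simp: zpts_def add1_zle_eq floor_less_iff less_ceiling_iff)

text \<open>Floor and ceiling commute with integer shifts, so shrinking moves both ends of the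
  integer range by exactly one, also when end points of the interval are integers.\<close>

lemma zpts_shrink_eq: "zpts (shrink I) = {\<lfloor>fst I\<rfloor> + 1 + 1..\<lceil>snd I\<rceil> - 1 - 1}"
  by (simp add: zpts_eq shrink_def)

lemma finite_zpts [simp]: "finite (zpts I)"
  by (simp add: zpts_eq)

lemma zpts_shrink_nbs: "s \<in> zpts (shrink I) \<Longrightarrow> s - 1 \<in> zpts I \<and> s \<in> zpts I \<and> s + 1 \<in> zpts I"
  by (auto simp: zpts_def shrink_def)

lemma sym_basis_mons: "sym_basis I n = mons (zpts I) (zpts (shrink I)) n"
  unfolding sym_basis_def mons_def by (auto intro: finite_subset)

lemma sym_basis_mono:
  assumes "I \<in> D11_colors" "ival I \<subseteq> ival J"
  shows "zpts I \<subseteq> zpts J" "zpts (shrink I) \<subseteq> zpts (shrink J)" "sym_basis I n \<subseteq> sym_basis J n"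
proof -
  \<comment> \<open>\<open>I\<close> is nonempty because of its length, so the inclusion of sets
    does compare the end points.\<close>
  have "fst J \<le> fst I" "snd I \<le> snd J"
    using assms by (auto simp: D11_colors_def ival_def greaterThanLessThan_subseteq_greaterThanLessThan)
  then show "zpts I \<subseteq> zpts J" "zpts (shrink I) \<subseteq> zpts (shrink J)"
    by (auto simp: zpts_def shrink_def)
  then show "sym_basis I n \<subseteq> sym_basis J n"
    unfolding sym_basis_mons by (rule mons_mono)
qed

lemma carrier_free_mod [simp]: "carrier (free_mod B) = span_of B"
  and zero_free_mod [simp]: "\<zero>\<^bsub>free_mod B\<^esub> = 0"
  and add_free_mod [simp]: "add (free_mod B) = (+)"
  and smult_free_mod [simp]: "module.smult (free_mod B) = scale"
  by (simp_all add: free_mod_def span_of_def)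

lemma scalars_simps [simp]:
  "carrier scalars = UNIV" "add scalars = (+)" "monoid.mult scalars = (*)" "\<one>\<^bsub>scalars\<^esub> = 1"
  by (simp_all add: ring_of_type_algebra_def)

lemma cring_scalars: "cring (scalars :: 'r::comm_ring_1 ring)"
  by (rule cring_from_type_algebra)

lemma module_free_mod: "module scalars (free_mod B)"
proof (rule moduleI[OF cring_scalars])
  show "abelian_group (free_mod B)"
  proof (rule abelian_groupI)
    fix f
    assume "f \<in> carrier (free_mod B)"
    then show "\<exists>g\<in>carrier (free_mod B). g \<oplus>\<^bsub>free_mod B\<^esub> f = \<zero>\<^bsub>free_mod B\<^esub>"
      by (intro bexI[where x = "- f"]) (auto intro: span_of_uminus)
  qed (auto intro: span_of_add simp: ac_simps)
qed (auto intro: span_of_scale simp: scale_add_left)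

lemma Oq_Cmod [simp]: "Cmod (Oq \<iota> \<alpha> h I) n = free_mod (sym_basis I n)"
  by (simp add: Oq_def)

text \<open>For an interior point \<open>x\<close> all three points supporting
  \<open>Q_op \<alpha> (delta x)\<close> lie in \<open>zpts I\<close>, so \<open>lin_elt\<close>
  cuts nothing off. The values there are 1, \<open>- (\<alpha> + inverse \<alpha>)\<close> and 1;
  their images under \<open>\<iota>\<close> are the coefficients of
  \<open>bv_op c 0 x\<close>.\<close>

lemma word_deriv_cone_dif:
  fixes \<iota> :: "'k::field \<Rightarrow> 'r::comm_ring_1" and \<alpha> :: 'k
  assumes \<iota>: "\<iota> 0 = 0" "\<iota> 1 = 1" and w: "\<And>x. Od x \<in> set w \<Longrightarrow> x \<in> zpts (shrink I)"
  defines "c \<equiv> \<iota> (- (\<alpha> + inverse \<alpha>))"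
  shows "word_deriv 1 (cone_dif \<iota> \<alpha> I) w
    = (\<Sum>s\<in>zpts (shrink I). bv_op c 0 s (parO s (sym_prod (map var w))))"
  using w
proof (induction w)
  case Nil
  show ?case by (simp add: sym_one_def)
next
  case (Cons v w)
  let ?W = "sym_prod (map var w) :: mon \<Rightarrow>\<^sub>0 'r"
  have fin: "?W \<in> span_of fin_mons"
    by (rule sym_prod_var_fin)
  have lin: "sym_mult (lin_elt \<iota> I (Q_op \<alpha> (delta x))) f = bv_op c 0 x f"
    if "x \<in> zpts (shrink I)" for x and f :: "mon \<Rightarrow>\<^sub>0 'r"
  proof -
    have "sym_mult (lin_elt \<iota> I (Q_op \<alpha> (delta x))) f
        = (\<Sum>y\<in>zpts I. scale (\<iota> (Q_op \<alpha> (delta x) y)) (mulE y f))"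
      by (simp add: lin_elt_def sym_mult_var_Ev del: var.simps)
    also have "\<dots> = (\<Sum>y\<in>{x - 1, x, x + 1}. scale (\<iota> (Q_op \<alpha> (delta x) y)) (mulE y f))"
    proof (rule sum.mono_neutral_right)
      show "{x - 1, x, x + 1} \<subseteq> zpts I"
        using zpts_shrink_nbs[OF that] by simp
    qed (auto simp: Q_op_def delta_def \<iota>)
    also have "\<dots> = bv_op c 0 x f"
      by (simp add: bv_op_def Q_op_def delta_def \<iota> c_def algebra_simps)
    finally show ?thesis .
  qed
  have IH: "word_deriv 1 (cone_dif \<iota> \<alpha> I) w
      = (\<Sum>s\<in>zpts (shrink I). bv_op c 0 s (parO s ?W))"
    using Cons by simp
  have IH_fin: "word_deriv 1 (cone_dif \<iota> \<alpha> I) w \<in> span_of fin_mons"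
    unfolding IH bv_op_def
    by (intro span_of_sum span_of_add span_of_scale fin_ops fin)
  show ?case
  proof (cases v)
    case (Ev x)
    have "bv_op c 0 s (parO s (mulE x ?W)) = mulE x (bv_op c 0 s (parO s ?W))" for s
      by (simp add: bv_op_def parO_mulE mulE_mulE)
    then show ?thesis
      by (simp add: Ev IH sym_mult_var_Ev ksign_def del: var.simps)
  next
    case (Od x)
    with Cons.prems have x: "x \<in> zpts (shrink I)"
      by simp
    have "bv_op c 0 s (parO s (mulO x ?W))
        = (if s = x then bv_op c 0 x ?W else 0) - mulO x (bv_op c 0 s (parO s ?W))" for s
      by (simp add: parO_mulO_same[OF fin] parO_mulO mulO_bv_op)
    moreover have "(\<Sum>s\<in>zpts (shrink I). if s = x then bv_op c 0 x ?W else 0) = bv_op c 0 x ?W"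
      using x by simp
    ultimately have "(\<Sum>s\<in>zpts (shrink I). bv_op c 0 s (parO s (mulO x ?W)))
        = bv_op c 0 x ?W - mulO x (word_deriv 1 (cone_dif \<iota> \<alpha> I) w)"
      by (simp only: IH sum_subtractf mulO_simps)
    then show ?thesis
      by (simp add: Od lin[OF x] sym_mult_var_Od fin IH_fin ksign_def del: var.simps)
  qed
qed

context
  fixes \<iota> :: "'k::field \<Rightarrow> 'r::comm_ring_1" and \<alpha> :: 'k and h :: 'r and c :: 'r
  assumes \<iota>: "\<iota> 0 = 0" "\<iota> 1 = 1" and c: "c = \<iota> (- (\<alpha> + inverse \<alpha>))"
begin

text \<open>\<open>bv_op c h s\<close> is split into its value at \<open>h = 0\<close> and
  \<open>h\<close> times \<open>parE s\<close>: summed over the interior points, the first part is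
  the derivation extending the cone differential and the second is the BV Laplacian.\<close>

lemma Oq_dif:
  assumes f: "f \<in> span_of (sym_basis I n)"
  shows "dif (Oq \<iota> \<alpha> h I) n f = bv_dif c h (zpts (shrink I)) f"
proof -
  let ?V = "zpts (shrink I)"
  have fin: "f \<in> span_of fin_mons"
    using f unfolding sym_basis_mons by (rule span_mons_fin)
  have cone: "derivation 1 (cone_dif \<iota> \<alpha> I) f = (\<Sum>s\<in>?V. bv_op c 0 s (parO s f))"
  proof (rule derivation_eqI[OF _ f])
    show "linear_map (\<lambda>f. \<Sum>s\<in>?V. bv_op c 0 s (parO s f))"
      by (intro linear_map_sums linear_map_comp[OF linear_bv_op] linear_parO)
    show "sym_basis I n \<subseteq> fin_mons"
      unfolding sym_basis_mons by (rule mons_fin)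
    fix m
    assume "m \<in> sym_basis I n"
    then have "snd m \<subseteq> ?V" "finite (snd m)"
      by (auto simp: sym_basis_mons mons_def)
    then have "x \<in> ?V" if "Od x \<in> set (mon_word m)" for x
      using that by (auto simp: mon_word_def)
    from word_deriv_cone_dif[OF \<iota> this]
    show "word_deriv 1 (cone_dif \<iota> \<alpha> I) (mon_word m)
        = (\<Sum>s\<in>?V. bv_op c 0 s (parO s (sym_prod (map var (mon_word m)))))"
      by (simp add: c)
  qed
  have bv: "BV_laplacian I f = (\<Sum>s\<in>?V. parE s (parO s f))"
    by (simp add: BV_laplacian_def partial_Ev[OF fin] partial_Od fin_ops fin parO_parE)
  have "bv_op c h s g = bv_op c 0 s g + scale h (parE s g)" for s g
    by (simp add: bv_op_def)
  then show ?thesis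
    by (simp add: Oq_def cone bv bv_dif_def sum.distrib scale_sum)
qed

lemma Oq_dif_closed:
  assumes "f \<in> span_of (sym_basis I n)"
  shows "bv_dif c h (zpts (shrink I)) f \<in> span_of (sym_basis I (n + 1))"
  using assms unfolding sym_basis_mons by (rule bv_dif_mons) (rule zpts_shrink_nbs)

lemma Oq_cochain_complex: "cochain_complex (Oq \<iota> \<alpha> h I)"
  unfolding cochain_complex_def mod_hom_def
  by (auto simp: module_free_mod Oq_dif Oq_dif_closed span_of_add span_of_scale bv_dif_bv_dif)

end

section \<open>Local constancy\<close>

text \<open>The two conjuncts are injectivity and surjectivity of the inclusion on cohomology,
  stated for representatives.\<close>

definition quasi_iso_incl ::
    "'r::comm_ring_1 \<Rightarrow> 'r \<Rightarrow> int set \<Rightarrow> int set \<Rightarrow> int set \<Rightarrow> int set \<Rightarrow> bool" where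
  "quasi_iso_incl c h U V U' V' \<longleftrightarrow>
     (\<forall>n. \<forall>x\<in>span_of (mons U V n). \<forall>y\<in>span_of (mons U' V' (n - 1)). bv_dif c h V' y = x \<longrightarrow>
        (\<exists>y'\<in>span_of (mons U V (n - 1)). bv_dif c h V y' = x)) \<and>
     (\<forall>n. \<forall>z\<in>span_of (mons U' V' n). bv_dif c h V' z = 0 \<longrightarrow>
        (\<exists>r\<in>span_of (mons U V n). bv_dif c h V r = 0 \<and>
          (\<exists>y\<in>span_of (mons U' V' (n - 1)). z = r + bv_dif c h V' y)))"

lemma quasi_iso_incl_coboundary:
  assumes "quasi_iso_incl c h U V U' V'" "x \<in> span_of (mons U V n)"
    and "x \<in> bv_dif c h V' ` span_of (mons U' V' (n - 1))"
  shows "x \<in> bv_dif c h V ` span_of (mons U V (n - 1))"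
proof -
  from assms(3) obtain y where y: "y \<in> span_of (mons U' V' (n - 1))" "bv_dif c h V' y = x"
    by blast
  with assms(1,2) obtain y' where "y' \<in> span_of (mons U V (n - 1))" "bv_dif c h V y' = x"
    unfolding quasi_iso_incl_def by blast
  then show ?thesis
    by blast
qed

lemma quasi_iso_incl_refl: "quasi_iso_incl c h U V U V"
  unfolding quasi_iso_incl_def
proof (intro conjI allI ballI impI)
  fix n z
  assume "z \<in> span_of (mons U V n)" "bv_dif c h V z = 0"
  then show "\<exists>r\<in>span_of (mons U V n). bv_dif c h V r = 0 \<and>
      (\<exists>y\<in>span_of (mons U V (n - 1)). z = r + bv_dif c h V y)"
    by (intro bexI[where x = z] conjI bexI[where x = 0]) auto
qed blast

lemma quasi_iso_incl_trans:
  assumes 1: "quasi_iso_incl c h U V U' V'" and 2: "quasi_iso_incl c h U' V' U'' V''"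
    and sub: "U \<subseteq> U'" "V \<subseteq> V'" "U' \<subseteq> U''" "V' \<subseteq> V''" "finite V''"
  shows "quasi_iso_incl c h U V U'' V''"
  unfolding quasi_iso_incl_def
proof (intro conjI allI ballI impI)
  fix n x y
  assume x: "x \<in> span_of (mons U V n)" and y: "y \<in> span_of (mons U'' V'' (n - 1))"
    and eq: "bv_dif c h V'' y = x"
  have "x \<in> span_of (mons U' V' n)"
    using x sub(1,2) by (rule span_mons_mono)
  with 2 y eq obtain y' where "y' \<in> span_of (mons U' V' (n - 1))" "bv_dif c h V' y' = x"
    unfolding quasi_iso_incl_def by blast
  with 1 x show "\<exists>y'\<in>span_of (mons U V (n - 1)). bv_dif c h V y' = x"
    unfolding quasi_iso_incl_def by blast
next
  fix n z
  assume z: "z \<in> span_of (mons U'' V'' n)" "bv_dif c h V'' z = 0"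
  with 2 obtain r y where r: "r \<in> span_of (mons U' V' n)" "bv_dif c h V' r = 0"
    and y: "y \<in> span_of (mons U'' V'' (n - 1))" and z_eq: "z = r + bv_dif c h V'' y"
    unfolding quasi_iso_incl_def by blast
  from 1 r obtain r' y' where r': "r' \<in> span_of (mons U V n)" "bv_dif c h V r' = 0"
    and y': "y' \<in> span_of (mons U' V' (n - 1))" and r_eq: "r = r' + bv_dif c h V' y'"
    unfolding quasi_iso_incl_def by blast
  have "bv_dif c h V' y' = bv_dif c h V'' y'"
    using bv_dif_superset[OF y' sub(4,5)] by simp
  with z_eq r_eq have "z = r' + bv_dif c h V'' (y' + y)"
    by simp
  moreover have "y' + y \<in> span_of (mons U'' V'' (n - 1))"
    using span_mons_mono[OF y' sub(3,4)] y by (rule span_of_add)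
  ultimately show "\<exists>r\<in>span_of (mons U V n). bv_dif c h V r = 0 \<and>
      (\<exists>y\<in>span_of (mons U'' V'' (n - 1)). z = r + bv_dif c h V'' y)"
    using r' by blast
qed

context new_site
begin

lemma quasi_iso_incl_new_site: "quasi_iso_incl c h U V U' V'"
  unfolding quasi_iso_incl_def using coboundary_descends cocycle_descends by blast

end

text \<open>The new site is \<open>n + 1\<close> and the point that becomes interior is
  \<open>n\<close>. By \<open>m < n\<close> its other neighbour \<open>n - 1\<close> is an old
  site.\<close>

lemma quasi_iso_incl_right:
  fixes m n :: int
  assumes "m < n"
  shows "quasi_iso_incl c h {m..n} {m + 1..n - 1} {m..n + 1} {m + 1..n + 1 - 1}"
proof -
  interpret new_site c h "{m..n}" "{m + 1..n - 1}" "n + 1" n "n - 1"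
    using assms by unfold_locales auto
  have "insert (n + 1) {m..n} = {m..n + 1}" "insert n {m + 1..n - 1} = {m + 1..n + 1 - 1}"
    using assms by auto
  with quasi_iso_incl_new_site show ?thesis
    by simp
qed

lemma quasi_iso_incl_left:
  fixes m n :: int
  assumes "m < n"
  shows "quasi_iso_incl c h {m..n} {m + 1..n - 1} {m - 1..n} {m - 1 + 1..n - 1}"
proof -
  interpret new_site c h "{m..n}" "{m + 1..n - 1}" "m - 1" m "m + 1"
    using assms by unfold_locales auto
  have "insert (m - 1) {m..n} = {m - 1..n}" "insert m {m + 1..n - 1} = {m - 1 + 1..n - 1}"
    using assms by auto
  with quasi_iso_incl_new_site show ?thesis
    by simp
qed

lemma quasi_iso_incl_intervals:
  fixes m n m' n' :: int
  assumes "m < n" "m' \<le> m" "n \<le> n'"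
  shows "quasi_iso_incl c h {m..n} {m + 1..n - 1} {m'..n'} {m' + 1..n' - 1}"
proof (rule quasi_iso_incl_trans)
  show "quasi_iso_incl c h {m..n} {m + 1..n - 1} {m..n'} {m + 1..n' - 1}"
    using assms(3)
  proof (induction n' rule: int_ge_induct)
    case base
    show ?case by (rule quasi_iso_incl_refl)
  next
    case (step i)
    then show ?case
      using assms(1) by (intro quasi_iso_incl_trans[OF step.IH quasi_iso_incl_right]) auto
  qed
  show "quasi_iso_incl c h {m..n'} {m + 1..n' - 1} {m'..n'} {m' + 1..n' - 1}"
    using assms(2)
  proof (induction m' rule: int_le_induct)
    case base
    show ?case by (rule quasi_iso_incl_refl)
  next
    case (step i)
    then show ?case
      using assms(1,3) by (intro quasi_iso_incl_trans[OF step.IH quasi_iso_incl_left]) auto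
  qed
qed (use assms in auto)

lemma quasi_iso_incl_zpts:
  assumes "I \<in> D11_colors" "ival I \<subseteq> ival J"
  shows "quasi_iso_incl c h (zpts I) (zpts (shrink I)) (zpts J) (zpts (shrink J))"
  unfolding zpts_eq[of I] zpts_eq[of J] zpts_shrink_eq
proof (rule quasi_iso_incl_intervals)
  have I: "2 < snd I - fst I" "fst J \<le> fst I" "snd I \<le> snd J"
    using assms by (auto simp: D11_colors_def ival_def greaterThanLessThan_subseteq_greaterThanLessThan)
  \<comment> \<open>Rounding outwards only lengthens the interval, so the integer end points differ
    by more than 2 and leave at least two integers strictly between them.\<close>
  have "real_of_int 2 < real_of_int (\<lceil>snd I\<rceil> - \<lfloor>fst I\<rfloor>)"
    using I(1) of_int_floor_le[of "fst I"] le_of_int_ceiling[of "snd I"]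
    unfolding of_int_diff by linarith
  then show "\<lfloor>fst I\<rfloor> + 1 < \<lceil>snd I\<rceil> - 1"
    unfolding of_int_less_iff by simp
  show "\<lfloor>fst J\<rfloor> + 1 \<le> \<lfloor>fst I\<rfloor> + 1" "\<lceil>snd I\<rceil> - 1 \<le> \<lceil>snd J\<rceil> - 1"
    using floor_mono[OF I(2)] ceiling_mono[OF I(3)] by linarith+
qed

section \<open>Cosets and the map induced on cohomology\<close>

definition translate :: "'a::ab_group_add set \<Rightarrow> 'a \<Rightarrow> 'a set" where
  "translate N x = (\<lambda>z. z + x) ` N"

text \<open>The cosets at issue are formed in free modules, whose addition is \<open>(+)\<close>;
  this frees them from the module record.\<close>

lemma a_r_coset_translate: "add M = (+) \<Longrightarrow> N +>\<^bsub>M\<^esub> x = translate N x"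
  by (auto simp: a_r_coset_def r_coset_def translate_def)

lemma translate_eq_iff:
  assumes "0 \<in> N" "\<And>x y. x \<in> N \<Longrightarrow> y \<in> N \<Longrightarrow> x + y \<in> N" "\<And>x. x \<in> N \<Longrightarrow> - x \<in> N"
  shows "translate N x = translate N y \<longleftrightarrow> x - y \<in> N"
proof
  assume "translate N x = translate N y"
  moreover have "x \<in> translate N x"
    using assms(1) by (force simp: translate_def)
  ultimately show "x - y \<in> N"
    by (auto simp: translate_def)
next
  assume xy: "x - y \<in> N"
  have "translate N a \<subseteq> translate N b" if "a - b \<in> N" for a b
  proof
    fix w
    assume "w \<in> translate N a"
    then obtain z where "z \<in> N" "w = z + a"
      by (auto simp: translate_def)
    with that assms(2) have "z + (a - b) \<in> N" "w = z + (a - b) + b"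
      by auto
    then show "w \<in> translate N b"
      unfolding translate_def by blast
  qed
  from this[OF xy] this[of y x] assms(3)[OF xy] show "translate N x = translate N y"
    by auto
qed

lemma Oq_quasi_isomorphism:
  fixes \<iota> :: "'k::field \<Rightarrow> 'r::comm_ring_1"
  assumes \<iota>: "\<iota> 0 = 0" "\<iota> 1 = 1"
    and IJ: "I \<in> D11_colors" "ival I \<subseteq> ival J"
    and F: "\<And>n x. x \<in> span_of (sym_basis I n) \<Longrightarrow> F n x = x"
  shows "quasi_isomorphism (Oq \<iota> \<alpha> h I) (Oq \<iota> \<alpha> h J) F"
proof -
  define c where "c = \<iota> (- (\<alpha> + inverse \<alpha>))"
  note Oq_dif = Oq_dif[OF \<iota> c_def] and cochain = Oq_cochain_complex[OF \<iota> c_def]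
  let ?D = "\<lambda>I. bv_dif c h (zpts (shrink I))"
  let ?C = "\<lambda>I. Oq \<iota> \<alpha> h I"
  note sub = sym_basis_mono[OF IJ]
  have incl: "x \<in> span_of (sym_basis J n)" if "x \<in> span_of (sym_basis I n)" for x n
    using that sub(3) by (rule span_of_mono)
  have D_eq: "?D J x = ?D I x" if "x \<in> span_of (sym_basis I n)" for x n
    using that sub(2) unfolding sym_basis_mons by (intro bv_dif_superset) auto
  have coch: "cochain_map (?C I) (?C J) F"
    unfolding cochain_map_def mod_hom_def
    using Oq_dif_closed[OF \<iota> c_def, where I = I and h = h]
    by (auto simp: cochain F incl span_of_add span_of_scale Oq_dif D_eq)
  have cob: "coboundaries (?C K) n = ?D K ` span_of (sym_basis K (n - 1))" for K n
    unfolding coboundaries_def by (simp add: Oq_dif cong: image_cong)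
  have coc: "cocycles (?C K) n = {x \<in> span_of (sym_basis K n). ?D K x = 0}" for K n
    unfolding cocycles_def by (auto simp: Oq_dif)
  have translate_eq: "translate (coboundaries (?C K) n) x = translate (coboundaries (?C K) n) y
      \<longleftrightarrow> x - y \<in> coboundaries (?C K) n" for K n x y
  proof (rule translate_eq_iff)
    show "0 \<in> coboundaries (?C K) n"
      unfolding cob by (rule image_eqI[where x = 0]) auto
    show "a + b \<in> coboundaries (?C K) n"
      if "a \<in> coboundaries (?C K) n" "b \<in> coboundaries (?C K) n" for a b
    proof -
      from that obtain a' b' where "a = ?D K a'" "b = ?D K b'"
        "a' + b' \<in> span_of (sym_basis K (n - 1))"
        unfolding cob by (blast intro: span_of_add)
      then show ?thesis
        unfolding cob by (intro image_eqI[where x = "a' + b'"]) auto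
    qed
    show "- a \<in> coboundaries (?C K) n" if "a \<in> coboundaries (?C K) n" for a
    proof -
      from that obtain a' where "a = ?D K a'" "- a' \<in> span_of (sym_basis K (n - 1))"
        unfolding cob by (blast intro: span_of_uminus)
      then show ?thesis
        unfolding cob by (intro image_eqI[where x = "- a'"]) auto
    qed
  qed
  have coh: "carrier (cohomology (?C K) n) = translate (coboundaries (?C K) n) ` cocycles (?C K) n"
    for K n
    by (auto simp: cohomology_def quot_mod_def A_RCOSETS_def' a_r_coset_translate)
  have cob_mono: "coboundaries (?C I) n \<subseteq> coboundaries (?C J) n" for n
  proof
    fix x
    assume "x \<in> coboundaries (?C I) n"
    then obtain y where y: "y \<in> span_of (sym_basis I (n - 1))" "x = ?D I y"
      unfolding cob by blast
    show "x \<in> coboundaries (?C J) n"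
      unfolding cob by (rule image_eqI[OF _ incl[OF y(1)]]) (simp add: y(2) D_eq[OF y(1)])
  qed
  have cob_coc: "coboundaries (?C I) n \<subseteq> cocycles (?C I) n" for n
    unfolding cob coc using Oq_dif_closed[OF \<iota> c_def, where I = I and n = "n - 1" and h = h]
    by (auto simp: bv_dif_bv_dif)
  \<comment> \<open>All representatives of a class give the same coset in the target, because
    coboundaries of \<open>I\<close> are coboundaries of \<open>J\<close>; the union defining
    \<open>cohomology_map\<close> is therefore a single coset.\<close>
  have map: "cohomology_map (?C J) F n (translate (coboundaries (?C I) n) x)
      = translate (coboundaries (?C J) n) x" if x: "x \<in> cocycles (?C I) n" for x n
  proof -
    have "coboundaries (?C J) n +>\<^bsub>Cmod (?C J) n\<^esub> F n y = translate (coboundaries (?C J) n) x"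
      if "y \<in> translate (coboundaries (?C I) n) x" for y
    proof -
      from that obtain b where b: "b \<in> coboundaries (?C I) n" "y = b + x"
        by (auto simp: translate_def)
      then have "b \<in> span_of (sym_basis I n)" "x \<in> span_of (sym_basis I n)"
        using cob_coc x by (auto simp: coc)
      then have "F n y = y"
        using b by (simp add: F span_of_add)
      moreover have "y - x \<in> coboundaries (?C J) n"
        using b cob_mono by auto
      ultimately show ?thesis
        by (simp add: a_r_coset_translate translate_eq)
    qed
    moreover have "x \<in> translate (coboundaries (?C I) n) x"
      unfolding translate_def cob by (rule image_eqI[where x = 0]) (auto intro: image_eqI[where x = 0])
    ultimately show ?thesis
      unfolding cohomology_map_def by blast
  qed
  have qi: "quasi_iso_incl c h (zpts I) (zpts (shrink I)) (zpts J) (zpts (shrink J))"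
    by (rule quasi_iso_incl_zpts[OF IJ])
  have "bij_betw (cohomology_map (?C J) F n) (carrier (cohomology (?C I) n))
      (carrier (cohomology (?C J) n))" for n
    unfolding bij_betw_def
  proof
    show "inj_on (cohomology_map (?C J) F n) (carrier (cohomology (?C I) n))"
    proof (rule inj_onI)
      fix a b
      assume "a \<in> carrier (cohomology (?C I) n)" "b \<in> carrier (cohomology (?C I) n)"
        and eq: "cohomology_map (?C J) F n a = cohomology_map (?C J) F n b"
      then obtain x y where xy: "x \<in> cocycles (?C I) n" "y \<in> cocycles (?C I) n"
        and ab: "a = translate (coboundaries (?C I) n) x" "b = translate (coboundaries (?C I) n) y"
        unfolding coh by blast
      with eq have "x - y \<in> coboundaries (?C J) n"
        by (simp add: map translate_eq)
      moreover have "x - y \<in> span_of (sym_basis I n)"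
        using xy by (auto simp: coc intro: span_of_diff)
      ultimately have "x - y \<in> coboundaries (?C I) n"
        unfolding cob sym_basis_mons by (intro quasi_iso_incl_coboundary[OF qi])
      then show "a = b"
        by (simp add: ab translate_eq)
    qed
    show "cohomology_map (?C J) F n ` carrier (cohomology (?C I) n) = carrier (cohomology (?C J) n)"
    proof (intro equalityI subsetI)
      fix a
      assume "a \<in> cohomology_map (?C J) F n ` carrier (cohomology (?C I) n)"
      then obtain x where x: "x \<in> cocycles (?C I) n" "a = translate (coboundaries (?C J) n) x"
        unfolding coh by (auto simp: map)
      then have "x \<in> cocycles (?C J) n"
        by (auto simp: coc incl D_eq)
      with x show "a \<in> carrier (cohomology (?C J) n)"
        unfolding coh by blast
    next
      fix a
      assume "a \<in> carrier (cohomology (?C J) n)"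
      then obtain z where z: "z \<in> cocycles (?C J) n" "a = translate (coboundaries (?C J) n) z"
        unfolding coh by blast
      then have "z \<in> span_of (mons (zpts J) (zpts (shrink J)) n)" "?D J z = 0"
        by (auto simp: coc sym_basis_mons)
      with qi obtain r y where r: "r \<in> span_of (mons (zpts I) (zpts (shrink I)) n)" "?D I r = 0"
        and y: "y \<in> span_of (mons (zpts J) (zpts (shrink J)) (n - 1))" "z = r + ?D J y"
        unfolding quasi_iso_incl_def by blast
      have "z - r \<in> coboundaries (?C J) n"
        unfolding cob sym_basis_mons using y by auto
      then have "a = translate (coboundaries (?C J) n) r"
        by (simp add: z translate_eq)
      moreover have "r \<in> cocycles (?C I) n"
        using r by (simp add: coc sym_basis_mons)
      ultimately show "a \<in> cohomology_map (?C J) F n ` carrier (cohomology (?C I) n)"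
        unfolding coh using map by (metis imageI)
    qed
  qed
  with coch show ?thesis
    unfolding quasi_isomorphism_def by blast
qed

section \<open>Quotients of free modules\<close>

definition lin_closed :: "('b \<Rightarrow>\<^sub>0 'r::comm_ring_1) set \<Rightarrow> bool" where
  "lin_closed N \<longleftrightarrow> 0 \<in> N \<and> (\<forall>x\<in>N. \<forall>y\<in>N. x + y \<in> N) \<and> (\<forall>c. \<forall>x\<in>N. scale c x \<in> N)"

lemma
  assumes "lin_closed N"
  shows lin_closed_0: "0 \<in> N"
    and lin_closed_add: "x \<in> N \<Longrightarrow> y \<in> N \<Longrightarrow> x + y \<in> N"
    and lin_closed_scale: "x \<in> N \<Longrightarrow> scale c x \<in> N"
    and lin_closed_uminus: "x \<in> N \<Longrightarrow> - x \<in> N"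
    and lin_closed_sum: "(\<And>a. a \<in> A \<Longrightarrow> F a \<in> N) \<Longrightarrow> sum F A \<in> N"
proof -
  show zero: "0 \<in> N" and add: "\<And>x y. x \<in> N \<Longrightarrow> y \<in> N \<Longrightarrow> x + y \<in> N"
    and sc: "\<And>c x. x \<in> N \<Longrightarrow> scale c x \<in> N"
    using assms by (auto simp: lin_closed_def)
  show "- x \<in> N" if "x \<in> N" for x
    using sc[OF that, of "- 1"] by simp
  show "(\<And>a. a \<in> A \<Longrightarrow> F a \<in> N) \<Longrightarrow> sum F A \<in> N"
    by (induction A rule: infinite_finite_induct) (auto intro: zero add)
qed

lemma lin_closed_Inter: "(\<And>N. N \<in> F \<Longrightarrow> lin_closed N) \<Longrightarrow> lin_closed (\<Inter>F)"
  by (simp add: lin_closed_def)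

lemma submodule_free_mod:
  "submodule N scalars (free_mod B) \<longleftrightarrow> N \<subseteq> span_of B \<and> lin_closed N"
proof
  assume N: "submodule N scalars (free_mod B)"
  note subm = module.submoduleE[OF module_free_mod N]
  have "0 \<in> N"
    using subgroup.one_closed[OF submodule.axioms(1)[OF N]] by simp
  with subm show "N \<subseteq> span_of B \<and> lin_closed N"
    by (simp add: lin_closed_def)
next
  assume N: "N \<subseteq> span_of B \<and> lin_closed N"
  show "submodule N scalars (free_mod B)"
  proof (rule module.submoduleI[OF module_free_mod])
    fix x
    assume x: "x \<in> N"
    interpret abelian_group "free_mod B"
      using module_free_mod by (rule module.axioms)
    have "\<ominus>\<^bsub>free_mod B\<^esub> x = - x"
    proof (rule minus_equality)
      show "x \<in> carrier (free_mod B)" "- x \<in> carrier (free_mod B)"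
        using x N by (auto intro: span_of_uminus)
    qed simp
    with x N show "\<ominus>\<^bsub>free_mod B\<^esub> x \<in> N"
      by (simp add: lin_closed_uminus)
  qed (use N in \<open>auto simp: lin_closed_def\<close>)
qed

lemma translate_lin_closed:
  assumes "lin_closed N"
  shows "translate N x = translate N y \<longleftrightarrow> x - y \<in> N"
  using assms by (intro translate_eq_iff) (auto intro: lin_closed_0 lin_closed_add lin_closed_uminus)

lemma mem_translate: "y \<in> translate N x \<longleftrightarrow> y - x \<in> N"
  by (force simp: translate_def image_iff)

context
  fixes N :: "('b \<Rightarrow>\<^sub>0 'r::comm_ring_1) set" and B
  assumes N: "lin_closed N" "N \<subseteq> span_of B"
begin

lemma translate_self: "x \<in> translate N x"
  by (simp add: mem_translate lin_closed_0[OF N(1)])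

text \<open>Operations on quotients are defined as unions over representatives; such a union
  collapses once its members agree.\<close>

lemma UN_translate:
  assumes "\<And>y. y - x \<in> N \<Longrightarrow> F y = F x"
  shows "(\<Union>y\<in>translate N x. F y) = F x"
proof -
  have "F y = F x" if "y \<in> translate N x" for y
    using that by (intro assms) (simp add: mem_translate)
  with translate_self[of x] show ?thesis
    by blast
qed

lemma carrier_quot_mod: "carrier (quot_mod (free_mod B) N) = translate N ` span_of B"
  by (auto simp: quot_mod_def A_RCOSETS_def' a_r_coset_translate)

lemma zero_quot_mod: "\<zero>\<^bsub>quot_mod (free_mod B) N\<^esub> = translate N 0"
  by (simp add: quot_mod_def translate_def)

lemma add_quot_mod:
  "translate N x \<oplus>\<^bsub>quot_mod (free_mod B) N\<^esub> translate N y = translate N (x + y)"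
proof -
  have "w \<in> translate N (x + y) \<longleftrightarrow> (\<exists>a\<in>translate N x. \<exists>b\<in>translate N y. w = a + b)" for w
  proof
    assume "w \<in> translate N (x + y)"
    then have "w - y \<in> translate N x"
      by (simp add: mem_translate algebra_simps)
    with translate_self[of y] show "\<exists>a\<in>translate N x. \<exists>b\<in>translate N y. w = a + b"
      by (intro bexI[where x = "w - y"] bexI[where x = y]) auto
  next
    assume "\<exists>a\<in>translate N x. \<exists>b\<in>translate N y. w = a + b"
    then obtain a b where "a - x \<in> N" "b - y \<in> N" "w = a + b"
      by (auto simp: mem_translate)
    moreover have "w - (x + y) = (a - x) + (b - y)"
      using \<open>w = a + b\<close> by simp
    ultimately show "w \<in> translate N (x + y)"
      unfolding mem_translate using lin_closed_add[OF N(1)] by metis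
  qed
  then show ?thesis
    by (auto simp: quot_mod_def set_add_def')
qed

lemma smult_quot_mod:
  "c \<odot>\<^bsub>quot_mod (free_mod B) N\<^esub> translate N x = translate N (scale c x)"
proof -
  have "translate N (scale c y) = translate N (scale c x)" if "y - x \<in> N" for y
    using lin_closed_scale[OF N(1) that, of c] by (simp add: translate_lin_closed[OF N(1)])
  from UN_translate[where F = "\<lambda>y. translate N (scale c y)", OF this] show ?thesis
    by (simp add: quot_mod_def a_r_coset_translate)
qed

lemma module_quot_mod: "module scalars (quot_mod (free_mod B) N)"
proof (rule moduleI[OF cring_scalars])
  show "abelian_group (quot_mod (free_mod B) N)"
  proof (rule abelian_groupI)
    fix a
    assume "a \<in> carrier (quot_mod (free_mod B) N)"
    then obtain x where "x \<in> span_of B" "a = translate N x"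
      unfolding carrier_quot_mod by blast
    then show "\<exists>b\<in>carrier (quot_mod (free_mod B) N).
        b \<oplus>\<^bsub>quot_mod (free_mod B) N\<^esub> a = \<zero>\<^bsub>quot_mod (free_mod B) N\<^esub>"
      unfolding carrier_quot_mod
      by (intro bexI[where x = "translate N (- x)"] imageI span_of_uminus)
        (simp_all add: add_quot_mod zero_quot_mod)
  qed (auto simp: carrier_quot_mod add_quot_mod zero_quot_mod ac_simps intro!: imageI span_of_intros)
qed (auto simp: carrier_quot_mod add_quot_mod smult_quot_mod scale_add_left
    intro!: imageI span_of_intros)

end

section \<open>The tensor product of cochain complexes\<close>

lemma sum_list_update_int:
  fixes xs :: "int list"
  shows "i < length xs \<Longrightarrow> sum_list (xs[i := y]) = sum_list xs - xs ! i + y"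
  by (induction xs arbitrary: i) (auto split: nat.split)

lemma ksign_add_1: "ksign (n + 1) = - (ksign n :: 'r::comm_ring_1)"
  by (simp add: ksign_def)

lemma ksign_add: "ksign (m + n) = (ksign m * ksign n :: 'r::comm_ring_1)"
  by (simp add: ksign_def)

lemma htuples_update:
  assumes "xs \<in> htuples Cs k" "i < length Cs" "a \<in> carrier (Cmod (Cs ! i) q)"
    and "k' = k - fst (xs ! i) + q"
  shows "xs[i := (q, a)] \<in> htuples Cs k'"
proof -
  have "length xs = length Cs" "sum_list (map fst xs) = k"
    "\<And>j. j < length Cs \<Longrightarrow> snd (xs ! j) \<in> carrier (Cmod (Cs ! j) (fst (xs ! j)))"
    using assms(1) by (auto simp: htuples_def)
  with assms(2-) show ?thesis
    by (auto simp: htuples_def map_update sum_list_update_int nth_list_update)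
qed

text \<open>The pattern behind the vanishing of the squared differential on a tensor product:
  off-diagonal terms cancel in the free module, while diagonal terms are only relations.\<close>

lemma antisymmetric_double_sum:
  fixes N :: "('b \<Rightarrow>\<^sub>0 'r::comm_ring_1) set" and n :: nat
  assumes N: "lin_closed N"
    and diag: "\<And>i. i < n \<Longrightarrow> T i i \<in> N"
    and anti: "\<And>i j. i < j \<Longrightarrow> j < n \<Longrightarrow> T i j + T j i = 0"
  shows "(\<Sum>i<n. \<Sum>j<n. T i j) \<in> N"
  using diag anti
proof (induction n)
  case 0
  show ?case by (simp add: lin_closed_0[OF N])
next
  case (Suc n)
  have "(\<Sum>i<Suc n. \<Sum>j<Suc n. T i j)
      = (\<Sum>i<n. \<Sum>j<n. T i j) + (\<Sum>i<n. T i n + T n i) + T n n"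
    by (simp add: sum.distrib)
  also have "(\<Sum>i<n. T i n + T n i) = 0"
    using Suc.prems(2) by (intro sum.neutral) auto
  finally have eq: "(\<Sum>i<Suc n. \<Sum>j<Suc n. T i j) = (\<Sum>i<n. \<Sum>j<n. T i j) + T n n"
    by simp
  have "(\<Sum>i<n. \<Sum>j<n. T i j) \<in> N"
    using Suc.prems by (intro Suc.IH) auto
  moreover have "T n n \<in> N"
    using Suc.prems by simp
  ultimately show ?case
    unfolding eq by (rule lin_closed_add[OF N])
qed

locale complexes =
  fixes Cs :: "('r::comm_ring_1, 'a) cochain list"
  assumes complexes: "\<And>C. C \<in> set Cs \<Longrightarrow> cochain_complex C"
begin

lemma
  assumes "i < length Cs"
  shows module_nth: "module scalars (Cmod (Cs ! i) n)"
    and dif_nth: "dif (Cs ! i) n \<in> mod_hom (Cmod (Cs ! i) n) (Cmod (Cs ! i) (n + 1))"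
    and dif_dif_nth: "x \<in> carrier (Cmod (Cs ! i) n) \<Longrightarrow>
      dif (Cs ! i) (n + 1) (dif (Cs ! i) n x) = \<zero>\<^bsub>Cmod (Cs ! i) (n + 1 + 1)\<^esub>"
  using complexes[of "Cs ! i"] assms by (auto simp: cochain_complex_def)

lemma dif_closed:
  "i < length Cs \<Longrightarrow> a \<in> carrier (Cmod (Cs ! i) n) \<Longrightarrow>
    dif (Cs ! i) n a \<in> carrier (Cmod (Cs ! i) (n + 1))"
  using dif_nth[of i n] by (auto simp: mod_hom_def)

lemma add_closed:
  assumes "i < length Cs" "a \<in> carrier (Cmod (Cs ! i) n)" "b \<in> carrier (Cmod (Cs ! i) n)"
  shows "a \<oplus>\<^bsub>Cmod (Cs ! i) n\<^esub> b \<in> carrier (Cmod (Cs ! i) n)"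
proof -
  interpret module scalars "Cmod (Cs ! i) n"
    by (rule module_nth[OF assms(1)])
  show ?thesis
    using assms by simp
qed

lemma smult_closed:
  assumes "i < length Cs" "a \<in> carrier (Cmod (Cs ! i) n)"
  shows "c \<odot>\<^bsub>Cmod (Cs ! i) n\<^esub> a \<in> carrier (Cmod (Cs ! i) n)"
  using module.smult_closed[OF module_nth[OF assms(1)], of c a] assms(2) by simp

lemma htuples_nth:
  "xs \<in> htuples Cs k \<Longrightarrow> i < length Cs \<Longrightarrow> snd (xs ! i) \<in> carrier (Cmod (Cs ! i) (fst (xs ! i)))"
  by (simp add: htuples_def)

lemma htuples_length: "xs \<in> htuples Cs k \<Longrightarrow> length xs = length Cs"
  by (simp add: htuples_def)

lemma relators_span: "multilinear_relators Cs k \<subseteq> span_of (htuples Cs k)"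
  unfolding multilinear_relators_def
  by (auto intro!: span_of_diff span_of_single htuples_update add_closed smult_closed)

lemma tensor_rel_submodule: "submodule (tensor_rel Cs k) scalars (free_mod (htuples Cs k))"
proof -
  let ?F = "{N. submodule N scalars (free_mod (htuples Cs k)) \<and> multilinear_relators Cs k \<subseteq> N}"
  have eq: "tensor_rel Cs k = \<Inter>?F"
    by (simp add: tensor_rel_def hull_def)
  have "lin_closed (\<Inter>?F)"
    by (rule lin_closed_Inter) (simp add: submodule_free_mod)
  moreover have "lin_closed (span_of (htuples Cs k))"
    by (simp add: lin_closed_def span_of_add span_of_scale)
  then have "span_of (htuples Cs k) \<in> ?F"
    using relators_span by (simp add: submodule_free_mod)
  then have "\<Inter>?F \<subseteq> span_of (htuples Cs k)"
    by (rule Inter_lower)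
  ultimately show ?thesis
    unfolding eq submodule_free_mod by blast
qed

lemma tensor_rel_lin_closed: "lin_closed (tensor_rel Cs k)"
  and tensor_rel_span: "tensor_rel Cs k \<subseteq> span_of (htuples Cs k)"
  using tensor_rel_submodule by (simp_all add: submodule_free_mod)

text \<open>Reduces a linear condition to the relators. \<open>N\<close> may exceed the span of the
  tuples, as the kernels and preimages to which this is applied do; the proof intersects it with the
  span.\<close>

lemma tensor_rel_minimal:
  assumes "lin_closed N" "multilinear_relators Cs k \<subseteq> N"
  shows "tensor_rel Cs k \<subseteq> N"
proof -
  have "tensor_rel Cs k \<subseteq> N \<inter> span_of (htuples Cs k)"
    unfolding tensor_rel_def
  proof (rule hull_minimal)
    show "submodule (N \<inter> span_of (htuples Cs k)) scalars (free_mod (htuples Cs k))"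
      using assms(1) by (simp add: submodule_free_mod lin_closed_def span_of_add span_of_scale)
  qed (use assms(2) relators_span in blast)
  then show ?thesis
    by blast
qed

lemma relator_add:
  assumes "xs \<in> htuples Cs k" "i < length Cs" "p = fst (xs ! i)"
    "a \<in> carrier (Cmod (Cs ! i) p)" "b \<in> carrier (Cmod (Cs ! i) p)"
  shows "Poly_Mapping.single (xs[i := (p, a \<oplus>\<^bsub>Cmod (Cs ! i) p\<^esub> b)]) s
    - Poly_Mapping.single (xs[i := (p, a)]) s - Poly_Mapping.single (xs[i := (p, b)]) s
    \<in> tensor_rel Cs k"
proof -
  have "Poly_Mapping.single (xs[i := (p, a \<oplus>\<^bsub>Cmod (Cs ! i) p\<^esub> b)]) 1
    - Poly_Mapping.single (xs[i := (p, a)]) 1 - Poly_Mapping.single (xs[i := (p, b)]) 1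
    \<in> multilinear_relators Cs k"
    unfolding multilinear_relators_def using assms by blast
  then have "Poly_Mapping.single (xs[i := (p, a \<oplus>\<^bsub>Cmod (Cs ! i) p\<^esub> b)]) 1
    - Poly_Mapping.single (xs[i := (p, a)]) 1 - Poly_Mapping.single (xs[i := (p, b)]) 1
    \<in> tensor_rel Cs k"
    unfolding tensor_rel_def by (rule hull_inc)
  from lin_closed_scale[OF tensor_rel_lin_closed this, of s] show ?thesis
    by simp
qed

lemma relator_scale:
  assumes "xs \<in> htuples Cs k" "i < length Cs" "p = fst (xs ! i)"
    "a \<in> carrier (Cmod (Cs ! i) p)"
  shows "Poly_Mapping.single (xs[i := (p, c \<odot>\<^bsub>Cmod (Cs ! i) p\<^esub> a)]) s
    - Poly_Mapping.single (xs[i := (p, a)]) (s * c) \<in> tensor_rel Cs k"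
proof -
  have "Poly_Mapping.single (xs[i := (p, c \<odot>\<^bsub>Cmod (Cs ! i) p\<^esub> a)]) 1
    - Poly_Mapping.single (xs[i := (p, a)]) c \<in> multilinear_relators Cs k"
    unfolding multilinear_relators_def using assms by blast
  then have "Poly_Mapping.single (xs[i := (p, c \<odot>\<^bsub>Cmod (Cs ! i) p\<^esub> a)]) 1
    - Poly_Mapping.single (xs[i := (p, a)]) c \<in> tensor_rel Cs k"
    unfolding tensor_rel_def by (rule hull_inc)
  from lin_closed_scale[OF tensor_rel_lin_closed this, of s] show ?thesis
    by simp
qed

text \<open>The zero entry is 0 times itself, so the scaling relator with coefficient 0 has this
  tuple as its only remaining term.\<close>

lemma single_zero_entry:
  assumes xs: "xs \<in> htuples Cs k" and i: "i < length Cs" and p: "p = fst (xs ! i)"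
  shows "Poly_Mapping.single (xs[i := (p, \<zero>\<^bsub>Cmod (Cs ! i) p\<^esub>)]) s \<in> tensor_rel Cs k"
proof -
  interpret module scalars "Cmod (Cs ! i) p"
    by (rule module_nth[OF i])
  have "\<zero>\<^bsub>scalars\<^esub> \<odot>\<^bsub>Cmod (Cs ! i) p\<^esub> \<zero>\<^bsub>Cmod (Cs ! i) p\<^esub> = \<zero>\<^bsub>Cmod (Cs ! i) p\<^esub>"
    by (rule smult_l_null) simp
  then have "(0 :: 'r) \<odot>\<^bsub>Cmod (Cs ! i) p\<^esub> \<zero>\<^bsub>Cmod (Cs ! i) p\<^esub> = \<zero>\<^bsub>Cmod (Cs ! i) p\<^esub>"
    by (simp add: ring_of_type_algebra_def)
  with relator_scale[OF xs i p, of "\<zero>\<^bsub>Cmod (Cs ! i) p\<^esub>" 0 s] show ?thesis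
    by simp
qed

section \<open>The differential on tuples of homogeneous elements\<close>

definition dterm :: "nat \<Rightarrow> (int \<times> 'a) list \<Rightarrow> (int \<times> 'a) list" where
  "dterm j xs = xs[j := (fst (xs ! j) + 1, dif (Cs ! j) (fst (xs ! j)) (snd (xs ! j)))]"

definition dsign :: "nat \<Rightarrow> (int \<times> 'a) list \<Rightarrow> 'r" where
  "dsign j xs = ksign (sum_list (map fst (take j xs)))"

lemma tensor_dif_tuple_eq:
  "tensor_dif_tuple Cs xs = (\<Sum>j<length xs. Poly_Mapping.single (dterm j xs) (dsign j xs))"
  by (simp add: tensor_dif_tuple_def dterm_def dsign_def)

lemma dterm_htuples: "xs \<in> htuples Cs k \<Longrightarrow> j < length Cs \<Longrightarrow> dterm j xs \<in> htuples Cs (k + 1)"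
  unfolding dterm_def by (rule htuples_update) (auto intro: dif_closed htuples_nth)

lemma length_dterm [simp]: "length (dterm j xs) = length xs"
  by (simp add: dterm_def)

lemma tensor_dif_tuple_span:
  "xs \<in> htuples Cs k \<Longrightarrow> tensor_dif_tuple Cs xs \<in> span_of (htuples Cs (k + 1))"
  unfolding tensor_dif_tuple_eq
  by (auto intro!: span_of_sum span_of_single dterm_htuples simp: htuples_length)

lemma dsign_update_same:
  assumes "i < length xs" "p = fst (xs ! i)"
  shows "dsign j (xs[i := (p, a)]) = dsign j xs"
proof -
  have "(map fst xs)[i := p] = map fst xs"
    using assms by (simp add: list_update_same_conv)
  then have "map fst (xs[i := (p, a)]) = map fst xs"
    by (simp add: map_update)
  then show ?thesis
    by (simp add: dsign_def flip: take_map)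
qed

text \<open>Raising the degree of entry \<open>i\<close> changes the parity of the degrees in front
  of \<open>j\<close> exactly when \<open>i\<close> precedes \<open>j\<close>. Of the two orders of
  differentiating entries \<open>i\<close> and \<open>j\<close>, one thus acquires a minus
  sign.\<close>

lemma dsign_dterm:
  assumes "i < length xs"
  shows "dsign j (dterm i xs) = (if i < j then - dsign j xs else dsign j xs)"
proof -
  let ?l = "take j (map fst xs)"
  have eq: "map fst (take j (dterm i xs)) = ?l[i := fst (xs ! i) + 1]"
    by (simp add: dterm_def map_update take_update_swap flip: take_map)
  show ?thesis
  proof (cases "i < j")
    case True
    then have "sum_list (?l[i := fst (xs ! i) + 1]) = sum_list ?l + 1"
      using assms by (simp add: sum_list_update_int)
    with True show ?thesis
      by (simp add: dsign_def eq take_map ksign_add_1)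
  next
    case False
    then have "?l[i := fst (xs ! i) + 1] = ?l"
      by (intro list_update_beyond) simp
    with False show ?thesis
      by (simp add: dsign_def eq take_map)
  qed
qed

lemma dterm_update:
  assumes xs: "xs \<in> htuples Cs k" and ij: "i < length Cs" "j < length Cs" and p: "p = fst (xs ! i)"
  shows "dterm j (xs[i := (p, a)]) =
    (if j = i then (dterm j xs)[i := (p + 1, dif (Cs ! i) p a)] else (dterm j xs)[i := (p, a)])"
proof -
  have "length xs = length Cs"
    using xs by (rule htuples_length)
  with ij p show ?thesis
    by (auto simp: dterm_def list_update_swap)
qed

text \<open>If the differential hits the varied entry, its additivity produces a relator in degree
  \<open>p + 1\<close> of that entry; otherwise the entry is untouched and the old relator
  persists.\<close>

lemma dterm_add:
  assumes xs: "xs \<in> htuples Cs k" and ij: "i < length Cs" "j < length Cs" and p: "p = fst (xs ! i)"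
    and a: "a \<in> carrier (Cmod (Cs ! i) p)" and b: "b \<in> carrier (Cmod (Cs ! i) p)"
  shows "Poly_Mapping.single (dterm j (xs[i := (p, a \<oplus>\<^bsub>Cmod (Cs ! i) p\<^esub> b)])) s
    - Poly_Mapping.single (dterm j (xs[i := (p, a)])) s
    - Poly_Mapping.single (dterm j (xs[i := (p, b)])) s \<in> tensor_rel Cs (k + 1)"
proof -
  have len: "length xs = length Cs"
    using xs by (rule htuples_length)
  have ys: "dterm j xs \<in> htuples Cs (k + 1)"
    by (rule dterm_htuples[OF xs ij(2)])
  note upd = dterm_update[OF xs ij p]
  show ?thesis
  proof (cases "j = i")
    case True
    have "dif (Cs ! i) p (a \<oplus>\<^bsub>Cmod (Cs ! i) p\<^esub> b)
        = dif (Cs ! i) p a \<oplus>\<^bsub>Cmod (Cs ! i) (p + 1)\<^esub> dif (Cs ! i) p b"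
      using dif_nth[OF ij(1), of p] a b by (simp add: mod_hom_def)
    moreover have "p + 1 = fst (dterm i xs ! i)"
      using ij len p by (simp add: dterm_def)
    from relator_add[OF dterm_htuples[OF xs ij(1)] ij(1) this dif_closed[OF ij(1) a]
        dif_closed[OF ij(1) b], of s]
    have "Poly_Mapping.single ((dterm i xs)[i := (p + 1, dif (Cs ! i) p a
          \<oplus>\<^bsub>Cmod (Cs ! i) (p + 1)\<^esub> dif (Cs ! i) p b)]) s
        - Poly_Mapping.single ((dterm i xs)[i := (p + 1, dif (Cs ! i) p a)]) s
        - Poly_Mapping.single ((dterm i xs)[i := (p + 1, dif (Cs ! i) p b)]) s
        \<in> tensor_rel Cs (k + 1)" .
    ultimately show ?thesis
      unfolding True dterm_update[OF xs ij(1) ij(1) p] by (simp only: simp_thms if_True)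
  next
    case False
    then have "p = fst (dterm j xs ! i)"
      by (simp add: dterm_def p)
    from relator_add[OF ys ij(1) this a b, of s] False show ?thesis
      by (simp only: upd if_False)
  qed
qed

lemma dterm_scale:
  assumes xs: "xs \<in> htuples Cs k" and ij: "i < length Cs" "j < length Cs" and p: "p = fst (xs ! i)"
    and a: "a \<in> carrier (Cmod (Cs ! i) p)"
  shows "Poly_Mapping.single (dterm j (xs[i := (p, c \<odot>\<^bsub>Cmod (Cs ! i) p\<^esub> a)])) s
    - Poly_Mapping.single (dterm j (xs[i := (p, a)])) (s * c) \<in> tensor_rel Cs (k + 1)"
proof -
  have len: "length xs = length Cs"
    using xs by (rule htuples_length)
  have ys: "dterm j xs \<in> htuples Cs (k + 1)"
    by (rule dterm_htuples[OF xs ij(2)])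
  note upd = dterm_update[OF xs ij p]
  show ?thesis
  proof (cases "j = i")
    case True
    have "dif (Cs ! i) p (c \<odot>\<^bsub>Cmod (Cs ! i) p\<^esub> a) = c \<odot>\<^bsub>Cmod (Cs ! i) (p + 1)\<^esub> dif (Cs ! i) p a"
      using dif_nth[OF ij(1), of p] a by (simp add: mod_hom_def)
    moreover have "p + 1 = fst (dterm i xs ! i)"
      using ij len p by (simp add: dterm_def)
    from relator_scale[OF dterm_htuples[OF xs ij(1)] ij(1) this dif_closed[OF ij(1) a], of c s]
    have "Poly_Mapping.single
          ((dterm i xs)[i := (p + 1, c \<odot>\<^bsub>Cmod (Cs ! i) (p + 1)\<^esub> dif (Cs ! i) p a)]) s
        - Poly_Mapping.single ((dterm i xs)[i := (p + 1, dif (Cs ! i) p a)]) (s * c)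
        \<in> tensor_rel Cs (k + 1)" .
    ultimately show ?thesis
      unfolding True dterm_update[OF xs ij(1) ij(1) p] by (simp only: simp_thms if_True)
  next
    case False
    then have "p = fst (dterm j xs ! i)"
      by (simp add: dterm_def p)
    from relator_scale[OF ys ij(1) this a, of c s] False show ?thesis
      by (simp only: upd if_False)
  qed
qed

lemma tensor_dif_rel:
  assumes "u \<in> tensor_rel Cs k"
  shows "lin_ext (tensor_dif_tuple Cs) u \<in> tensor_rel Cs (k + 1)"
proof -
  let ?N = "{u. lin_ext (tensor_dif_tuple Cs) u \<in> tensor_rel Cs (k + 1)}"
  have "tensor_rel Cs k \<subseteq> ?N"
  proof (rule tensor_rel_minimal)
    show "lin_closed ?N"
      using tensor_rel_lin_closed[of "k + 1"] by (simp add: lin_closed_def)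
    show "multilinear_relators Cs k \<subseteq> ?N"
    proof
      fix v
      assume "v \<in> multilinear_relators Cs k"
      then consider
        (add) xs i p a b where "xs \<in> htuples Cs k" "i < length Cs" "p = fst (xs ! i)"
          "a \<in> carrier (Cmod (Cs ! i) p)" "b \<in> carrier (Cmod (Cs ! i) p)"
          "v = Poly_Mapping.single (xs[i := (p, a \<oplus>\<^bsub>Cmod (Cs ! i) p\<^esub> b)]) 1
            - Poly_Mapping.single (xs[i := (p, a)]) 1 - Poly_Mapping.single (xs[i := (p, b)]) 1"
        | (scale) xs i p c a where "xs \<in> htuples Cs k" "i < length Cs" "p = fst (xs ! i)"
          "a \<in> carrier (Cmod (Cs ! i) p)"
          "v = Poly_Mapping.single (xs[i := (p, c \<odot>\<^bsub>Cmod (Cs ! i) p\<^esub> a)]) 1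
            - Poly_Mapping.single (xs[i := (p, a)]) c"
        unfolding multilinear_relators_def by blast
      then show "v \<in> ?N"
      proof cases
        case add
        then have len: "length xs = length Cs"
          by (simp add: htuples_length)
        have "lin_ext (tensor_dif_tuple Cs) v = (\<Sum>j<length Cs.
            Poly_Mapping.single (dterm j (xs[i := (p, a \<oplus>\<^bsub>Cmod (Cs ! i) p\<^esub> b)])) (dsign j xs)
            - Poly_Mapping.single (dterm j (xs[i := (p, a)])) (dsign j xs)
            - Poly_Mapping.single (dterm j (xs[i := (p, b)])) (dsign j xs))"
          using add(2,3) len
          by (simp add: add(6) tensor_dif_tuple_eq dsign_update_same sum_subtractf)
        also have "\<dots> \<in> tensor_rel Cs (k + 1)"
          using add by (intro lin_closed_sum[OF tensor_rel_lin_closed] dterm_add) auto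
        finally show ?thesis
          by simp
      next
        case scale
        then have len: "length xs = length Cs"
          by (simp add: htuples_length)
        have "lin_ext (tensor_dif_tuple Cs) v = (\<Sum>j<length Cs.
            Poly_Mapping.single (dterm j (xs[i := (p, c \<odot>\<^bsub>Cmod (Cs ! i) p\<^esub> a)])) (dsign j xs)
            - Poly_Mapping.single (dterm j (xs[i := (p, a)])) (dsign j xs * c))"
          using scale(2,3) len
          by (simp add: scale(5) tensor_dif_tuple_eq dsign_update_same sum_subtractf scale_sum
              mult.commute)
        also have "\<dots> \<in> tensor_rel Cs (k + 1)"
          using scale by (intro lin_closed_sum[OF tensor_rel_lin_closed] dterm_scale) auto
        finally show ?thesis
          by simp
      qed
    qed
  qed
  with assms show ?thesis
    by blast
qed

lemma tensor_dif_dif: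
  assumes xs: "xs \<in> htuples Cs k"
  shows "lin_ext (tensor_dif_tuple Cs) (tensor_dif_tuple Cs xs) \<in> tensor_rel Cs (k + 1 + 1)"
proof -
  have len: "length xs = length Cs"
    using xs by (rule htuples_length)
  let ?T = "\<lambda>i j. Poly_Mapping.single (dterm j (dterm i xs)) (dsign i xs * dsign j (dterm i xs))"
  have "lin_ext (tensor_dif_tuple Cs) (tensor_dif_tuple Cs xs)
      = (\<Sum>i<length Cs. \<Sum>j<length Cs. ?T i j)"
    by (simp add: tensor_dif_tuple_eq len scale_sum)
  also have "\<dots> \<in> tensor_rel Cs (k + 1 + 1)"
  proof (rule antisymmetric_double_sum[OF tensor_rel_lin_closed])
    fix i
    assume i: "i < length Cs"
    let ?p = "fst (xs ! i)"
    have ys: "dterm i (dterm i xs) \<in> htuples Cs (k + 1 + 1)"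
      by (intro dterm_htuples xs i)
    have "dif (Cs ! i) (?p + 1) (dif (Cs ! i) ?p (snd (xs ! i))) = \<zero>\<^bsub>Cmod (Cs ! i) (?p + 1 + 1)\<^esub>"
      by (intro dif_dif_nth i htuples_nth[OF xs])
    then have "dterm i (dterm i xs)
        = (dterm i (dterm i xs))[i := (?p + 1 + 1, \<zero>\<^bsub>Cmod (Cs ! i) (?p + 1 + 1)\<^esub>)]"
      using i len by (simp add: dterm_def)
    moreover have "?p + 1 + 1 = fst (dterm i (dterm i xs) ! i)"
      using i len by (simp add: dterm_def)
    ultimately show "?T i i \<in> tensor_rel Cs (k + 1 + 1)"
      using single_zero_entry[OF ys i] by metis
  next
    fix i j
    assume ij: "i < j" "j < length Cs"
    then have "dterm j (dterm i xs) = dterm i (dterm j xs)"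
      by (simp add: dterm_def list_update_swap)
    with ij show "?T i j + ?T j i = 0"
      by (simp add: dsign_dterm len mult.commute flip: single_add)
  qed
  finally show ?thesis .
qed

section \<open>Passage to the quotient by the multilinear relations\<close>

lemma tensor_class_translate: "tensor_class Cs k u = translate (tensor_rel Cs k) u"
  by (simp add: tensor_class_def a_r_coset_translate)

lemma pure_tensor_translate:
  "pure_tensor Cs xs = translate (tensor_rel Cs (total_deg xs)) (Poly_Mapping.single xs 1)"
  by (simp add: pure_tensor_def tensor_class_translate)

lemma tensor_Cmod: "Cmod (tensor Cs) k = quot_mod (free_mod (htuples Cs k)) (tensor_rel Cs k)"
  by (simp add: tensor_def)

lemma tensor_dif_translate:
  "dif (tensor Cs) k (translate (tensor_rel Cs k) u)
    = translate (tensor_rel Cs (k + 1)) (lin_ext (tensor_dif_tuple Cs) u)"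
proof -
  have "translate (tensor_rel Cs (k + 1)) (lin_ext (tensor_dif_tuple Cs) v)
      = translate (tensor_rel Cs (k + 1)) (lin_ext (tensor_dif_tuple Cs) u)"
    if "v - u \<in> tensor_rel Cs k" for v
    using tensor_dif_rel[OF that] by (simp add: translate_lin_closed[OF tensor_rel_lin_closed])
  from UN_translate[where F = "\<lambda>v. translate (tensor_rel Cs (k + 1))
      (lin_ext (tensor_dif_tuple Cs) v)", OF tensor_rel_lin_closed tensor_rel_span this] show ?thesis
    by (simp add: tensor_def tensor_class_translate)
qed

lemma tensor_dif_span:
  "u \<in> span_of (htuples Cs k) \<Longrightarrow>
    lin_ext (tensor_dif_tuple Cs) u \<in> span_of (htuples Cs (k + 1))"
  by (erule linear_map_span[OF linear_lin_ext]) (simp add: tensor_dif_tuple_span)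

lemma tensor_carrier: "carrier (Cmod (tensor Cs) k) = translate (tensor_rel Cs k) ` span_of (htuples Cs k)"
  unfolding tensor_Cmod by (rule carrier_quot_mod[OF tensor_rel_lin_closed tensor_rel_span])

lemma tensor_add: "translate (tensor_rel Cs k) x \<oplus>\<^bsub>Cmod (tensor Cs) k\<^esub> translate (tensor_rel Cs k) y
    = translate (tensor_rel Cs k) (x + y)"
  unfolding tensor_Cmod by (rule add_quot_mod[OF tensor_rel_lin_closed tensor_rel_span])

lemma tensor_smult: "a \<odot>\<^bsub>Cmod (tensor Cs) k\<^esub> translate (tensor_rel Cs k) x
    = translate (tensor_rel Cs k) (scale a x)"
  unfolding tensor_Cmod by (rule smult_quot_mod[OF tensor_rel_lin_closed tensor_rel_span])

lemma tensor_dif_dif_span: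
  assumes "u \<in> span_of (htuples Cs k)"
  shows "lin_ext (tensor_dif_tuple Cs) (lin_ext (tensor_dif_tuple Cs) u)
    \<in> tensor_rel Cs (k + 1 + 1)" (is "_ \<in> ?N")
proof -
  have N: "lin_closed ?N"
    by (rule tensor_rel_lin_closed)
  show ?thesis
    using assms
  proof (induction rule: span_induct)
    case zero
    show ?case
      using lin_closed_0[OF N] by (simp only: lin_ext_simps)
  next
    case (basis xs)
    from tensor_dif_dif[OF this] show ?case
      by (simp only: lin_ext_single scale_1)
  next
    case (add f g)
    from lin_closed_add[OF N this] show ?case
      by (simp only: lin_ext_simps)
  next
    case (scale a f)
    from lin_closed_scale[OF N this, of a] show ?case
      by (simp only: lin_ext_simps)
  qed
qed

lemma cochain_complex_tensor: "cochain_complex (tensor Cs)"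
  unfolding cochain_complex_def mod_hom_def
proof (intro conjI allI ballI CollectI)
  show "module scalars (Cmod (tensor Cs) n)" for n
    unfolding tensor_Cmod by (rule module_quot_mod[OF tensor_rel_lin_closed tensor_rel_span])
  show "dif (tensor Cs) n \<in> carrier (Cmod (tensor Cs) n) \<rightarrow> carrier (Cmod (tensor Cs) (n + 1))" for n
    by (auto simp: tensor_carrier tensor_dif_translate intro!: imageI tensor_dif_span)
next
  fix n x
  assume "x \<in> carrier (Cmod (tensor Cs) n)"
  then obtain u where u: "u \<in> span_of (htuples Cs n)" "x = translate (tensor_rel Cs n) u"
    unfolding tensor_carrier by blast
  show "dif (tensor Cs) n (c \<odot>\<^bsub>Cmod (tensor Cs) n\<^esub> x)
      = c \<odot>\<^bsub>Cmod (tensor Cs) (n + 1)\<^esub> dif (tensor Cs) n x" for c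
    by (simp add: u tensor_smult tensor_dif_translate)
  have "translate (tensor_rel Cs (n + 1 + 1)) (lin_ext (tensor_dif_tuple Cs) (lin_ext (tensor_dif_tuple Cs) u))
      = translate (tensor_rel Cs (n + 1 + 1)) 0"
    using tensor_dif_dif_span[OF u(1)]
    unfolding translate_lin_closed[OF tensor_rel_lin_closed] by simp
  then show "dif (tensor Cs) (n + 1) (dif (tensor Cs) n x) = \<zero>\<^bsub>Cmod (tensor Cs) (n + 1 + 1)\<^esub>"
    unfolding u(2) tensor_dif_translate tensor_Cmod
      zero_quot_mod[OF tensor_rel_lin_closed tensor_rel_span] .
  fix y
  assume "y \<in> carrier (Cmod (tensor Cs) n)"
  then obtain v where v: "v \<in> span_of (htuples Cs n)" "y = translate (tensor_rel Cs n) v"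
    unfolding tensor_carrier by blast
  show "dif (tensor Cs) n (x \<oplus>\<^bsub>Cmod (tensor Cs) n\<^esub> y)
      = dif (tensor Cs) n x \<oplus>\<^bsub>Cmod (tensor Cs) (n + 1)\<^esub> dif (tensor Cs) n y"
    by (simp add: u v tensor_add tensor_dif_translate)
qed

end

section \<open>Products of several factors\<close>

lemma sym_prod_update_add:
  "i < length fs \<Longrightarrow> sym_prod (fs[i := f + g]) = sym_prod (fs[i := f]) + sym_prod (fs[i := g])"
  by (induction fs arbitrary: i) (auto split: nat.split)

lemma sym_prod_update_scale:
  "i < length fs \<Longrightarrow> sym_prod (fs[i := scale c f]) = scale c (sym_prod (fs[i := f]))"
  by (induction fs arbitrary: i) (auto split: nat.split)

lemma sym_prod_append:
  assumes "set fs \<subseteq> span_of fin_mons" "set gs \<subseteq> span_of fin_mons"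
  shows "sym_prod (fs @ gs) = sym_mult (sym_prod fs) (sym_prod gs)"
  using assms(1)
proof (induction fs)
  case (Cons f fs)
  then show ?case
    by (simp add: sym_mult_assoc sym_prod_fin assms(2))
qed simp

lemma sym_prod_concat:
  assumes "\<And>fs. fs \<in> set fss \<Longrightarrow> set fs \<subseteq> span_of fin_mons"
  shows "sym_prod (concat fss) = sym_prod (map sym_prod fss)"
  using assms
proof (induction fss)
  case (Cons fs fss)
  have "set (concat fss) \<subseteq> span_of fin_mons"
    using Cons.prems by auto
  with Cons show ?case
    by (simp add: sym_prod_append)
qed simp

lemma sym_prod_mons:
  assumes "list_all2 (\<lambda>n f. f \<in> span_of (mons U V n)) ns fs"
  shows "sym_prod fs \<in> span_of (mons U V (sum_list ns))"
  using assms by (induction rule: list_all2_induct) (simp_all add: sym_one_mons sym_mult_mons)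

lemma bv_dif_one: "bv_dif c h W sym_one = 0"
  by (simp add: bv_dif_def sym_one_def)

text \<open>Iterates \<open>bv_dif_sym_mult\<close>, playing the first factor against the product of
  the others, whose supports are the unions over the remaining intervals.\<close>

lemma bv_dif_sym_prod:
  assumes "length xs = length Is"
    and "\<And>i. i < length Is \<Longrightarrow> snd (xs ! i) \<in> span_of (sym_basis (Is ! i) (fst (xs ! i)))"
    and "sorted_wrt (\<lambda>I J. zpts I \<inter> zpts J = {}) Is"
  shows "bv_dif c h W (sym_prod (map snd xs)) =
    (\<Sum>i<length xs. scale (ksign (sum_list (map fst (take i xs))))
      (sym_prod ((map snd xs)[i := bv_dif c h W (snd (xs ! i))])))"
  using assms
proof (induction xs Is rule: list_induct2)
  case Nil
  show ?case
    by (simp add: bv_dif_one)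
next
  case (Cons x xs I Is)
  let ?U = "\<Union>(zpts ` set Is)" and ?V = "\<Union>((\<lambda>I. zpts (shrink I)) ` set Is)"
  have xs: "snd (xs ! i) \<in> span_of (sym_basis (Is ! i) (fst (xs ! i)))" if "i < length Is" for i
    using Cons.prems(1)[of "Suc i"] that by simp
  have IH: "bv_dif c h W (sym_prod (map snd xs)) =
      (\<Sum>i<length xs. scale (ksign (sum_list (map fst (take i xs))))
        (sym_prod ((map snd xs)[i := bv_dif c h W (snd (xs ! i))])))"
    using Cons.prems(2) by (intro Cons.IH xs) auto
  have x: "snd x \<in> span_of (mons (zpts I) (zpts (shrink I)) (fst x))"
    using Cons.prems(1)[of 0] by (simp add: sym_basis_mons)
  have "snd (xs ! i) \<in> span_of (mons ?U ?V (fst (xs ! i)))" if "i < length xs" for i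
  proof -
    have "i < length Is"
      using that Cons.hyps by simp
    then show ?thesis
      using nth_mem[of i Is] by (intro span_mons_mono[OF xs[unfolded sym_basis_mons]]) blast+
  qed
  then have "list_all2 (\<lambda>n f. f \<in> span_of (mons ?U ?V n)) (map fst xs) (map snd xs)"
    by (simp add: list_all2_conv_all_nth)
  then have rest: "sym_prod (map snd xs) \<in> span_of (mons ?U ?V (sum_list (map fst xs)))"
    by (rule sym_prod_mons)
  \<comment> \<open>Interior points of an interval are among its integer points, so disjointness of
    the integer points excludes both kinds of mixed terms.\<close>
  have disj: "zpts (shrink I) \<inter> ?U = {}" "?V \<inter> zpts I = {}"
    using Cons.prems(2) zpts_shrink_nbs by fastforce+
  show ?case
    by (simp add: bv_dif_sym_mult[OF x rest disj] IH sum.lessThan_Suc_shift scale_sum ksign_add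
        del: sum.lessThan_Suc) (simp add: ksign_def)
qed

subsection \<open>Koszul signs\<close>

text \<open>
  Reordering is done by insertion sort on triples (position, degree, factor): inserting a factor
  moves it past the factors at smaller positions.
\<close>

definition koszul_weight :: "nat \<times> int \<times> 'a \<Rightarrow> nat \<times> int \<times> 'a \<Rightarrow> 'r::comm_ring_1" where
  "koszul_weight z w = (if fst w < fst z then ksign (fst (snd z) * fst (snd w)) else 1)"

fun koszul_sign :: "(nat \<times> int \<times> 'a) list \<Rightarrow> 'r::comm_ring_1" where
  "koszul_sign [] = 1"
| "koszul_sign (z # zs) = prod_list (map (koszul_weight z) zs) * koszul_sign zs"

abbreviation homogeneous :: "nat \<times> int \<times> (mon \<Rightarrow>\<^sub>0 'r::comm_ring_1) \<Rightarrow> bool" where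
  "homogeneous z \<equiv> snd (snd z) \<in> span_of (mons UNIV UNIV (fst (snd z)))"

abbreviation factors :: "(nat \<times> int \<times> 'a) list \<Rightarrow> 'a list" where
  "factors zs \<equiv> map (\<lambda>z. snd (snd z)) zs"

lemma factors_fin:
  assumes "\<forall>z\<in>set zs. homogeneous z"
  shows "set (factors zs) \<subseteq> span_of fin_mons"
  using assms span_mons_fin by fastforce

lemma sym_prod_insort:
  fixes z :: "nat \<times> int \<times> (mon \<Rightarrow>\<^sub>0 'r::comm_ring_1)"
  assumes "homogeneous z" "\<forall>w\<in>set zs. homogeneous w" "sorted (map fst zs)"
  shows "sym_prod (factors (insort_key fst z zs))
    = scale (prod_list (map (koszul_weight z) zs)) (sym_mult (snd (snd z)) (sym_prod (factors zs)))"
  using assms(2,3)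
proof (induction zs)
  case (Cons w zs)
  show ?case
  proof (cases "fst z \<le> fst w")
    case True
    \<comment> \<open>As the list is sorted, no position from \<open>w\<close> on is smaller than
      that of \<open>z\<close>, so the factor stops here without further signs.\<close>
    have "koszul_weight z v = (1 :: 'r)" if "v \<in> set (w # zs)" for v
      using True that Cons.prems(2) by (auto simp: koszul_weight_def)
    then have "map (koszul_weight z) (w # zs) = map (\<lambda>_. 1 :: 'r) (w # zs)"
      by (intro map_cong) auto
    then have "prod_list (map (koszul_weight z) (w # zs)) = (1 :: 'r)"
      by (simp only: map_replicate_const prod_list_replicate power_one)
    with True show ?thesis
      by (simp del: list.map(2) add: list.map(2)[of "\<lambda>z. snd (snd z)"])
  next
    case False
    let ?z = "snd (snd z)" and ?w = "snd (snd w)" and ?P = "sym_prod (factors zs)"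
    have fin: "?z \<in> span_of fin_mons" "?w \<in> span_of fin_mons" "?P \<in> span_of fin_mons"
      using assms(1) Cons.prems(1) span_mons_fin sym_prod_fin[OF factors_fin[of zs]] by auto
    have "sym_mult ?w (sym_mult ?z ?P) = sym_mult (sym_mult ?w ?z) ?P"
      by (simp add: sym_mult_assoc fin)
    also have "sym_mult ?w ?z = scale (ksign (fst (snd z) * fst (snd w))) (sym_mult ?z ?w)"
      using sym_mult_commute[of ?w UNIV UNIV "fst (snd w)" ?z "fst (snd z)"] assms(1) Cons.prems(1)
      by (simp add: mult.commute)
    also have "sym_mult (scale (ksign (fst (snd z) * fst (snd w))) (sym_mult ?z ?w)) ?P
        = scale (ksign (fst (snd z) * fst (snd w))) (sym_mult ?z (sym_mult ?w ?P))"
      by (simp add: sym_mult_assoc fin)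
    finally have swap: "sym_mult ?w (sym_mult ?z ?P)
        = scale (ksign (fst (snd z) * fst (snd w))) (sym_mult ?z (sym_mult ?w ?P))" .
    have "sym_prod (factors (insort_key fst z zs))
        = scale (prod_list (map (koszul_weight z) zs)) (sym_mult ?z ?P)"
      using Cons by simp
    moreover have "koszul_weight z w = (ksign (fst (snd z) * fst (snd w)) :: 'r)"
      using False by (simp add: koszul_weight_def)
    ultimately show ?thesis
      using False by (simp add: swap mult.commute)
  qed
qed simp

lemma sym_prod_sort:
  fixes zs :: "(nat \<times> int \<times> (mon \<Rightarrow>\<^sub>0 'r::comm_ring_1)) list"
  assumes "\<forall>z\<in>set zs. homogeneous z"
  shows "sym_prod (factors (sort_key fst zs)) = scale (koszul_sign zs) (sym_prod (factors zs))"
  using assms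
proof (induction zs)
  case (Cons z zs)
  have "mset (map (koszul_weight z) (sort_key fst zs)) = mset (map (koszul_weight z) zs)"
    by simp
  then have weights: "prod_list (map (koszul_weight z) (sort_key fst zs))
      = (prod_list (map (koszul_weight z) zs) :: 'r)"
    by (metis prod_mset_prod_list)
  have "sym_prod (factors (sort_key fst (z # zs))) = scale (prod_list (map (koszul_weight z) zs))
      (sym_mult (snd (snd z)) (sym_prod (factors (sort_key fst zs))))"
    using Cons.prems by (simp add: sym_prod_insort weights)
  with Cons show ?case
    by simp
qed simp

text \<open>Unfolds the recursion into a product over pairs of positions, the shape in which
  \<open>perm_sign\<close> is given.\<close>

lemma koszul_sign_prod:
  "(koszul_sign zs :: 'r::comm_ring_1) = (\<Prod>i<length zs. \<Prod>j\<in>{i<..<length zs}. koszul_weight (zs ! i) (zs ! j))"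
proof (induction zs)
  case (Cons z zs)
  have shift: "(\<Prod>j\<in>{Suc i<..<Suc n}. f j) = (\<Prod>j\<in>{i<..<n}. f (Suc j))"
    "(\<Prod>j\<in>{0<..<Suc n}. f j) = (\<Prod>j<n. f (Suc j))"
    for i n and f :: "nat \<Rightarrow> 'r"
    by (simp_all only: prod.shift_bounds_Suc_ivl lessThan_atLeast0
        flip: atLeastSucLessThan_greaterThanLessThan)
  have "prod_list (map (koszul_weight z) zs)
      = (\<Prod>j<length zs. koszul_weight z (zs ! j) :: 'r)"
    by (simp add: prod.list_conv_set_nth atLeast0LessThan)
  then show ?case
    by (simp add: Cons prod.lessThan_Suc_shift shift del: prod.lessThan_Suc)
qed simp

lemma sym_prod_permute:
  fixes xs :: "(int \<times> (mon \<Rightarrow>\<^sub>0 'r::comm_ring_1)) list"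
  assumes hom: "\<And>x. x \<in> set xs \<Longrightarrow> snd x \<in> span_of (mons UNIV UNIV (fst x))"
    and \<sigma>: "\<sigma> permutes {..<length xs}"
  shows "scale (perm_sign \<sigma> xs) (sym_prod (map snd (permute_list \<sigma> xs))) = sym_prod (map snd xs)"
proof -
  \<comment> \<open>Each factor is tagged with its original position; sorting the permuted list by
    these tags restores the original order.\<close>
  define zs where "zs = map (\<lambda>i. (i, xs ! i)) [0..<length xs]"
  define ws where "ws = permute_list \<sigma> zs"
  have len: "length zs = length xs" "length ws = length xs"
    by (simp_all add: zs_def ws_def)
  have perm: "\<sigma> permutes {..<length zs}"
    using \<sigma> by (simp add: len)
  have \<sigma>_less: "\<sigma> i < length xs" if "i < length xs" for i
    using permutes_in_image[OF \<sigma>, of i] that by simp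
  have nth: "ws ! i = (\<sigma> i, xs ! \<sigma> i)" if "i < length xs" for i
  proof -
    have "ws ! i = zs ! \<sigma> i"
      using that len unfolding ws_def by (intro permute_list_nth[OF perm]) simp
    with that \<sigma>_less show ?thesis
      by (simp add: zs_def)
  qed
  have zs_xs: "map snd zs = xs"
    by (simp add: zs_def comp_def map_nth)
  have mset_eq: "mset ws = mset zs"
    unfolding ws_def by (rule mset_permute_list[OF perm])
  have set_eq: "set ws = set zs"
    using mset_eq by (rule mset_eq_setD)
  have "sort_key fst ws = zs"
  proof (rule sort_key_inj_key_eq[OF mset_eq])
    show "inj_on fst (set ws)"
      unfolding set_eq by (auto simp: zs_def inj_on_def)
    show "sorted (map fst zs)"
      by (simp add: zs_def comp_def)
  qed
  moreover have "\<forall>z\<in>set ws. homogeneous z"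
    unfolding set_eq using hom by (auto simp: zs_def)
  ultimately have sort: "sym_prod (factors zs) = scale (koszul_sign ws) (sym_prod (factors ws))"
    using sym_prod_sort[of ws] by simp
  have factors: "factors ts = map snd (map snd ts)" for ts :: "(nat \<times> int \<times> (mon \<Rightarrow>\<^sub>0 'r)) list"
    by simp
  have "map snd ws = permute_list \<sigma> (map snd zs)"
    unfolding ws_def by (rule permute_list_map[symmetric, OF perm])
  then have "factors ws = map snd (permute_list \<sigma> xs)" "factors zs = map snd xs"
    unfolding factors zs_xs by simp_all
  moreover have "koszul_sign ws = (perm_sign \<sigma> xs :: 'r)"
  proof -
    let ?n = "length xs"
    let ?w = "\<lambda>i j. koszul_weight (ws ! i) (ws ! j) :: 'r"
    have "koszul_sign ws = (\<Prod>(i, j)\<in>Sigma {..<?n} (\<lambda>i. {i<..<?n}). ?w i j)"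
      by (simp add: koszul_sign_prod len prod.Sigma)
    \<comment> \<open>Pairs that \<open>\<sigma>\<close> leaves in order have weight 1, so only the
      inversions contribute.\<close>
    also have "\<dots> = (\<Prod>(i, j)\<in>{(i, j). i < j \<and> j < ?n \<and> \<sigma> j < \<sigma> i}. ?w i j)"
      by (rule prod.mono_neutral_right) (auto simp: nth koszul_weight_def split: if_splits)
    also have "\<dots> = perm_sign \<sigma> xs"
      unfolding perm_sign_def by (rule prod.cong) (auto simp: nth koszul_weight_def)
    finally show ?thesis .
  qed
  ultimately show ?thesis
    using sort by simp
qed

section \<open>The algebra over the operad of intervals\<close>

context
  fixes \<iota> :: "'k::field \<Rightarrow> 'r::comm_ring_1" and \<alpha> :: 'k and h :: 'r and c :: 'r
  assumes \<iota>: "\<iota> 0 = 0" "\<iota> 1 = 1" and c: "c = \<iota> (- (\<alpha> + inverse \<alpha>))"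
begin

abbreviation (input) "A \<equiv> Oq \<iota> \<alpha> h"
abbreviation (input) "prod_map \<equiv> lin_ext (\<lambda>xs. sym_prod (map snd xs)) ::
  ((int \<times> (mon \<Rightarrow>\<^sub>0 'r)) list \<Rightarrow>\<^sub>0 'r) \<Rightarrow> (mon \<Rightarrow>\<^sub>0 'r)"

lemma complexes_Oq: "complexes (map A Is)"
  by unfold_locales (auto simp: Oq_cochain_complex[OF \<iota> c])

lemma htuples_Oq:
  "xs \<in> htuples (map A Is) k \<longleftrightarrow> length xs = length Is \<and> total_deg xs = k \<and>
    (\<forall>i<length Is. snd (xs ! i) \<in> span_of (sym_basis (Is ! i) (fst (xs ! i))))"
  by (auto simp: htuples_def)

lemma prod_map_rel:
  assumes "u \<in> tensor_rel (map A Is) k"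
  shows "prod_map u = 0"
proof -
  interpret complexes "map A Is"
    by (rule complexes_Oq)
  have "tensor_rel (map A Is) k \<subseteq> {u. prod_map u = 0}"
  proof (rule tensor_rel_minimal)
    show "multilinear_relators (map A Is) k \<subseteq> {u. prod_map u = 0}"
      by (auto simp: multilinear_relators_def htuples_Oq map_update sym_prod_update_add
          sym_prod_update_scale)
  qed (simp add: lin_closed_def)
  with assms show ?thesis
    by blast
qed

lemma Oq_mult_translate: "Oq_mult Js J n (translate (tensor_rel (map A Is) k) u) = prod_map u"
proof -
  interpret complexes "map A Is"
    by (rule complexes_Oq)
  have "prod_map v = prod_map u" if "v \<in> translate (tensor_rel (map A Is) k) u" for v
    using that prod_map_rel[of "v - u" Is k] by (simp add: mem_translate)
  moreover have "u \<in> translate (tensor_rel (map A Is) k) u"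
    by (rule translate_self[OF tensor_rel_lin_closed tensor_rel_span])
  ultimately have "prod_map ` translate (tensor_rel (map A Is) k) u = {prod_map u}"
    by blast
  then show ?thesis
    by (simp add: Oq_mult_def)
qed

lemma Oq_mult_pure: "Oq_mult Js J n (pure_tensor (map A Is) xs) = sym_prod (map snd xs)"
proof -
  interpret complexes "map A Is"
    by (rule complexes_Oq)
  show ?thesis
    by (simp add: pure_tensor_translate Oq_mult_translate)
qed

lemma Oq_mult_unit: "Oq_mult Js J n (pure_tensor [A I] [(m, x)]) = x"
  using Oq_mult_pure[of Js J n "[I]" "[(m, x)]"] by simp

lemma htuples_factor_mons:
  assumes "xs \<in> htuples (map A Is) k" "x \<in> set xs"
  shows "snd x \<in> span_of (mons UNIV UNIV (fst x))"
proof -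
  from assms obtain i where "i < length Is" "x = xs ! i"
    by (auto simp: htuples_Oq in_set_conv_nth)
  with assms(1) have "snd x \<in> span_of (sym_basis (Is ! i) (fst x))"
    by (auto simp: htuples_Oq)
  then show ?thesis
    unfolding sym_basis_mons by (rule span_mons_mono) auto
qed

lemma cochain_map_Oq_mult:
  assumes op: "D11_op Is J"
  shows "cochain_map (tensor (map A Is)) (A J) (Oq_mult Is J)"
proof -
  interpret complexes "map A Is"
    by (rule complexes_Oq)
  have Is: "I \<in> D11_colors" "ival I \<subseteq> ival J" if "I \<in> set Is" for I
    using op that by (auto simp: D11_op_def)
  note sub = sym_basis_mono[OF Is]
  have "zpts (Is ! i) \<inter> zpts (Is ! j) = {}" if "i < j" "j < length Is" for i j
  proof -
    have "ival (Is ! i) \<inter> ival (Is ! j) = {}"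
      using op that by (simp add: D11_op_def)
    then show ?thesis
      by (auto simp: ival_def zpts_def)
  qed
  then have disj: "sorted_wrt (\<lambda>I J. zpts I \<inter> zpts J = {}) Is"
    by (simp add: sorted_wrt_iff_nth_less)
  have closed: "sym_prod (map snd xs) \<in> span_of (sym_basis J k)"
    if "xs \<in> htuples (map A Is) k" for xs k
  proof -
    have "snd (xs ! i) \<in> span_of (sym_basis J (fst (xs ! i)))" if "i < length Is" for i
    proof (rule span_of_mono)
      show "snd (xs ! i) \<in> span_of (sym_basis (Is ! i) (fst (xs ! i)))"
        using \<open>xs \<in> htuples (map A Is) k\<close> that by (simp add: htuples_Oq)
      show "sym_basis (Is ! i) (fst (xs ! i)) \<subseteq> sym_basis J (fst (xs ! i))"
        using that by (intro sub) simp_all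
    qed
    then have "list_all2 (\<lambda>n f. f \<in> span_of (mons (zpts J) (zpts (shrink J)) n))
        (map fst xs) (map snd xs)"
      using that by (simp add: list_all2_conv_all_nth htuples_Oq flip: sym_basis_mons)
    from sym_prod_mons[OF this] that show ?thesis
      by (simp add: htuples_Oq sym_basis_mons)
  qed
  have prod_closed: "prod_map u \<in> span_of (sym_basis J k)"
    if "u \<in> span_of (htuples (map A Is) k)" for u k
    by (rule linear_map_span[OF linear_lin_ext that]) (simp add: closed)
  have dif: "prod_map (tensor_dif_tuple (map A Is) xs)
      = bv_dif c h (zpts (shrink J)) (sym_prod (map snd xs))"
    if xs: "xs \<in> htuples (map A Is) k" for xs k
  proof -
    \<comment> \<open>Each factor may be differentiated over the interior points of \<open>J\<close>
      instead of its own interval; the Leibniz formula needs one common operator for all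
      factors.\<close>
    have "dif (map A Is ! i) (fst (xs ! i)) (snd (xs ! i))
        = bv_dif c h (zpts (shrink J)) (snd (xs ! i))" if "i < length Is" for i
    proof -
      have x: "snd (xs ! i) \<in> span_of (sym_basis (Is ! i) (fst (xs ! i)))"
        using xs that by (simp add: htuples_Oq)
      have "zpts (shrink (Is ! i)) \<subseteq> zpts (shrink J)"
        using that by (intro sub) simp_all
      then have "bv_dif c h (zpts (shrink J)) (snd (xs ! i))
          = bv_dif c h (zpts (shrink (Is ! i))) (snd (xs ! i))"
        using x unfolding sym_basis_mons by (intro bv_dif_superset) simp_all
      with that x show ?thesis
        by (simp add: Oq_dif[OF \<iota> c])
    qed
    note dif_entry = this
    have "prod_map (tensor_dif_tuple (map A Is) xs) =
        (\<Sum>i<length xs. scale (ksign (sum_list (map fst (take i xs)))) (sym_prod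
          ((map snd xs)[i := dif (map A Is ! i) (fst (xs ! i)) (snd (xs ! i))])))"
      by (simp only: tensor_dif_tuple_def lin_ext_simps lin_ext_single map_update snd_conv)
    also have "\<dots> =
        (\<Sum>i<length xs. scale (ksign (sum_list (map fst (take i xs))))
          (sym_prod ((map snd xs)[i := bv_dif c h (zpts (shrink J)) (snd (xs ! i))])))"
    proof (rule sum.cong[OF refl])
      fix i
      assume "i \<in> {..<length xs}"
      with xs have "i < length Is"
        by (simp add: htuples_Oq)
      then show "scale (ksign (sum_list (map fst (take i xs)))) (sym_prod
            ((map snd xs)[i := dif (map A Is ! i) (fst (xs ! i)) (snd (xs ! i))]))
          = scale (ksign (sum_list (map fst (take i xs))))
            (sym_prod ((map snd xs)[i := bv_dif c h (zpts (shrink J)) (snd (xs ! i))]))"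
        by (simp only: dif_entry)
    qed
    also have "\<dots> = bv_dif c h (zpts (shrink J)) (sym_prod (map snd xs))"
      using xs by (intro bv_dif_sym_prod[symmetric, OF _ _ disj]) (simp_all add: htuples_Oq)
    finally show ?thesis .
  qed
  have prod_dif: "prod_map (lin_ext (tensor_dif_tuple (map A Is)) u) = dif (A J) k (prod_map u)"
    if u: "u \<in> span_of (htuples (map A Is) k)" for u k
  proof -
    have "prod_map (lin_ext (tensor_dif_tuple (map A Is)) u)
        = bv_dif c h (zpts (shrink J)) (prod_map u)"
    proof (rule linear_map_eqI[where f = u])
      show "linear_map (\<lambda>u. prod_map (lin_ext (tensor_dif_tuple (map A Is)) u))"
        by (rule linear_map_comp[OF linear_lin_ext linear_lin_ext])
      show "linear_map (\<lambda>u. bv_dif c h (zpts (shrink J)) (prod_map u))"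
        by (rule linear_map_comp[OF linear_bv_dif linear_lin_ext])
      fix xs
      assume "xs \<in> Poly_Mapping.keys u"
      with u have "xs \<in> htuples (map A Is) k"
        by (auto simp: span_of_def)
      from dif[OF this]
      show "prod_map (lin_ext (tensor_dif_tuple (map A Is)) (Poly_Mapping.single xs 1))
          = bv_dif c h (zpts (shrink J)) (prod_map (Poly_Mapping.single xs 1))"
        by (simp only: lin_ext_single scale_1)
    qed
    with prod_closed[OF u] show ?thesis
      by (simp add: Oq_dif[OF \<iota> c])
  qed
  show ?thesis
    unfolding cochain_map_def mod_hom_def
  proof (intro conjI allI ballI CollectI)
    show "cochain_complex (tensor (map A Is))"
      by (rule cochain_complex_tensor)
    show "cochain_complex (A J)"
      by (rule Oq_cochain_complex[OF \<iota> c])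
    show "Oq_mult Is J n \<in> carrier (Cmod (tensor (map A Is)) n) \<rightarrow> carrier (Cmod (A J) n)" for n
      by (auto simp: tensor_carrier Oq_mult_translate prod_closed)
  next
    fix n x
    assume "x \<in> carrier (Cmod (tensor (map A Is)) n)"
    then obtain u where u: "u \<in> span_of (htuples (map A Is) n)"
      "x = translate (tensor_rel (map A Is) n) u"
      unfolding tensor_carrier by blast
    show "Oq_mult Is J n (a \<odot>\<^bsub>Cmod (tensor (map A Is)) n\<^esub> x)
        = a \<odot>\<^bsub>Cmod (A J) n\<^esub> Oq_mult Is J n x" for a
      by (simp add: u(2) tensor_smult Oq_mult_translate)
    show "Oq_mult Is J (n + 1) (dif (tensor (map A Is)) n x) = dif (A J) n (Oq_mult Is J n x)"
      by (simp only: u(2) tensor_dif_translate Oq_mult_translate prod_dif[OF u(1)])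
    fix y
    assume "y \<in> carrier (Cmod (tensor (map A Is)) n)"
    then obtain v where v: "v \<in> span_of (htuples (map A Is) n)"
      "y = translate (tensor_rel (map A Is) n) v"
      unfolding tensor_carrier by blast
    show "Oq_mult Is J n (x \<oplus>\<^bsub>Cmod (tensor (map A Is)) n\<^esub> y)
        = Oq_mult Is J n x \<oplus>\<^bsub>Cmod (A J) n\<^esub> Oq_mult Is J n y"
      by (simp add: u(2) v(2) tensor_add Oq_mult_translate)
  qed
qed

lemma Oq_mult_permute:
  assumes xs: "xs \<in> htuples (map A Is) k" and \<sigma>: "\<sigma> permutes {..<length Is}"
  shows "Oq_mult (permute_list \<sigma> Is) J k
      (perm_sign \<sigma> xs \<odot>\<^bsub>Cmod (tensor (map A (permute_list \<sigma> Is))) k\<^esub>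
        pure_tensor (map A (permute_list \<sigma> Is)) (permute_list \<sigma> xs))
    = Oq_mult Is J k (pure_tensor (map A Is) xs)"
proof -
  interpret complexes "map A (permute_list \<sigma> Is)"
    by (rule complexes_Oq)
  have len: "length xs = length Is" and deg: "total_deg xs = k"
    using xs by (simp_all add: htuples_Oq)
  with \<sigma> have \<sigma>': "\<sigma> permutes {..<length xs}"
    by simp
  \<comment> \<open>\<open>pure_tensor\<close> computes its degree from the permuted tuple; equality
    of multisets shows that this degree is \<open>k\<close>, the one in which the scalar
    multiplication is taken.\<close>
  have "mset (map fst (permute_list \<sigma> xs)) = mset (map fst xs)"
    using mset_permute_list[OF \<sigma>'] by simp
  then have "total_deg (permute_list \<sigma> xs) = k"
    unfolding deg[symmetric] by (metis sum_mset_sum_list)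
  then show ?thesis
    using sym_prod_permute[OF htuples_factor_mons[OF xs] \<sigma>']
    by (simp add: pure_tensor_translate tensor_smult Oq_mult_translate Oq_mult_pure)
qed

lemma Oq_mult_compose:
  assumes len: "length xss = length Js"
    and xss: "\<And>i. i < length Js \<Longrightarrow> xss ! i \<in> htuples (map A (Iss ! i)) (total_deg (xss ! i))"
  shows "Oq_mult Js K n
      (pure_tensor (map A Js)
        (map (\<lambda>i. (total_deg (xss ! i),
                   Oq_mult (Iss ! i) (Js ! i) (total_deg (xss ! i))
                     (pure_tensor (map A (Iss ! i)) (xss ! i))))
          [0..<length Js]))
    = Oq_mult (concat Iss) K n (pure_tensor (map A (concat Iss)) (concat xss))"
proof -
  \<comment> \<open>Flattening nested products rests on associativity, which has been established on
    the span of \<open>fin_mons\<close>.\<close>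
  have fin: "set (map snd xs) \<subseteq> span_of fin_mons" if xs: "xs \<in> set xss" for xs
  proof -
    from xs obtain i where "i < length Js" "xs = xss ! i"
      by (auto simp: in_set_conv_nth len)
    with xss have "xs \<in> htuples (map A (Iss ! i)) (total_deg xs)"
      by simp
    from span_mons_fin[OF htuples_factor_mons[OF this]] show ?thesis
      unfolding set_map by (rule image_subsetI)
  qed
  have "sym_prod (map (\<lambda>i. sym_prod (map snd (xss ! i))) [0..<length Js])
      = sym_prod (map sym_prod (map (map snd) (map ((!) xss) [0..<length xss])))"
    by (simp add: len comp_def)
  also have "map ((!) xss) [0..<length xss] = xss"
    by (rule map_nth)
  also have "sym_prod (map sym_prod (map (map snd) xss)) = sym_prod (concat (map (map snd) xss))"
    by (rule sym_prod_concat[symmetric]) (unfold set_map[of "map snd"], erule imageE, simp only: fin)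
  finally have "sym_prod (map (\<lambda>i. sym_prod (map snd (xss ! i))) [0..<length Js])
      = sym_prod (concat (map (map snd) xss))" .
  then show ?thesis
    by (simp add: Oq_mult_pure comp_def flip: map_concat)
qed

lemma locally_constant_Oq: "locally_constant_D11_algebra A Oq_mult"
  unfolding locally_constant_D11_algebra_def D11_algebra_def
proof (intro conjI ballI allI impI)
  show "quasi_isomorphism (A I) (A J) (\<lambda>n x. Oq_mult [I] J n (pure_tensor [A I] [(n, x)]))"
    if "I \<in> D11_colors" "ival I \<subseteq> ival J" for I J
    using that by (intro Oq_quasi_isomorphism \<iota> Oq_mult_unit)
  show "cochain_complex (A I)" for I
    by (rule Oq_cochain_complex[OF \<iota> c])
  show "cochain_map (tensor (map A Is)) (A J) (Oq_mult Is J)" if "D11_op Is J" for Is J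
    using that by (rule cochain_map_Oq_mult)
  show "Oq_mult [I] I n (pure_tensor [A I] [(n, x)]) = x" for I n x
    by (rule Oq_mult_unit)
  show "Oq_mult (permute_list \<sigma> Is) J k
      (perm_sign \<sigma> xs \<odot>\<^bsub>Cmod (tensor (map A (permute_list \<sigma> Is))) k\<^esub>
        pure_tensor (map A (permute_list \<sigma> Is)) (permute_list \<sigma> xs))
      = Oq_mult Is J k (pure_tensor (map A Is) xs)"
    if "xs \<in> htuples (map A Is) k" "D11_op Is J \<and> \<sigma> permutes {..<length Is}" for Is J \<sigma> k xs
    using that by (intro Oq_mult_permute) blast+
  show "Oq_mult Js K (total_deg (concat xss))
      (pure_tensor (map A Js)
        (map (\<lambda>i. (total_deg (xss ! i),
                   Oq_mult (Iss ! i) (Js ! i) (total_deg (xss ! i))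
                     (pure_tensor (map A (Iss ! i)) (xss ! i))))
          [0..<length Js]))
    = Oq_mult (concat Iss) K (total_deg (concat xss)) (pure_tensor (map A (concat Iss)) (concat xss))"
    if "D11_op Js K \<and> length Iss = length Js \<and> length xss = length Js \<and>
        (\<forall>i<length Js. D11_op (Iss ! i) (Js ! i) \<and>
           xss ! i \<in> htuples (map A (Iss ! i)) (total_deg (xss ! i)))" for Iss Js K xss
    using that by (intro Oq_mult_compose) blast+
qed

end

theorem mainTheorem2:
  fixes \<alpha> :: "'k::field_char_0"
  assumes "\<alpha> \<noteq> 0"
  shows "(\<forall>hbar::'k. hbar \<noteq> 0 \<longrightarrow> locally_constant_D11_algebra (Oq (\<lambda>c. c) \<alpha> hbar) Oq_mult) \<and>
    locally_constant_D11_algebra (Oq (\<lambda>c. [:c:]) \<alpha> [:0, 1:]) Oq_mult \<and>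
    locally_constant_D11_algebra (Oq fps_const \<alpha> fps_X) Oq_mult"
proof (intro conjI allI impI)
  show "locally_constant_D11_algebra (Oq (\<lambda>c. c) \<alpha> hbar) Oq_mult" for hbar :: 'k
    by (rule locally_constant_Oq) simp_all
  show "locally_constant_D11_algebra (Oq (\<lambda>c. [:c:]) \<alpha> [:0, 1:]) Oq_mult"
    by (rule locally_constant_Oq) (simp_all add: one_pCons)
  show "locally_constant_D11_algebra (Oq fps_const \<alpha> fps_X) Oq_mult"
    by (rule locally_constant_Oq) simp_all
qed

end
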